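(* Let $K$ be a field, $\delta\in K$, $\mathbf r=(r_1,r_2)$ and $\mathbf p=(p_1,p_2)$ with $r_i\ge p_i\ge0$, and let $D_{\mathbf r}$ be the walled Brauer algebra with parameter $\delta$. For an arbitrary $\mathfrak S_{p_1}\times\mathfrak S_{p_2}$-module $V=V(Y_1,Y_2)$, the $\mathfrak S_{r_1}\times\mathfrak S_{r_2}$-module $(\mathrm{Inf}_{\mathbf p}^{\mathbf r}V)\downarrow^{D_{\mathbf r}}_{\mathfrak S_{r_1}\times\mathfrak S_{r_2}}$ is isomorphic, as a species, to the homogeneous part of degree $r_1$ in sort $Y_1$ and $r_2$ in sort $Y_2$ of the bivariate species $$V(Y_1,Y_2)\cdot H(Y_1\cdot Y_2).$$ When $V(Y_1,Y_2)$ is a permutation representation, the isomorphism is an isomorphism of permutation representations.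
   Context: Walled Brauer diagrams: for $\mathbf r=(r_1,r_2)$, $\mathbf s=(s_1,s_2)$, $D(\mathbf r,\mathbf s)$ is the set of perfect matchings of the $r_1+r_2$ points on the top edge and $s_1+s_2$ points on the bottom edge of a rectangle, with a wall separating the first $r_1$ (resp. $s_1$) points from the last $r_2$ (resp. $s_2$) points, such that strands joining top to bottom do not cross the wall while strands joining two points of the same edge do. Multiplication is $x\cdot y=\delta^{c(x,y)}x\circ y$, obtained by stacking $x$ on top of $y$, $c(x,y)$ being the number of closed loops, which are deleted. $D_{\mathbf r}$ is the algebra with basis $D(\mathbf r,\mathbf r)$; it contains $K(\mathfrak S_{r_1}\times\mathfrak S_{r_2})$ as the span of diagrams with only top-to-bottom strands. The propagating numbers of a diagram are $\mathbf p=(p_1,p_2)$, the numbers of top-to-bottom strands on the left and on the right of the wall; $D(\mathbf r,\mathbf s;\mathbf p)$ is the set of diagrams with propagating numbers $\mathbf p$. $KD(\mathbf p,\mathbf r;\mathbf p)$ is a $K(\mathfrak S_{p_1}\times\mathfrak S_{p_2})$-$D_{\mathbf r}$ bimodule (products with smaller propagating numbers are set to zero), and $\mathrm{Inf}_{\mathbf p}^{\mathbf r}V=V\otimes_{K(\mathfrak S_{p_1}\times\mathfrak S_{p_2})}KD(\mathbf p,\mathbf r;\mathbf p)$. Species: a bivariate species is a functor $F$ from pairs of finite sets with bijections to finite sets or to vector spaces (set valued ones may be linearised); its part of degree $(r_1,r_2)$ is the $\mathfrak S_{r_1}\times\mathfrak S_{r_2}$-representation $F[\{1,\dots,r_1\},\{1,\dots,r_2\}]$,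 and an $\mathfrak S_{p_1}\times\mathfrak S_{p_2}$-module is a species concentrated in degree $(p_1,p_2)$. $(F\cdot G)[U_1,U_2]=\bigoplus F[A_1,A_2]\otimes G[B_1,B_2]$ over all $U_i=A_i\amalg B_i$. $H(Y_1\cdot Y_2)[U_1,U_2]$ is the set of bijections $U_1\to U_2$. Last sentence: if $V=KT$ for an $\mathfrak S_{p_1}\times\mathfrak S_{p_2}$-set $T$, then $(\mathrm{Inf}_{\mathbf p}^{\mathbf r}V)\downarrow$ is the permutation representation of $\mathfrak S_{r_1}\times\mathfrak S_{r_2}$ on the quotient set $T\times_{\mathfrak S_{p_1}\times\mathfrak S_{p_2}}D(\mathbf p,\mathbf r;\mathbf p)$, and this set is isomorphic, as an $\mathfrak S_{r_1}\times\mathfrak S_{r_2}$-set, to the corresponding component of the set-valued species $T\cdot H(Y_1\cdot Y_2)$. *)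

theory Defs
  imports "HOL-Algebra.Module" "HOL-Algebra.AbelCoset" "HOL-Algebra.Group_Action" "HOL-Algebra.Sym_Groups"
    "HOL-Library.Disjoint_Sets"
begin

hide_const (open) Multiset.mult

section \<open>Vector spaces, representations and tensor products\<close>

text \<open>Only the linear structure of the record \<^typ>\<open>('k, 'v) module\<close> matters, except in
  \<open>walled_brauer\<close> and \<open>sym_alg\<close>, where the multiplicative fields are used as well.\<close>

definition mk_module :: "'v set \<Rightarrow> 'v \<Rightarrow> ('v \<Rightarrow> 'v \<Rightarrow> 'v) \<Rightarrow> ('k \<Rightarrow> 'v \<Rightarrow> 'v) \<Rightarrow> ('k, 'v) module" where
  "mk_module C z a s =
     \<lparr>carrier = C, mult = undefined, one = undefined, zero = z, add = a, smult = s\<rparr>"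

definition linear_map ::
    "('k, 'z) ring_scheme \<Rightarrow> ('k, 'v) module \<Rightarrow> ('k, 'w) module \<Rightarrow> ('v \<Rightarrow> 'w) \<Rightarrow> bool" where
  "linear_map K V W f \<longleftrightarrow> f \<in> carrier V \<rightarrow> carrier W \<and>
     (\<forall>v\<in>carrier V. \<forall>v'\<in>carrier V. f (v \<oplus>\<^bsub>V\<^esub> v') = f v \<oplus>\<^bsub>W\<^esub> f v') \<and>
     (\<forall>k\<in>carrier K. \<forall>v\<in>carrier V. f (k \<odot>\<^bsub>V\<^esub> v) = k \<odot>\<^bsub>W\<^esub> f v)"

text \<open>The vector space \<open>KX\<close>, its basis vectors, and the linear map \<open>KX \<rightarrow> KY\<close> induced by
  \<open>m : X \<rightarrow> Y\<close>.\<close>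

definition free_mod :: "('k, 'z) ring_scheme \<Rightarrow> 'x set \<Rightarrow> ('k, 'x \<Rightarrow> 'k) module" where
  "free_mod K X = mk_module
     {f. range f \<subseteq> carrier K \<and> finite {x. f x \<noteq> \<zero>\<^bsub>K\<^esub>} \<and> {x. f x \<noteq> \<zero>\<^bsub>K\<^esub>} \<subseteq> X}
     (\<lambda>x. \<zero>\<^bsub>K\<^esub>) (\<lambda>f g x. f x \<oplus>\<^bsub>K\<^esub> g x) (\<lambda>k f x. k \<otimes>\<^bsub>K\<^esub> f x)"

definition delta :: "('k, 'z) ring_scheme \<Rightarrow> 'x \<Rightarrow> 'x \<Rightarrow> 'k" where
  "delta K x = (\<lambda>y. if y = x then \<one>\<^bsub>K\<^esub> else \<zero>\<^bsub>K\<^esub>)"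

definition push :: "('k, 'z) ring_scheme \<Rightarrow> ('x \<Rightarrow> 'y) \<Rightarrow> ('x \<Rightarrow> 'k) \<Rightarrow> 'y \<Rightarrow> 'k" where
  "push K m f = (\<lambda>y. \<Oplus>\<^bsub>K\<^esub> x \<in> {x. f x \<noteq> \<zero>\<^bsub>K\<^esub> \<and> m x = y}. f x)"

definition dsum :: "'i set \<Rightarrow> ('i \<Rightarrow> ('k, 'v) module) \<Rightarrow> ('k, 'i \<Rightarrow> 'v) module" where
  \<comment> \<open>used for finite index sets only, where direct sum and direct product agree\<close>
  "dsum I V = mk_module (\<Pi>\<^sub>E i\<in>I. carrier (V i)) (\<lambda>i\<in>I. \<zero>\<^bsub>V i\<^esub>)
     (\<lambda>f g. \<lambda>i\<in>I. f i \<oplus>\<^bsub>V i\<^esub> g i) (\<lambda>k f. \<lambda>i\<in>I. k \<odot>\<^bsub>V i\<^esub> f i)"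

definition gen_submodule :: "('k, 'z) ring_scheme \<Rightarrow> ('k, 'v) module \<Rightarrow> 'v set \<Rightarrow> 'v set" where
  "gen_submodule K V S = \<Inter>{N. submodule N K V \<and> S \<subseteq> N}"

definition quot_mod :: "('k, 'v) module \<Rightarrow> 'v set \<Rightarrow> ('k, 'v set) module" where
  "quot_mod V N = mk_module (a_rcosets\<^bsub>V\<^esub> N) N (set_add V) (\<lambda>k X. \<Union>x\<in>X. N +>\<^bsub>V\<^esub> (k \<odot>\<^bsub>V\<^esub> x))"

text \<open>Tensor product over a \<open>K\<close>-algebra with underlying set \<open>A\<close> of a right module \<open>V\<close> with
  action \<open>ra\<close> and a left module \<open>M\<close> with action \<open>la\<close>: the quotient of \<open>K(V \<times> M)\<close> by
  \<open>tensor_rel\<close>.\<close>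

definition tensor_rel ::
    "('k, 'z) ring_scheme \<Rightarrow> 'a set \<Rightarrow> ('v \<Rightarrow> 'a \<Rightarrow> 'v) \<Rightarrow> ('k, 'v) module \<Rightarrow>
     ('a \<Rightarrow> 'm \<Rightarrow> 'm) \<Rightarrow> ('k, 'm) module \<Rightarrow> ('v \<times> 'm \<Rightarrow> 'k) set" where
  "tensor_rel K A ra V la M =
    (let F = free_mod K (carrier V \<times> carrier M); e = (\<lambda>v m. delta K (v, m))
     in gen_submodule K F (
       {e (v \<oplus>\<^bsub>V\<^esub> v') m \<ominus>\<^bsub>F\<^esub> (e v m \<oplus>\<^bsub>F\<^esub> e v' m) | v v' m.
          v \<in> carrier V \<and> v' \<in> carrier V \<and> m \<in> carrier M} \<union>
       {e v (m \<oplus>\<^bsub>M\<^esub> m') \<ominus>\<^bsub>F\<^esub> (e v m \<oplus>\<^bsub>F\<^esub> e v m') | v m m'.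
          v \<in> carrier V \<and> m \<in> carrier M \<and> m' \<in> carrier M} \<union>
       {e (k \<odot>\<^bsub>V\<^esub> v) m \<ominus>\<^bsub>F\<^esub> (k \<odot>\<^bsub>F\<^esub> e v m) | k v m.
          k \<in> carrier K \<and> v \<in> carrier V \<and> m \<in> carrier M} \<union>
       {e v (k \<odot>\<^bsub>M\<^esub> m) \<ominus>\<^bsub>F\<^esub> (k \<odot>\<^bsub>F\<^esub> e v m) | k v m.
          k \<in> carrier K \<and> v \<in> carrier V \<and> m \<in> carrier M} \<union>
       {e (ra v a) m \<ominus>\<^bsub>F\<^esub> e v (la a m) | v a m.
          v \<in> carrier V \<and> a \<in> A \<and> m \<in> carrier M}))"

definition tensor ::
    "('k, 'z) ring_scheme \<Rightarrow> 'a set \<Rightarrow> ('v \<Rightarrow> 'a \<Rightarrow> 'v) \<Rightarrow> ('k, 'v) module \<Rightarrow>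
     ('a \<Rightarrow> 'm \<Rightarrow> 'm) \<Rightarrow> ('k, 'm) module \<Rightarrow> ('k, ('v \<times> 'm \<Rightarrow> 'k) set) module" where
  "tensor K A ra V la M =
     quot_mod (free_mod K (carrier V \<times> carrier M)) (tensor_rel K A ra V la M)"

definition pure_tensor ::
    "('k, 'z) ring_scheme \<Rightarrow> 'a set \<Rightarrow> ('v \<Rightarrow> 'a \<Rightarrow> 'v) \<Rightarrow> ('k, 'v) module \<Rightarrow>
     ('a \<Rightarrow> 'm \<Rightarrow> 'm) \<Rightarrow> ('k, 'm) module \<Rightarrow> 'v \<Rightarrow> 'm \<Rightarrow> ('v \<times> 'm \<Rightarrow> 'k) set" where
  "pure_tensor K A ra V la M v m =
     tensor_rel K A ra V la M +>\<^bsub>free_mod K (carrier V \<times> carrier M)\<^esub> delta K (v, m)"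

text \<open>The linear map into \<open>tensor K A ra V la M\<close> that sends a pure tensor of \<open>x\<close> and \<open>y\<close> to
  that of \<open>f x\<close> and \<open>g y\<close>.\<close>

definition tensor_map ::
    "('k, 'z) ring_scheme \<Rightarrow> 'a set \<Rightarrow> ('v \<Rightarrow> 'a \<Rightarrow> 'v) \<Rightarrow> ('k, 'v) module \<Rightarrow>
     ('a \<Rightarrow> 'm \<Rightarrow> 'm) \<Rightarrow> ('k, 'm) module \<Rightarrow> ('x \<Rightarrow> 'v) \<Rightarrow> ('y \<Rightarrow> 'm) \<Rightarrow>
     ('x \<times> 'y \<Rightarrow> 'k) set \<Rightarrow> ('v \<times> 'm \<Rightarrow> 'k) set" where
  "tensor_map K A ra V la M f g X =
     (\<Union>x\<in>X. tensor_rel K A ra V la M +>\<^bsub>free_mod K (carrier V \<times> carrier M)\<^esub>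
               push K (map_prod f g) x)"

abbreviation tensor_K ::
    "('k, 'z) ring_scheme \<Rightarrow> ('k, 'v) module \<Rightarrow> ('k, 'w) module \<Rightarrow>
     ('k, ('v \<times> 'w \<Rightarrow> 'k) set) module" where
  "tensor_K K V W \<equiv> tensor K (carrier K) (\<lambda>v k. k \<odot>\<^bsub>V\<^esub> v) V (smult W) W"

abbreviation pure_tensor_K ::
    "('k, 'z) ring_scheme \<Rightarrow> ('k, 'v) module \<Rightarrow> ('k, 'w) module \<Rightarrow> 'v \<Rightarrow> 'w \<Rightarrow>
     ('v \<times> 'w \<Rightarrow> 'k) set" where
  "pure_tensor_K K V W \<equiv> pure_tensor K (carrier K) (\<lambda>v k. k \<odot>\<^bsub>V\<^esub> v) V (smult W) W"

abbreviation tensor_map_K ::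
    "('k, 'z) ring_scheme \<Rightarrow> ('k, 'v) module \<Rightarrow> ('k, 'w) module \<Rightarrow> ('x \<Rightarrow> 'v) \<Rightarrow> ('y \<Rightarrow> 'w) \<Rightarrow>
     ('x \<times> 'y \<Rightarrow> 'k) set \<Rightarrow> ('v \<times> 'w \<Rightarrow> 'k) set" where
  "tensor_map_K K V W \<equiv> tensor_map K (carrier K) (\<lambda>v k. k \<odot>\<^bsub>V\<^esub> v) V (smult W) W"

definition is_rep ::
    "('k, 'z) ring_scheme \<Rightarrow> 'g monoid \<Rightarrow> ('k, 'v) module \<Rightarrow> ('g \<Rightarrow> 'v \<Rightarrow> 'v) \<Rightarrow> bool" where
  "is_rep K G V \<rho> \<longleftrightarrow> module K V \<and> group_action G (carrier V) \<rho> \<and>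
     (\<forall>g\<in>carrier G. linear_map K V V (\<rho> g))"

definition rep_iso ::
    "('k, 'z) ring_scheme \<Rightarrow> 'g monoid \<Rightarrow> ('k, 'v) module \<Rightarrow> ('g \<Rightarrow> 'v \<Rightarrow> 'v) \<Rightarrow>
     ('k, 'w) module \<Rightarrow> ('g \<Rightarrow> 'w \<Rightarrow> 'w) \<Rightarrow> ('v \<Rightarrow> 'w) \<Rightarrow> bool" where
  "rep_iso K G V \<rho> W \<sigma> \<Phi> \<longleftrightarrow> linear_map K V W \<Phi> \<and> bij_betw \<Phi> (carrier V) (carrier W) \<and>
     (\<forall>g\<in>carrier G. \<forall>v\<in>carrier V. \<Phi> (\<rho> g v) = \<sigma> g (\<Phi> v))"

definition gset_iso ::
    "'g monoid \<Rightarrow> 'x set \<Rightarrow> ('g \<Rightarrow> 'x \<Rightarrow> 'x) \<Rightarrow> 'y set \<Rightarrow> ('g \<Rightarrow> 'y \<Rightarrow> 'y) \<Rightarrow> ('x \<Rightarrow> 'y) \<Rightarrow> bool" where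
  "gset_iso G X \<alpha> Y \<beta> \<phi> \<longleftrightarrow> bij_betw \<phi> X Y \<and>
     (\<forall>g\<in>carrier G. \<forall>x\<in>X. \<phi> (\<alpha> g x) = \<beta> g (\<phi> x))"

text \<open>The representation \<open>V\<close> is the permutation representation \<open>KX\<close> on the \<open>G\<close>-set \<open>X\<close>, through
  the linear extension of \<open>b : X \<rightarrow> V\<close>.\<close>

definition perm_rep ::
    "('k, 'z) ring_scheme \<Rightarrow> 'g monoid \<Rightarrow> 'x set \<Rightarrow> ('g \<Rightarrow> 'x \<Rightarrow> 'x) \<Rightarrow>
     ('k, 'v) module \<Rightarrow> ('g \<Rightarrow> 'v \<Rightarrow> 'v) \<Rightarrow> ('x \<Rightarrow> 'v) \<Rightarrow> bool" where
  "perm_rep K G X \<alpha> V \<rho> b \<longleftrightarrow> b \<in> X \<rightarrow> carrier V \<and>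
     (\<forall>g\<in>carrier G. \<forall>x\<in>X. \<alpha> g x \<in> X \<and> b (\<alpha> g x) = \<rho> g (b x)) \<and>
     bij_betw (\<lambda>f. \<Oplus>\<^bsub>V\<^esub> x \<in> {x. f x \<noteq> \<zero>\<^bsub>K\<^esub>}. f x \<odot>\<^bsub>V\<^esub> b x) (carrier (free_mod K X)) (carrier V)"


section \<open>Walled Brauer diagrams\<close>

datatype level = Top | Mid | Bot
datatype side = Lft | Rgt

text \<open>A point is given by its edge, its side of the wall and its position there.  The level
  \<open>Mid\<close> occurs only while two diagrams are being stacked.\<close>

type_synonym point = "level \<times> side \<times> nat"
type_synonym diagram = "point set set"

fun sel :: "side \<Rightarrow> 'a \<times> 'a \<Rightarrow> 'a" where
  "sel Lft x = fst x"
| "sel Rgt x = snd x"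

definition points :: "nat \<times> nat \<Rightarrow> nat \<times> nat \<Rightarrow> point set" where
  "points r s = {(Top, w, i) | w i. i \<in> {1..sel w r}} \<union> {(Bot, w, i) | w i. i \<in> {1..sel w s}}"

definition diagrams :: "nat \<times> nat \<Rightarrow> nat \<times> nat \<Rightarrow> diagram set" where
  "diagrams r s = {d. partition_on (points r s) d \<and> (\<forall>e\<in>d. card e = 2) \<and>
     (\<forall>l w i l' w' j. {(l, w, i), (l', w', j)} \<in> d \<longrightarrow> (l \<noteq> l' \<longleftrightarrow> w = w'))}"

definition prop_number :: "side \<Rightarrow> diagram \<Rightarrow> nat" where
  "prop_number w d = card {e \<in> d. \<exists>i j. e = {(Top, w, i), (Bot, w, j)}}"

definition prop_diagrams :: "nat \<times> nat \<Rightarrow> nat \<times> nat \<Rightarrow> nat \<times> nat \<Rightarrow> diagram set" where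
  "prop_diagrams r s p = {d \<in> diagrams r s. \<forall>w. prop_number w d = sel w p}"

definition relevel :: "(level \<Rightarrow> level) \<Rightarrow> diagram \<Rightarrow> diagram" where
  "relevel f d = (\<lambda>e. (\<lambda>(l, w, i). (f l, w, i)) ` e) ` d"

text \<open>The strands and loops of the stack of \<open>x\<close> on top of \<open>y\<close>, as sets of points.\<close>

definition stack_components :: "diagram \<Rightarrow> diagram \<Rightarrow> point set set" where
  "stack_components x y =
    (let E = relevel (\<lambda>l. if l = Bot then Mid else l) x \<union> relevel (\<lambda>l. if l = Top then Mid else l) y
     in \<Union>E // {(a, b). {a, b} \<in> E}\<^sup>*)"

definition mid_points :: "point set" where
  "mid_points = {(l, w, i). l = Mid}"

definition loops :: "diagram \<Rightarrow> diagram \<Rightarrow> nat" where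
  "loops x y = card {C \<in> stack_components x y. C \<subseteq> mid_points}"

definition dcomp :: "diagram \<Rightarrow> diagram \<Rightarrow> diagram" where
  "dcomp x y = {C - mid_points | C. C \<in> stack_components x y \<and> \<not> C \<subseteq> mid_points}"

text \<open>The product \<open>x \<cdot> y = \<delta>\<^sup>c\<^sup>(\<^sup>x\<^sup>,\<^sup>y\<^sup>) x \<circ> y\<close>, extended bilinearly to a map \<open>KX \<times> KY \<rightarrow> KZ\<close>;
  composites outside \<open>Z\<close> are set to zero.\<close>

definition dmult ::
    "('k, 'z) ring_scheme \<Rightarrow> 'k \<Rightarrow> diagram set \<Rightarrow> diagram set \<Rightarrow> diagram set \<Rightarrow>
     (diagram \<Rightarrow> 'k) \<Rightarrow> (diagram \<Rightarrow> 'k) \<Rightarrow> diagram \<Rightarrow> 'k" where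
  "dmult K \<delta> X Y Z f g = (\<lambda>z. if z \<in> Z
     then \<Oplus>\<^bsub>K\<^esub> q \<in> {q \<in> X \<times> Y. dcomp (fst q) (snd q) = z}.
            (\<delta> [^]\<^bsub>K\<^esub> loops (fst q) (snd q)) \<otimes>\<^bsub>K\<^esub> (f (fst q) \<otimes>\<^bsub>K\<^esub> g (snd q))
     else \<zero>\<^bsub>K\<^esub>)"

abbreviation Sym :: "nat \<times> nat \<Rightarrow> ((nat \<Rightarrow> nat) \<times> (nat \<Rightarrow> nat)) monoid" where
  "Sym r \<equiv> sym_group (fst r) \<times>\<times> sym_group (snd r)"

text \<open>With this direction of the strands \<open>dcomp (perm_diagram r g) (perm_diagram r h)\<close> is the
  diagram of the product \<open>g h\<close> in \<open>Sym r\<close>.\<close>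

definition perm_diagram :: "nat \<times> nat \<Rightarrow> (nat \<Rightarrow> nat) \<times> (nat \<Rightarrow> nat) \<Rightarrow> diagram" where
  "perm_diagram r g = {{(Top, w, sel w g i), (Bot, w, i)} | w i. i \<in> {1..sel w r}}"

definition walled_brauer ::
    "('k, 'z) ring_scheme \<Rightarrow> 'k \<Rightarrow> nat \<times> nat \<Rightarrow> ('k, diagram \<Rightarrow> 'k) module" where
  "walled_brauer K \<delta> r = (free_mod K (diagrams r r))
     \<lparr>mult := dmult K \<delta> (diagrams r r) (diagrams r r) (diagrams r r),
      one := delta K (perm_diagram r (id, id))\<rparr>"

text \<open>The group algebra of \<open>Sym r\<close>, as a subalgebra of \<open>walled_brauer K \<delta> r\<close>.\<close>

definition sym_alg ::
    "('k, 'z) ring_scheme \<Rightarrow> 'k \<Rightarrow> nat \<times> nat \<Rightarrow> ('k, diagram \<Rightarrow> 'k) module" where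
  "sym_alg K \<delta> r = (walled_brauer K \<delta> r)\<lparr>carrier := carrier (free_mod K (prop_diagrams r r r))\<rparr>"


section \<open>Inflation\<close>

text \<open>A representation \<open>\<rho>\<close> of \<open>Sym p\<close> is a right module over its group algebra through
  \<open>v \<cdot> g = \<rho> (g\<^sup>-\<^sup>1) v\<close>.\<close>

definition rep_right_act ::
    "nat \<times> nat \<Rightarrow> ('k, 'v) module \<Rightarrow> ((nat \<Rightarrow> nat) \<times> (nat \<Rightarrow> nat) \<Rightarrow> 'v \<Rightarrow> 'v) \<Rightarrow>
     'v \<Rightarrow> (diagram \<Rightarrow> 'k) \<Rightarrow> 'v" where
  "rep_right_act p V \<rho> v a =
     (\<Oplus>\<^bsub>V\<^esub> g \<in> carrier (Sym p). a (perm_diagram p g) \<odot>\<^bsub>V\<^esub> \<rho> (inv\<^bsub>Sym p\<^esub> g) v)"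

definition bimod_left ::
    "('k, 'z) ring_scheme \<Rightarrow> 'k \<Rightarrow> nat \<times> nat \<Rightarrow> nat \<times> nat \<Rightarrow>
     (diagram \<Rightarrow> 'k) \<Rightarrow> (diagram \<Rightarrow> 'k) \<Rightarrow> diagram \<Rightarrow> 'k" where
  "bimod_left K \<delta> p r = dmult K \<delta> (diagrams p p) (prop_diagrams p r p) (prop_diagrams p r p)"

definition bimod_right ::
    "('k, 'z) ring_scheme \<Rightarrow> 'k \<Rightarrow> nat \<times> nat \<Rightarrow> nat \<times> nat \<Rightarrow>
     (diagram \<Rightarrow> 'k) \<Rightarrow> (diagram \<Rightarrow> 'k) \<Rightarrow> diagram \<Rightarrow> 'k" where
  "bimod_right K \<delta> p r = dmult K \<delta> (prop_diagrams p r p) (diagrams r r) (prop_diagrams p r p)"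

definition infl ::
    "('k, 'z) ring_scheme \<Rightarrow> 'k \<Rightarrow> nat \<times> nat \<Rightarrow> nat \<times> nat \<Rightarrow> ('k, 'v) module \<Rightarrow>
     ((nat \<Rightarrow> nat) \<times> (nat \<Rightarrow> nat) \<Rightarrow> 'v \<Rightarrow> 'v) \<Rightarrow>
     ('k, ('v \<times> (diagram \<Rightarrow> 'k) \<Rightarrow> 'k) set) module" where
  "infl K \<delta> p r V \<rho> =
     tensor K (carrier (sym_alg K \<delta> p)) (rep_right_act p V \<rho>) V
       (bimod_left K \<delta> p r) (free_mod K (prop_diagrams p r p))"

definition infl_pure ::
    "('k, 'z) ring_scheme \<Rightarrow> 'k \<Rightarrow> nat \<times> nat \<Rightarrow> nat \<times> nat \<Rightarrow> ('k, 'v) module \<Rightarrow>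
     ((nat \<Rightarrow> nat) \<times> (nat \<Rightarrow> nat) \<Rightarrow> 'v \<Rightarrow> 'v) \<Rightarrow>
     'v \<Rightarrow> (diagram \<Rightarrow> 'k) \<Rightarrow> ('v \<times> (diagram \<Rightarrow> 'k) \<Rightarrow> 'k) set" where
  "infl_pure K \<delta> p r V \<rho> =
     pure_tensor K (carrier (sym_alg K \<delta> p)) (rep_right_act p V \<rho>) V
       (bimod_left K \<delta> p r) (free_mod K (prop_diagrams p r p))"

definition infl_act ::
    "('k, 'z) ring_scheme \<Rightarrow> 'k \<Rightarrow> nat \<times> nat \<Rightarrow> nat \<times> nat \<Rightarrow> ('k, 'v) module \<Rightarrow>
     ((nat \<Rightarrow> nat) \<times> (nat \<Rightarrow> nat) \<Rightarrow> 'v \<Rightarrow> 'v) \<Rightarrow>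
     ('v \<times> (diagram \<Rightarrow> 'k) \<Rightarrow> 'k) set \<Rightarrow> (diagram \<Rightarrow> 'k) \<Rightarrow> ('v \<times> (diagram \<Rightarrow> 'k) \<Rightarrow> 'k) set" where
  "infl_act K \<delta> p r V \<rho> =
     (\<lambda>X \<in> carrier (infl K \<delta> p r V \<rho>). \<lambda>b \<in> carrier (walled_brauer K \<delta> r).
       tensor_map K (carrier (sym_alg K \<delta> p)) (rep_right_act p V \<rho>) V
         (bimod_left K \<delta> p r) (free_mod K (prop_diagrams p r p))
         (\<lambda>v. v) (\<lambda>m. bimod_right K \<delta> p r m b) X)"

text \<open>The representation of \<open>Sym r\<close> that underlies a right \<open>walled_brauer K \<delta> r\<close>-module with
  action \<open>act\<close>.\<close>

definition restrict_sym ::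
    "('k, 'z) ring_scheme \<Rightarrow> nat \<times> nat \<Rightarrow> ('x \<Rightarrow> (diagram \<Rightarrow> 'k) \<Rightarrow> 'x) \<Rightarrow>
     (nat \<Rightarrow> nat) \<times> (nat \<Rightarrow> nat) \<Rightarrow> 'x \<Rightarrow> 'x" where
  "restrict_sym K r act g x = act x (delta K (perm_diagram r (inv\<^bsub>Sym r\<^esub> g)))"

text \<open>The quotient \<open>T \<times>\<^bsub>Sym p\<^esub> D(p, r; p)\<close>.  Since \<open>t \<cdot> g = \<alpha> (g\<^sup>-\<^sup>1) t\<close>, identifying
  \<open>(t \<cdot> g, d)\<close> with \<open>(t, g d)\<close> means passing to the orbits of the diagonal left action.\<close>

definition quot_set ::
    "nat \<times> nat \<Rightarrow> nat \<times> nat \<Rightarrow> 't set \<Rightarrow> ((nat \<Rightarrow> nat) \<times> (nat \<Rightarrow> nat) \<Rightarrow> 't \<Rightarrow> 't) \<Rightarrow>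
     ('t \<times> diagram) set set" where
  "quot_set p r T \<alpha> =
     orbits (Sym p) (T \<times> prop_diagrams p r p) (\<lambda>g (t, d). (\<alpha> g t, dcomp (perm_diagram p g) d))"

definition quot_set_act ::
    "nat \<times> nat \<Rightarrow> (nat \<Rightarrow> nat) \<times> (nat \<Rightarrow> nat) \<Rightarrow> ('t \<times> diagram) set \<Rightarrow> ('t \<times> diagram) set" where
  "quot_set_act r g X = (\<lambda>(t, d). (t, dcomp d (perm_diagram r (inv\<^bsub>Sym r\<^esub> g)))) ` X"

text \<open>The class of \<open>(t, d)\<close> goes to the pure tensor of \<open>b t\<close> and \<open>d\<close>.\<close>

definition quot_set_basis ::
    "('k, 'z) ring_scheme \<Rightarrow> 'k \<Rightarrow> nat \<times> nat \<Rightarrow> nat \<times> nat \<Rightarrow> ('k, 'v) module \<Rightarrow>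
     ((nat \<Rightarrow> nat) \<times> (nat \<Rightarrow> nat) \<Rightarrow> 'v \<Rightarrow> 'v) \<Rightarrow> ('t \<Rightarrow> 'v) \<Rightarrow>
     ('t \<times> diagram) set \<Rightarrow> ('v \<times> (diagram \<Rightarrow> 'k) \<Rightarrow> 'k) set" where
  "quot_set_basis K \<delta> p r V \<rho> b X =
     the_elem ((\<lambda>(t, d). infl_pure K \<delta> p r V \<rho> (b t) (delta K d)) ` X)"


section \<open>Bivariate species\<close>

text \<open>The second field is the transport along a pair of bijections defined on \<open>U\<close>; the target
  is the image of \<open>U\<close>.\<close>

record ('u, 'x) set_species =
  sobj :: "'u set \<times> 'u set \<Rightarrow> 'x set"
  smap :: "'u set \<times> 'u set \<Rightarrow> ('u \<Rightarrow> 'u) \<times> ('u \<Rightarrow> 'u) \<Rightarrow> 'x \<Rightarrow> 'x"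

record ('u, 'k, 'v) lin_species =
  lobj :: "'u set \<times> 'u set \<Rightarrow> ('k, 'v) module"
  lmap :: "'u set \<times> 'u set \<Rightarrow> ('u \<Rightarrow> 'u) \<times> ('u \<Rightarrow> 'u) \<Rightarrow> 'v \<Rightarrow> 'v"

definition im2 :: "('u \<Rightarrow> 'u) \<times> ('u \<Rightarrow> 'u) \<Rightarrow> 'u set \<times> 'u set \<Rightarrow> 'u set \<times> 'u set" where
  "im2 \<sigma> U = (fst \<sigma> ` fst U, snd \<sigma> ` snd U)"

definition vim2 :: "'u set \<times> 'u set \<Rightarrow> ('u \<Rightarrow> 'u) \<times> ('u \<Rightarrow> 'u) \<Rightarrow> 'u set \<times> 'u set \<Rightarrow> 'u set \<times> 'u set" where
  "vim2 U \<sigma> A = (fst U \<inter> fst \<sigma> -` fst A, snd U \<inter> snd \<sigma> -` snd A)"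

definition diff2 :: "'u set \<times> 'u set \<Rightarrow> 'u set \<times> 'u set \<Rightarrow> 'u set \<times> 'u set" where
  "diff2 U A = (fst U - fst A, snd U - snd A)"

definition fin2 :: "'u set \<times> 'u set \<Rightarrow> bool" where
  "fin2 U \<longleftrightarrow> finite (fst U) \<and> finite (snd U)"

definition inj2 :: "'u set \<times> 'u set \<Rightarrow> ('u \<Rightarrow> 'u) \<times> ('u \<Rightarrow> 'u) \<Rightarrow> bool" where
  "inj2 U \<sigma> \<longleftrightarrow> inj_on (fst \<sigma>) (fst U) \<and> inj_on (snd \<sigma>) (snd U)"

definition comp2 :: "('u \<Rightarrow> 'u) \<times> ('u \<Rightarrow> 'u) \<Rightarrow> ('u \<Rightarrow> 'u) \<times> ('u \<Rightarrow> 'u) \<Rightarrow> ('u \<Rightarrow> 'u) \<times> ('u \<Rightarrow> 'u)" where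
  "comp2 \<tau> \<sigma> = (fst \<tau> \<circ> fst \<sigma>, snd \<tau> \<circ> snd \<sigma>)"

definition eq2_on :: "'u set \<times> 'u set \<Rightarrow> ('u \<Rightarrow> 'u) \<times> ('u \<Rightarrow> 'u) \<Rightarrow> ('u \<Rightarrow> 'u) \<times> ('u \<Rightarrow> 'u) \<Rightarrow> bool" where
  "eq2_on U \<sigma> \<tau> \<longleftrightarrow> (\<forall>i\<in>fst U. fst \<sigma> i = fst \<tau> i) \<and> (\<forall>i\<in>snd U. snd \<sigma> i = snd \<tau> i)"

locale is_set_species =
  fixes F :: "('u, 'x) set_species"
  assumes smap_closed: "fin2 U \<Longrightarrow> inj2 U \<sigma> \<Longrightarrow> smap F U \<sigma> \<in> sobj F U \<rightarrow> sobj F (im2 \<sigma> U)"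
    and smap_cong: "fin2 U \<Longrightarrow> inj2 U \<sigma> \<Longrightarrow> eq2_on U \<sigma> \<tau> \<Longrightarrow> x \<in> sobj F U \<Longrightarrow>
      smap F U \<sigma> x = smap F U \<tau> x"
    and smap_id: "fin2 U \<Longrightarrow> x \<in> sobj F U \<Longrightarrow> smap F U (id, id) x = x"
    and smap_comp: "fin2 U \<Longrightarrow> inj2 U \<sigma> \<Longrightarrow> inj2 (im2 \<sigma> U) \<tau> \<Longrightarrow> x \<in> sobj F U \<Longrightarrow>
      smap F U (comp2 \<tau> \<sigma>) x = smap F (im2 \<sigma> U) \<tau> (smap F U \<sigma> x)"

locale is_lin_species =
  fixes K :: "('k, 'z) ring_scheme" and F :: "('u, 'k, 'v) lin_species"
  assumes lobj_module: "fin2 U \<Longrightarrow> module K (lobj F U)"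
    and lmap_linear: "fin2 U \<Longrightarrow> inj2 U \<sigma> \<Longrightarrow>
      linear_map K (lobj F U) (lobj F (im2 \<sigma> U)) (lmap F U \<sigma>)"
    and lmap_cong: "fin2 U \<Longrightarrow> inj2 U \<sigma> \<Longrightarrow> eq2_on U \<sigma> \<tau> \<Longrightarrow> v \<in> carrier (lobj F U) \<Longrightarrow>
      lmap F U \<sigma> v = lmap F U \<tau> v"
    and lmap_id: "fin2 U \<Longrightarrow> v \<in> carrier (lobj F U) \<Longrightarrow> lmap F U (id, id) v = v"
    and lmap_comp: "fin2 U \<Longrightarrow> inj2 U \<sigma> \<Longrightarrow> inj2 (im2 \<sigma> U) \<tau> \<Longrightarrow> v \<in> carrier (lobj F U) \<Longrightarrow>
      lmap F U (comp2 \<tau> \<sigma>) v = lmap F (im2 \<sigma> U) \<tau> (lmap F U \<sigma> v)"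

definition lin_of ::
    "('k, 'z) ring_scheme \<Rightarrow> ('u, 'x) set_species \<Rightarrow> ('u, 'k, 'x \<Rightarrow> 'k) lin_species" where
  "lin_of K F = \<lparr>lobj = (\<lambda>U. free_mod K (sobj F U)), lmap = (\<lambda>U \<sigma>. push K (smap F U \<sigma>))\<rparr>"

text \<open>In a decomposition of \<open>U\<close> as a disjoint union of \<open>A\<close> and \<open>B\<close>, both pairs of sets, \<open>B\<close> is
  determined by \<open>A\<close>, so that \<open>A\<close> alone serves as the index.\<close>

definition parts :: "'u set \<times> 'u set \<Rightarrow> ('u set \<times> 'u set) set" where
  "parts U = Pow (fst U) \<times> Pow (snd U)"

definition set_prod ::
    "('u, 'x) set_species \<Rightarrow> ('u, 'y) set_species \<Rightarrow> ('u, ('u set \<times> 'u set) \<times> 'x \<times> 'y) set_species"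
  where
  "set_prod F G =
    \<lparr>sobj = (\<lambda>U. SIGMA A : parts U. sobj F A \<times> sobj G (diff2 U A)),
     smap = (\<lambda>U \<sigma> (A, x, y). (im2 \<sigma> A, smap F A \<sigma> x, smap G (diff2 U A) \<sigma> y))\<rparr>"

definition lin_prod ::
    "('k, 'z) ring_scheme \<Rightarrow> ('u, 'k, 'v) lin_species \<Rightarrow> ('u, 'k, 'w) lin_species \<Rightarrow>
     ('u, 'k, 'u set \<times> 'u set \<Rightarrow> ('v \<times> 'w \<Rightarrow> 'k) set) lin_species" where
  "lin_prod K F G =
    \<lparr>lobj = (\<lambda>U. dsum (parts U) (\<lambda>A. tensor_K K (lobj F A) (lobj G (diff2 U A)))),
     lmap = (\<lambda>U \<sigma> f. \<lambda>A' \<in> parts (im2 \<sigma> U). let A = vim2 U \<sigma> A' in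
        tensor_map_K K (lobj F A') (lobj G (diff2 (im2 \<sigma> U) A'))
          (lmap F A \<sigma>) (lmap G (diff2 U A) \<sigma>) (f A))\<rparr>"

text \<open>\<open>H(Y\<^sub>1 \<cdot> Y\<^sub>2)\<close>.\<close>

definition bij_species :: "('u, 'u \<Rightarrow> 'u) set_species" where
  "bij_species =
    \<lparr>sobj = (\<lambda>U. {h \<in> extensional (fst U). bij_betw h (fst U) (snd U)}),
     smap = (\<lambda>U \<sigma> h. \<lambda>x \<in> fst \<sigma> ` fst U. snd \<sigma> (h (inv_into (fst U) (fst \<sigma>) x)))\<rparr>"

text \<open>The species concentrated in degree \<open>p\<close> that corresponds to a representation of \<open>Sym p\<close> (or
  to a \<open>Sym p\<close>-set).  Its value on \<open>U\<close> consists of the equivariant functions from the \<open>Sym p\<close>-torsor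
  of pairs of bijections \<open>{1..p\<^sub>i} \<rightarrow> U\<^sub>i\<close>.  If there are no such bijections, then the formula gives the
  zero space; for sets, the empty value has to be prescribed.\<close>

definition frames ::
    "nat \<times> nat \<Rightarrow> 'u set \<times> 'u set \<Rightarrow> ((nat \<Rightarrow> 'u) \<times> (nat \<Rightarrow> 'u)) set" where
  "frames p U =
     {\<beta> \<in> extensional {1..fst p}. bij_betw \<beta> {1..fst p} (fst U)} \<times>
     {\<beta> \<in> extensional {1..snd p}. bij_betw \<beta> {1..snd p} (snd U)}"

definition frame_right ::
    "nat \<times> nat \<Rightarrow> (nat \<Rightarrow> 'u) \<times> (nat \<Rightarrow> 'u) \<Rightarrow> (nat \<Rightarrow> nat) \<times> (nat \<Rightarrow> nat) \<Rightarrow>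
     (nat \<Rightarrow> 'u) \<times> (nat \<Rightarrow> 'u)" where
  "frame_right p \<beta> g = (\<lambda>i\<in>{1..fst p}. fst \<beta> (fst g i), \<lambda>i\<in>{1..snd p}. snd \<beta> (snd g i))"

definition frame_pull ::
    "nat \<times> nat \<Rightarrow> 'u set \<times> 'u set \<Rightarrow> ('u \<Rightarrow> 'u) \<times> ('u \<Rightarrow> 'u) \<Rightarrow>
     (nat \<Rightarrow> 'u) \<times> (nat \<Rightarrow> 'u) \<Rightarrow> (nat \<Rightarrow> 'u) \<times> (nat \<Rightarrow> 'u)" where
  "frame_pull p U \<sigma> \<beta> =
     (\<lambda>i\<in>{1..fst p}. inv_into (fst U) (fst \<sigma>) (fst \<beta> i),
      \<lambda>i\<in>{1..snd p}. inv_into (snd U) (snd \<sigma>) (snd \<beta> i))"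

definition equivariant ::
    "nat \<times> nat \<Rightarrow> 'x set \<Rightarrow> ((nat \<Rightarrow> nat) \<times> (nat \<Rightarrow> nat) \<Rightarrow> 'x \<Rightarrow> 'x) \<Rightarrow> 'u set \<times> 'u set \<Rightarrow>
     ((nat \<Rightarrow> 'u) \<times> (nat \<Rightarrow> 'u) \<Rightarrow> 'x) set" where
  "equivariant p X \<alpha> U = {f \<in> frames p U \<rightarrow>\<^sub>E X.
     \<forall>\<beta>\<in>frames p U. \<forall>g\<in>carrier (Sym p). f (frame_right p \<beta> g) = \<alpha> (inv\<^bsub>Sym p\<^esub> g) (f \<beta>)}"

definition module_species ::
    "nat \<times> nat \<Rightarrow> ('k, 'v) module \<Rightarrow> ((nat \<Rightarrow> nat) \<times> (nat \<Rightarrow> nat) \<Rightarrow> 'v \<Rightarrow> 'v) \<Rightarrow>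
     ('u, 'k, (nat \<Rightarrow> 'u) \<times> (nat \<Rightarrow> 'u) \<Rightarrow> 'v) lin_species" where
  "module_species p V \<rho> =
    \<lparr>lobj = (\<lambda>U. mk_module (equivariant p (carrier V) \<rho> U) (\<lambda>\<beta>\<in>frames p U. \<zero>\<^bsub>V\<^esub>)
        (\<lambda>f h. \<lambda>\<beta>\<in>frames p U. f \<beta> \<oplus>\<^bsub>V\<^esub> h \<beta>) (\<lambda>k f. \<lambda>\<beta>\<in>frames p U. k \<odot>\<^bsub>V\<^esub> f \<beta>)),
     lmap = (\<lambda>U \<sigma> f. \<lambda>\<beta>\<in>frames p (im2 \<sigma> U). f (frame_pull p U \<sigma> \<beta>))\<rparr>"

definition gset_species ::
    "nat \<times> nat \<Rightarrow> 't set \<Rightarrow> ((nat \<Rightarrow> nat) \<times> (nat \<Rightarrow> nat) \<Rightarrow> 't \<Rightarrow> 't) \<Rightarrow>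
     ('u, (nat \<Rightarrow> 'u) \<times> (nat \<Rightarrow> 'u) \<Rightarrow> 't) set_species" where
  "gset_species p T \<alpha> =
    \<lparr>sobj = (\<lambda>U. if frames p U = {} then {} else equivariant p T \<alpha> U),
     smap = (\<lambda>U \<sigma> f. \<lambda>\<beta>\<in>frames p (im2 \<sigma> U). f (frame_pull p U \<sigma> \<beta>))\<rparr>"

abbreviation std :: "nat \<times> nat \<Rightarrow> nat set \<times> nat set" where
  "std r \<equiv> ({1..fst r}, {1..snd r})"

definition V_H_species ::
    "('k, 'z) ring_scheme \<Rightarrow> nat \<times> nat \<Rightarrow> ('k, 'v) module \<Rightarrow>
     ((nat \<Rightarrow> nat) \<times> (nat \<Rightarrow> nat) \<Rightarrow> 'v \<Rightarrow> 'v) \<Rightarrow>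
     (nat, 'k, nat set \<times> nat set \<Rightarrow>
        (((nat \<Rightarrow> nat) \<times> (nat \<Rightarrow> nat) \<Rightarrow> 'v) \<times> ((nat \<Rightarrow> nat) \<Rightarrow> 'k) \<Rightarrow> 'k) set) lin_species" where
  "V_H_species K p V \<rho> = lin_prod K (module_species p V \<rho>) (lin_of K bij_species)"

definition T_H_species ::
    "nat \<times> nat \<Rightarrow> 't set \<Rightarrow> ((nat \<Rightarrow> nat) \<times> (nat \<Rightarrow> nat) \<Rightarrow> 't \<Rightarrow> 't) \<Rightarrow>
     (nat, (nat set \<times> nat set) \<times> ((nat \<Rightarrow> nat) \<times> (nat \<Rightarrow> nat) \<Rightarrow> 't) \<times> (nat \<Rightarrow> nat)) set_species" where
  "T_H_species p T \<alpha> = set_prod (gset_species p T \<alpha>) bij_species"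

text \<open>If \<open>b : T \<rightarrow> V\<close> identifies \<open>V\<close> with \<open>KT\<close>, then this map from the value of \<open>T_H_species\<close> on
  \<open>U\<close> to that of \<open>V_H_species\<close> identifies the latter with the linearisation of the former.\<close>

definition T_H_basis ::
    "('k, 'z) ring_scheme \<Rightarrow> nat \<times> nat \<Rightarrow> ('k, 'v) module \<Rightarrow>
     ((nat \<Rightarrow> nat) \<times> (nat \<Rightarrow> nat) \<Rightarrow> 'v \<Rightarrow> 'v) \<Rightarrow> ('t \<Rightarrow> 'v) \<Rightarrow> nat set \<times> nat set \<Rightarrow>
     (nat set \<times> nat set) \<times> ((nat \<Rightarrow> nat) \<times> (nat \<Rightarrow> nat) \<Rightarrow> 't) \<times> (nat \<Rightarrow> nat) \<Rightarrow>
     nat set \<times> nat set \<Rightarrow>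
        (((nat \<Rightarrow> nat) \<times> (nat \<Rightarrow> nat) \<Rightarrow> 'v) \<times> ((nat \<Rightarrow> nat) \<Rightarrow> 'k) \<Rightarrow> 'k) set" where
  "T_H_basis K p V \<rho> b U = (\<lambda>(A, t, h). \<lambda>A' \<in> parts U.
     let F = lobj (module_species p V \<rho>) A'; G = lobj (lin_of K bij_species) (diff2 U A') in
     if A' = A then pure_tensor_K K F G (\<lambda>\<beta>\<in>frames p A. b (t \<beta>)) (delta K h)
     else \<zero>\<^bsub>tensor_K K F G\<^esub>)"


section \<open>The species of a representation\<close>

text \<open>The constructions \<open>module_species\<close> and \<open>gset_species\<close> are functors concentrated in degree
  \<open>p\<close>, and evaluation at the identity frame recovers the given representation.\<close>

lemma group_Sym: "group (Sym p)"
  by (intro DirProd_group sym_group_is_group)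

lemma frame_pull_frames:
  assumes "inj2 U \<sigma>" "\<beta> \<in> frames p (im2 \<sigma> U)"
  shows "frame_pull p U \<sigma> \<beta> \<in> frames p U"
proof -
  have 1: "bij_betw (inv_into A f) (f ` A) A" if "inj_on f A" for f :: "'a \<Rightarrow> 'a" and A
    using that by (simp add: bij_betw_inv_into inj_on_imp_bij_betw)
  have 2: "bij_betw (\<lambda>i\<in>{1..n}. inv_into A f (b i)) {1..n} A"
    if "inj_on f A" "bij_betw b {1..n} (f ` A)" for f :: "'a \<Rightarrow> 'a" and A b and n :: nat
    using bij_betw_trans[OF that(2) 1[OF that(1)]] by (simp add: bij_betw_restrict_eq comp_def)
  show ?thesis
    using assms 2 by (auto simp: frames_def frame_pull_def im2_def inj2_def)
qed

lemma frame_right_frames: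
  assumes "\<beta> \<in> frames p U" "g \<in> carrier (Sym p)"
  shows "frame_right p \<beta> g \<in> frames p U"
proof -
  have 2: "bij_betw (\<lambda>i\<in>{1..n}. b (h i)) {1..n} A"
    if "h permutes {1..n}" "bij_betw b {1..n} A" for A b h and n :: nat
    using bij_betw_trans[OF permutes_imp_bij[OF that(1)] that(2)]
    by (simp add: bij_betw_restrict_eq comp_def)
  show ?thesis
    using assms 2 by (auto simp: frames_def frame_right_def DirProd_def sym_group_carrier)
qed

lemma frame_pull_right:
  assumes "g \<in> carrier (Sym p)"
  shows "frame_pull p U \<sigma> (frame_right p \<beta> g) = frame_right p (frame_pull p U \<sigma> \<beta>) g"
  using assms permutes_in_image
  by (fastforce simp: frame_pull_def frame_right_def DirProd_def sym_group_carrier)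

lemma equivariant_pull:
  assumes "inj2 U \<sigma>" "f \<in> equivariant p X \<alpha> U"
  shows "(\<lambda>\<beta>\<in>frames p (im2 \<sigma> U). f (frame_pull p U \<sigma> \<beta>)) \<in> equivariant p X \<alpha> (im2 \<sigma> U)"
  using assms frame_pull_frames[OF assms(1)]
  by (auto simp: equivariant_def frame_right_frames frame_pull_right PiE_iff)

lemma frame_pull_cong:
  assumes "eq2_on U \<sigma> \<tau>" "inj2 U \<sigma>" "\<beta> \<in> frames p (im2 \<sigma> U)"
  shows "frame_pull p U \<sigma> \<beta> = frame_pull p U \<tau> \<beta>"
proof -
  have *: "inv_into A f y = inv_into A g y" if "\<forall>i\<in>A. f i = g i" for f g :: "'a \<Rightarrow> 'a" and A y
    unfolding inv_into_def using that by metis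
  show ?thesis
    using assms(1) *[of "fst U" "fst \<sigma>" "fst \<tau>"] *[of "snd U" "snd \<sigma>" "snd \<tau>"]
    unfolding frame_pull_def eq2_on_def by simp
qed

lemma im2_cong: "eq2_on U \<sigma> \<tau> \<Longrightarrow> im2 \<sigma> U = im2 \<tau> U"
  by (auto simp: eq2_on_def im2_def intro!: image_cong)

lemma frame_pull_id:
  assumes "\<beta> \<in> frames p U"
  shows "frame_pull p U (id, id) \<beta> = \<beta>"
proof -
  have *: "(\<lambda>i\<in>{1..n}. inv_into A id (b i)) = b"
    if "b \<in> extensional {1..n}" "bij_betw b {1..n} A" for A b and n :: nat
    using that
    by (intro extensionalityI[of _ "{1..n}"]) (auto simp: bij_betw_def inv_into_f_eq)
  show ?thesis
    using assms * by (auto simp: frame_pull_def frames_def)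
qed

lemma im2_id [simp]: "im2 (id, id) U = U"
  by (simp add: im2_def)

lemma im2_comp: "im2 (comp2 \<tau> \<sigma>) U = im2 \<tau> (im2 \<sigma> U)"
  by (auto simp: im2_def comp2_def)

lemma inv_into_compose:
  assumes "inj_on f A" "inj_on g (f ` A)" "y \<in> g ` f ` A"
  shows "inv_into A (g \<circ> f) y = inv_into A f (inv_into (f ` A) g y)"
proof -
  obtain x where x: "x \<in> A" "y = g (f x)" using assms(3) by auto
  show ?thesis using x assms by (auto intro!: inv_into_f_eq comp_inj_on)
qed

lemma frame_pull_comp:
  assumes "inj2 U \<sigma>" "inj2 (im2 \<sigma> U) \<tau>" "\<beta> \<in> frames p (im2 \<tau> (im2 \<sigma> U))"
  shows "frame_pull p U (comp2 \<tau> \<sigma>) \<beta> = frame_pull p U \<sigma> (frame_pull p (im2 \<sigma> U) \<tau> \<beta>)"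
proof -
  have *: "(\<lambda>i\<in>{1..n}. inv_into A (g \<circ> f) (b i))
      = (\<lambda>i\<in>{1..n}. inv_into A f ((\<lambda>i\<in>{1..n}. inv_into (f ` A) g (b i)) i))"
    if "inj_on f A" "inj_on g (f ` A)" "bij_betw b {1..n} (g ` f ` A)"
    for f g :: "'a \<Rightarrow> 'a" and A b and n :: nat
    using inv_into_compose[OF that(1,2)] bij_betwE[OF that(3)] by (intro restrict_ext) simp
  show ?thesis
    using assms *[of "fst \<sigma>" "fst U" "fst \<tau>" "fst \<beta>" "fst p"]
      *[of "snd \<sigma>" "snd U" "snd \<tau>" "snd \<beta>" "snd p"]
    by (simp add: frame_pull_def frames_def comp2_def im2_def inj2_def mem_Times_iff)
qed

lemma frames_im2_nonempty:
  assumes "inj2 U \<sigma>" "frames p U \<noteq> {}"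
  shows "frames p (im2 \<sigma> U) \<noteq> {}"
proof -
  obtain \<beta> where b: "\<beta> \<in> frames p U" using assms by blast
  have 2: "bij_betw (\<lambda>i\<in>{1..n}. f (b i)) {1..n} (f ` A)"
    if "inj_on f A" "bij_betw b {1..n} A" for f :: "'a \<Rightarrow> 'a" and A b and n :: nat
    using bij_betw_trans[OF that(2) inj_on_imp_bij_betw[OF that(1)]]
    by (simp add: bij_betw_restrict_eq comp_def)
  have "(\<lambda>i\<in>{1..fst p}. fst \<sigma> (fst \<beta> i), \<lambda>i\<in>{1..snd p}. snd \<sigma> (snd \<beta> i)) \<in> frames p (im2 \<sigma> U)"
    using assms(1) b 2 by (auto simp: frames_def im2_def inj2_def)
  then show ?thesis by blast
qed

lemma extensional_restrict':
  assumes "f \<in> equivariant p X \<alpha> U"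
  shows "(\<lambda>\<beta>\<in>frames p U. f (frame_pull p U (id, id) \<beta>)) = f"
proof -
  have "(\<lambda>\<beta>\<in>frames p U. f (frame_pull p U (id, id) \<beta>)) = restrict f (frames p U)"
    by (rule restrict_ext) (simp add: frame_pull_id)
  also have "\<dots> = f"
    using assms by (intro extensional_restrict) (auto simp: equivariant_def PiE_def)
  finally show ?thesis .
qed

lemma bij_species_is_set_species: "is_set_species bij_species"
proof
  fix U :: "'a set \<times> 'a set" and \<sigma> assume s: "inj2 U \<sigma>"
  show "smap bij_species U \<sigma> \<in> sobj bij_species U \<rightarrow> sobj bij_species (im2 \<sigma> U)"
  proof
    fix h assume "h \<in> sobj bij_species U"
    then have h: "bij_betw h (fst U) (snd U)" by (simp add: bij_species_def)
    have 1: "bij_betw (inv_into (fst U) (fst \<sigma>)) (fst \<sigma> ` fst U) (fst U)"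
      using s by (simp add: inj2_def bij_betw_inv_into inj_on_imp_bij_betw)
    have 2: "bij_betw (snd \<sigma>) (snd U) (snd \<sigma> ` snd U)"
      using s by (simp add: inj2_def inj_on_imp_bij_betw)
    show "smap bij_species U \<sigma> h \<in> sobj bij_species (im2 \<sigma> U)"
      using bij_betw_trans[OF bij_betw_trans[OF 1 h] 2]
      by (simp add: bij_species_def im2_def bij_betw_restrict_eq comp_def)
  qed
next
  fix U :: "'a set \<times> 'a set" and \<sigma> \<tau> h
  assume s: "inj2 U \<sigma>" "eq2_on U \<sigma> \<tau>" "h \<in> sobj bij_species U"
  have 1: "inv_into (fst U) (fst \<sigma>) y = inv_into (fst U) (fst \<tau>) y" for y
    unfolding inv_into_def using s(2) by (metis eq2_on_def)
  have 2: "fst \<sigma> ` fst U = fst \<tau> ` fst U"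
    using s(2) by (auto simp: eq2_on_def intro!: image_cong)
  have "snd \<sigma> (h (inv_into (fst U) (fst \<sigma>) y)) = snd \<tau> (h (inv_into (fst U) (fst \<sigma>) y))"
    if "y \<in> fst \<sigma> ` fst U" for y
    using s that bij_betwE[of h "fst U" "snd U"] inv_into_into[OF that]
    by (auto simp: eq2_on_def bij_species_def)
  then show "smap bij_species U \<sigma> h = smap bij_species U \<tau> h"
    by (simp add: bij_species_def 1 2[symmetric] cong: restrict_cong)
next
  fix U :: "'a set \<times> 'a set" and h assume "h \<in> sobj bij_species U"
  then show "smap bij_species U (id, id) h = h"
    by (intro extensionalityI[of _ "fst U"]) (auto simp: bij_species_def inv_into_f_eq)
next
  fix U :: "'a set \<times> 'a set" and \<sigma> \<tau> h
  assume s: "inj2 U \<sigma>" "inj2 (im2 \<sigma> U) \<tau>"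
  have "inv_into (fst U) (fst \<tau> \<circ> fst \<sigma>) y
      = inv_into (fst U) (fst \<sigma>) (inv_into (fst \<sigma> ` fst U) (fst \<tau>) y)"
    "inv_into (fst \<sigma> ` fst U) (fst \<tau>) y \<in> fst \<sigma> ` fst U"
    if "y \<in> fst \<tau> ` fst \<sigma> ` fst U" for y
    using s that by (auto simp: inj2_def im2_def intro!: inv_into_compose inv_into_into)
  then show "smap bij_species U (comp2 \<tau> \<sigma>) h = smap bij_species (im2 \<sigma> U) \<tau> (smap bij_species U \<sigma> h)"
    by (auto simp: bij_species_def comp2_def im2_def image_comp intro!: restrict_ext)
qed

lemma gset_species_is_set_species: "is_set_species (gset_species p T \<alpha>)"
proof
  fix U :: "'a set \<times> 'a set" and \<sigma> assume "inj2 U \<sigma>"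
  then show "smap (gset_species p T \<alpha>) U \<sigma>
     \<in> sobj (gset_species p T \<alpha>) U \<rightarrow> sobj (gset_species p T \<alpha>) (im2 \<sigma> U)"
    by (auto simp: gset_species_def equivariant_pull dest: frames_im2_nonempty)
qed (auto simp: gset_species_def frame_pull_cong im2_cong extensional_restrict' im2_comp
      frame_pull_comp frame_pull_frames split: if_splits intro!: restrict_ext)

lemma equivariantI:
  assumes "f \<in> extensional (frames p U)" "\<And>\<beta>. \<beta> \<in> frames p U \<Longrightarrow> f \<beta> \<in> X"
    "\<And>\<beta> g. \<beta> \<in> frames p U \<Longrightarrow> g \<in> carrier (Sym p) \<Longrightarrow>
       f (frame_right p \<beta> g) = \<alpha> (inv\<^bsub>Sym p\<^esub> g) (f \<beta>)"
  shows "f \<in> equivariant p X \<alpha> U"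
  using assms by (auto simp: equivariant_def PiE_def)

lemma module_species_module:
  assumes "is_rep K (Sym p) V \<rho>"
  shows "module K (lobj (module_species p V \<rho>) U)"
proof -
  interpret V: module K V using assms by (simp add: is_rep_def)
  have inv: "inv\<^bsub>Sym p\<^esub> g \<in> carrier (Sym p)" if "g \<in> carrier (Sym p)" for g
    using group.inv_closed[OF group_Sym that] .
  have add: "\<rho> g (v \<oplus>\<^bsub>V\<^esub> w) = \<rho> g v \<oplus>\<^bsub>V\<^esub> \<rho> g w" and
    smult: "k \<in> carrier K \<Longrightarrow> \<rho> g (k \<odot>\<^bsub>V\<^esub> v) = k \<odot>\<^bsub>V\<^esub> \<rho> g v" and
    closed: "\<rho> g v \<in> carrier V"
    if "g \<in> carrier (Sym p)" "v \<in> carrier V" "w \<in> carrier V" for g v w k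
    using assms that unfolding is_rep_def linear_map_def by blast+
  have zero: "\<rho> g \<zero>\<^bsub>V\<^esub> = \<zero>\<^bsub>V\<^esub>" if "g \<in> carrier (Sym p)" for g
    using smult[OF that, of "\<zero>\<^bsub>V\<^esub>" "\<zero>\<^bsub>V\<^esub>" "\<zero>\<^bsub>K\<^esub>"] closed[OF that, of "\<zero>\<^bsub>V\<^esub>" "\<zero>\<^bsub>V\<^esub>"] by simp
  let ?E = "equivariant p (carrier V) \<rho> U" and ?F = "frames p U"
  have val: "f \<beta> \<in> carrier V" if "f \<in> ?E" "\<beta> \<in> ?F" for f \<beta>
    using that by (auto simp: equivariant_def)
  have eqv: "f (frame_right p \<beta> g) = \<rho> (inv\<^bsub>Sym p\<^esub> g) (f \<beta>)"
    if "f \<in> ?E" "\<beta> \<in> ?F" "g \<in> carrier (Sym p)" for f \<beta> g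
    using that unfolding equivariant_def by blast
  have ext: "f = h" if "f \<in> ?E" "h \<in> extensional ?F" "\<And>\<beta>. \<beta> \<in> ?F \<Longrightarrow> f \<beta> = h \<beta>" for f h
    using that by (intro extensionalityI[of f ?F h]) (auto simp: equivariant_def PiE_def)
  have E0: "(\<lambda>\<beta>\<in>?F. \<zero>\<^bsub>V\<^esub>) \<in> ?E"
  proof (rule equivariantI)
    fix \<beta> g assume "\<beta> \<in> ?F" and g: "g \<in> carrier (Sym p)"
    then show "(\<lambda>\<beta>\<in>?F. \<zero>\<^bsub>V\<^esub>) (frame_right p \<beta> g) = \<rho> (inv\<^bsub>Sym p\<^esub> g) ((\<lambda>\<beta>\<in>?F. \<zero>\<^bsub>V\<^esub>) \<beta>)"
      using zero[OF inv[OF g]] frame_right_frames[of \<beta> p U g] by simp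
  qed auto
  have Ea: "(\<lambda>\<beta>\<in>?F. f \<beta> \<oplus>\<^bsub>V\<^esub> h \<beta>) \<in> ?E" if "f \<in> ?E" "h \<in> ?E" for f h
    using that
  proof (intro equivariantI)
    fix \<beta> g assume b: "\<beta> \<in> ?F" and g: "g \<in> carrier (Sym p)"
    show "(\<lambda>\<beta>\<in>?F. f \<beta> \<oplus>\<^bsub>V\<^esub> h \<beta>) (frame_right p \<beta> g)
      = \<rho> (inv\<^bsub>Sym p\<^esub> g) ((\<lambda>\<beta>\<in>?F. f \<beta> \<oplus>\<^bsub>V\<^esub> h \<beta>) \<beta>)"
      using add[OF inv[OF g] val[OF that(1) b] val[OF that(2) b]] frame_right_frames[OF b g] b
        eqv[OF that(1) b g] eqv[OF that(2) b g] by simp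
  qed (auto simp: val)
  have Es: "(\<lambda>\<beta>\<in>?F. k \<odot>\<^bsub>V\<^esub> f \<beta>) \<in> ?E" if "f \<in> ?E" "k \<in> carrier K" for f k
    using that
  proof (intro equivariantI)
    fix \<beta> g assume b: "\<beta> \<in> ?F" and g: "g \<in> carrier (Sym p)"
    show "(\<lambda>\<beta>\<in>?F. k \<odot>\<^bsub>V\<^esub> f \<beta>) (frame_right p \<beta> g)
      = \<rho> (inv\<^bsub>Sym p\<^esub> g) ((\<lambda>\<beta>\<in>?F. k \<odot>\<^bsub>V\<^esub> f \<beta>) \<beta>)"
      using smult[OF inv[OF g] val[OF that(1) b] val[OF that(1) b] that(2)]
        frame_right_frames[OF b g] b eqv[OF that(1) b g] by simp
  qed (auto simp: val)
  show ?thesis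
  proof (rule moduleI)
    show "abelian_group (lobj (module_species p V \<rho>) U)"
    proof (rule abelian_groupI)
      fix f assume f: "f \<in> carrier (lobj (module_species p V \<rho>) U)"
      then have f': "f \<in> ?E" by (simp add: module_species_def mk_module_def)
      show "\<exists>h\<in>carrier (lobj (module_species p V \<rho>) U).
          h \<oplus>\<^bsub>lobj (module_species p V \<rho>) U\<^esub> f = \<zero>\<^bsub>lobj (module_species p V \<rho>) U\<^esub>"
      proof
        show "(\<lambda>\<beta>\<in>?F. (\<ominus>\<^bsub>K\<^esub> \<one>\<^bsub>K\<^esub>) \<odot>\<^bsub>V\<^esub> f \<beta>) \<in> carrier (lobj (module_species p V \<rho>) U)"
          using Es[OF f', of "\<ominus>\<^bsub>K\<^esub> \<one>\<^bsub>K\<^esub>"] by (simp add: module_species_def mk_module_def)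
        show "(\<lambda>\<beta>\<in>?F. (\<ominus>\<^bsub>K\<^esub> \<one>\<^bsub>K\<^esub>) \<odot>\<^bsub>V\<^esub> f \<beta>) \<oplus>\<^bsub>lobj (module_species p V \<rho>) U\<^esub> f
            = \<zero>\<^bsub>lobj (module_species p V \<rho>) U\<^esub>"
          using f' by (auto simp: module_species_def mk_module_def V.smult_l_minus val V.M.l_neg
              intro!: restrict_ext)
      qed
    qed (auto simp: module_species_def mk_module_def Ea E0 val V.M.a_assoc V.M.a_comm V.M.add.m_lcomm
          intro!: restrict_ext ext[symmetric])
  qed (auto simp: module_species_def mk_module_def Ea Es val V.smult_l_distr V.smult_r_distr
        V.smult_assoc1 V.R.is_cring intro!: restrict_ext ext[symmetric])
qed

lemma module_species_is_lin_species:
  assumes "is_rep K (Sym p) V \<rho>"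
  shows "is_lin_species K (module_species p V \<rho>)"
proof (rule is_lin_species.intro)
  fix U :: "'d set \<times> 'd set"
  show "module K (lobj (module_species p V \<rho>) U)"
    by (rule module_species_module[OF assms])
next
  fix U :: "'d set \<times> 'd set" and \<sigma> assume "inj2 U \<sigma>"
  then show "linear_map K (lobj (module_species p V \<rho>) U) (lobj (module_species p V \<rho>) (im2 \<sigma> U))
      (lmap (module_species p V \<rho>) U \<sigma>)"
    by (auto simp: linear_map_def module_species_def mk_module_def equivariant_pull
        frame_pull_frames intro!: restrict_ext)
qed (auto simp: module_species_def mk_module_def frame_pull_cong
      im2_cong extensional_restrict' im2_comp frame_pull_comp frame_pull_frames
      intro!: restrict_ext)

lemma module_species_concentrated:
  assumes "card (fst U) \<noteq> fst p \<or> card (snd U) \<noteq> snd p"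
  shows "carrier (lobj (module_species p V \<rho>) U) = {\<zero>\<^bsub>lobj (module_species p V \<rho>) U\<^esub>}"
    and "sobj (gset_species p T \<alpha>) U = {}"
proof -
  have "frames p U = {}"
    using assms by (auto simp: frames_def dest: bij_betw_same_card)
  then show "carrier (lobj (module_species p V \<rho>) U) = {\<zero>\<^bsub>lobj (module_species p V \<rho>) U\<^esub>}"
    and "sobj (gset_species p T \<alpha>) U = {}"
    by (auto simp: module_species_def gset_species_def mk_module_def equivariant_def)
qed

definition std_frame :: "nat \<times> nat \<Rightarrow> (nat \<Rightarrow> nat) \<times> (nat \<Rightarrow> nat)" where
  "std_frame p = (\<lambda>i\<in>{1..fst p}. i, \<lambda>i\<in>{1..snd p}. i)"

lemma std_frame_frames: "std_frame p \<in> frames p (std p)"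
  by (simp add: std_frame_def frames_def bij_betw_def inj_on_def)

lemma frame_of_perm:
  assumes "\<beta> \<in> frames p (std p)"
  obtains g where "g \<in> carrier (Sym p)" "\<beta> = frame_right p (std_frame p) g"
proof -
  define ext where "ext n b i = (if i \<in> {1..n} then b i else i)" for n :: nat and b :: "nat \<Rightarrow> nat" and i
  have perm: "ext n b permutes {1..n}" if "bij_betw b {1..n} {1..n}" for n b
  proof (rule bij_imp_permutes)
    show "bij_betw (ext n b) {1..n} {1..n}"
      using that by (rule bij_betw_cong[THEN iffD1, rotated]) (simp add: ext_def)
  qed (auto simp: ext_def)
  have eq: "(\<lambda>i\<in>{1..n}. (\<lambda>j\<in>{1..n}. j) (ext n b i)) = b"
    if "b \<in> extensional {1..n}" "bij_betw b {1..n} {1..n}" for n b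
    using that bij_betwE[OF that(2)] by (intro extensionalityI[of _ "{1..n}"]) (auto simp: ext_def)
  show ?thesis
  proof
    show "(ext (fst p) (fst \<beta>), ext (snd p) (snd \<beta>)) \<in> carrier (Sym p)"
      using assms perm by (auto simp: DirProd_def sym_group_carrier frames_def)
    show "\<beta> = frame_right p (std_frame p) (ext (fst p) (fst \<beta>), ext (snd p) (snd \<beta>))"
      using assms eq[of "fst \<beta>" "fst p"] eq[of "snd \<beta>" "snd p"]
      by (simp add: frame_right_def std_frame_def frames_def mem_Times_iff prod_eq_iff)
  qed
qed

lemma frame_right_mult:
  assumes "g \<in> carrier (Sym p)" "h \<in> carrier (Sym p)"
  shows "frame_right p (frame_right p \<beta> g) h = frame_right p \<beta> (g \<otimes>\<^bsub>Sym p\<^esub> h)"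
proof -
  have *: "(\<lambda>i\<in>{1..n}. (\<lambda>i\<in>{1..n}. b (g i)) (h i)) = (\<lambda>i\<in>{1..n}. b (g (h i)))"
    if "h permutes {1..n}" for n and b :: "nat \<Rightarrow> 'a" and g h :: "nat \<Rightarrow> nat"
    using permutes_in_image[OF that] by (intro restrict_ext) simp
  then show ?thesis
    using assms *[of "snd h" "snd p" "snd \<beta>" "snd g"] *[of "fst h" "fst p" "fst \<beta>" "fst g"]
    by (simp add: frame_right_def DirProd_def sym_group_carrier sym_group_mult case_prod_beta
        mem_Times_iff)
qed

lemma frame_right_inj:
  assumes "g \<in> carrier (Sym p)" "h \<in> carrier (Sym p)"
    and "frame_right p (std_frame p) g = frame_right p (std_frame p) h"
  shows "g = h"
proof -
  have *: "g = h" if "g permutes {1..n}" "h permutes {1..n}"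
    "(\<lambda>i\<in>{1..n}. (\<lambda>j\<in>{1..n}. j) (g i)) = (\<lambda>i\<in>{1..n}. (\<lambda>j\<in>{1..n}. j) (h i))"
    for n and g h :: "nat \<Rightarrow> nat"
  proof
    fix i
    show "g i = h i"
    proof (cases "i \<in> {1..n}")
      case True
      then have "g i \<in> {1..n}" "h i \<in> {1..n}"
        using permutes_in_image[OF that(1)] permutes_in_image[OF that(2)] by auto
      then show ?thesis using fun_cong[OF that(3), of i] True by (simp split: if_splits)
    next
      case False
      then show ?thesis using that by (simp add: permutes_def)
    qed
  qed
  then show ?thesis
    using assms *[of "fst g" "fst p" "fst h"] *[of "snd g" "snd p" "snd h"]
    by (simp add: frame_right_def DirProd_def sym_group_carrier std_frame_def prod_eq_iff
        mem_Times_iff)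
qed

lemma frame_pull_std:
  assumes "g \<in> carrier (Sym p)"
  shows "frame_pull p (std p) g (std_frame p) = frame_right p (std_frame p) (inv\<^bsub>Sym p\<^esub> g)"
proof -
  have *: "(\<lambda>i\<in>{1..n}. inv_into {1..n} g ((\<lambda>j\<in>{1..n}. j) i))
     = (\<lambda>i\<in>{1..n}. (\<lambda>j\<in>{1..n}. j) ((inv\<^bsub>sym_group n\<^esub> g) i))"
    if "g \<in> carrier (sym_group n)" for n g
  proof (rule restrict_ext)
    fix i assume i: "i \<in> {1..n}"
    interpret S: group "sym_group n" by (rule sym_group_is_group)
    let ?h = "inv\<^bsub>sym_group n\<^esub> g"
    have h: "?h permutes {1..n}" "g permutes {1..n}"
      using that S.inv_closed[OF that] by (auto simp: sym_group_carrier)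
    have gh: "g (?h i) = i"
      using S.r_inv[OF that] by (simp add: sym_group_mult sym_group_one fun_eq_iff)
    have hi: "?h i \<in> {1..n}" using i permutes_in_image[OF h(1)] by blast
    have "inv_into {1..n} g i = ?h i"
      using gh hi h(2) by (intro inv_into_f_eq) (auto intro: permutes_inj_on)
    then show "inv_into {1..n} g ((\<lambda>j\<in>{1..n}. j) i) = (\<lambda>j\<in>{1..n}. j) (?h i)"
      using i hi by simp
  qed
  show ?thesis
    using assms *[of "fst g" "fst p"] *[of "snd g" "snd p"]
    by (auto simp: frame_pull_def frame_right_def std_frame_def DirProd_def[symmetric]
        inv_DirProd sym_group_is_group)
qed

lemma module_species_degree_part:
  assumes "is_rep K (Sym p) V \<rho>"
  shows "rep_iso K (Sym p) (lobj (module_species p V \<rho>) (std p))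
    (lmap (module_species p V \<rho>) (std p)) V \<rho> (\<lambda>f. f (std_frame p))"
proof -
  interpret G: group "Sym p" by (rule group_Sym)
  interpret A: group_action "Sym p" "carrier V" \<rho> using assms by (simp add: is_rep_def)
  let ?E = "equivariant p (carrier V) \<rho> (std p)" and ?F = "frames p (std p)" and ?e = "std_frame p"
  have eF: "?e \<in> ?F" by (rule std_frame_frames)
  have clos: "\<rho> g v \<in> carrier V" if "g \<in> carrier (Sym p)" "v \<in> carrier V" for g v
    using A.element_image that by blast
  have eqv: "f (frame_right p ?e g) = \<rho> (inv\<^bsub>Sym p\<^esub> g) (f ?e)"
    if "f \<in> ?E" "g \<in> carrier (Sym p)" for f g
    using that eF unfolding equivariant_def by blast
  have inj: "inj_on (\<lambda>f. f ?e) ?E"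
  proof (rule inj_onI)
    fix f h assume fh: "f \<in> ?E" "h \<in> ?E" "f ?e = h ?e"
    show "f = h"
    proof (rule extensionalityI[of f ?F h])
      fix \<beta> assume "\<beta> \<in> ?F"
      then obtain g where g: "g \<in> carrier (Sym p)" "\<beta> = frame_right p ?e g" by (rule frame_of_perm)
      show "f \<beta> = h \<beta>" unfolding g(2) eqv[OF fh(1) g(1)] eqv[OF fh(2) g(1)] fh(3) ..
    qed (use fh in \<open>auto simp: equivariant_def PiE_def\<close>)
  qed
  have surj: "\<exists>f\<in>?E. f ?e = v" if v: "v \<in> carrier V" for v
  proof -
    define f where "f = (\<lambda>\<beta>\<in>?F. \<rho> (inv\<^bsub>Sym p\<^esub> (THE g. g \<in> carrier (Sym p) \<and> \<beta> = frame_right p ?e g)) v)"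
    have f: "f (frame_right p ?e g) = \<rho> (inv\<^bsub>Sym p\<^esub> g) v" if g: "g \<in> carrier (Sym p)" for g
    proof -
      have "(THE h. h \<in> carrier (Sym p) \<and> frame_right p ?e g = frame_right p ?e h) = g"
        using g frame_right_inj[OF g] by (intro the_equality) blast+
      then show ?thesis using frame_right_frames[OF eF g] by (simp add: f_def)
    qed
    have "f \<in> ?E"
    proof (rule equivariantI)
      show "f \<in> extensional ?F" by (simp add: f_def)
    next
      fix \<beta> assume "\<beta> \<in> ?F"
      then obtain g where "g \<in> carrier (Sym p)" "\<beta> = frame_right p ?e g" by (rule frame_of_perm)
      then show "f \<beta> \<in> carrier V" using f clos[OF G.inv_closed v] by simp
    next
      fix \<beta> h assume h: "h \<in> carrier (Sym p)" and "\<beta> \<in> ?F"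
      from this(2) obtain g where g: "g \<in> carrier (Sym p)" and b: "\<beta> = frame_right p ?e g"
        by (rule frame_of_perm)
      have "f (frame_right p \<beta> h) = \<rho> (inv\<^bsub>Sym p\<^esub> (g \<otimes>\<^bsub>Sym p\<^esub> h)) v"
        unfolding b frame_right_mult[OF g h] by (rule f) (rule G.m_closed[OF g h])
      also have "\<dots> = \<rho> (inv\<^bsub>Sym p\<^esub> h) (f \<beta>)"
        unfolding G.inv_mult_group[OF g h]
        by (simp only: A.composition_rule[OF v G.inv_closed[OF h] G.inv_closed[OF g]] b f[OF g])
      finally show "f (frame_right p \<beta> h) = \<rho> (inv\<^bsub>Sym p\<^esub> h) (f \<beta>)" .
    qed
    moreover have "f ?e = v"
    proof -
      have "frame_right p ?e \<one>\<^bsub>Sym p\<^esub> = ?e"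
        by (auto simp: frame_right_def std_frame_def DirProd_def sym_group_one)
      then have "f ?e = \<rho> \<one>\<^bsub>Sym p\<^esub> v" using f[OF G.one_closed] G.inv_one by metis
      then show ?thesis using v A.id_eq_one by (metis restrict_apply')
    qed
    ultimately show ?thesis by blast
  qed
  have im: "im2 g (std p) = std p" if "g \<in> carrier (Sym p)" for g
    using that permutes_image[of "fst g" "{1..fst p}"] permutes_image[of "snd g" "{1..snd p}"]
    by (simp add: im2_def DirProd_def sym_group_carrier mem_Times_iff)
  show ?thesis
    unfolding rep_iso_def
  proof (intro conjI ballI)
    show "linear_map K (lobj (module_species p V \<rho>) (std p)) V (\<lambda>f. f ?e)"
      using eF by (auto simp: linear_map_def module_species_def mk_module_def equivariant_def)
    show "bij_betw (\<lambda>f. f ?e) (carrier (lobj (module_species p V \<rho>) (std p))) (carrier V)"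
      using inj surj eF
      by (auto simp: bij_betw_def module_species_def mk_module_def equivariant_def image_iff)
  next
    fix g f assume g: "g \<in> carrier (Sym p)"
      and "f \<in> carrier (lobj (module_species p V \<rho>) (std p))"
    then have f: "f \<in> ?E" by (simp add: module_species_def mk_module_def)
    have "lmap (module_species p V \<rho>) (std p) g f ?e = f (frame_pull p (std p) g ?e)"
      using eF im[OF g] by (simp add: module_species_def)
    also have "\<dots> = \<rho> g (f ?e)"
      unfolding frame_pull_std[OF g] eqv[OF f G.inv_closed[OF g]] G.inv_inv[OF g] ..
    finally show "lmap (module_species p V \<rho>) (std p) g f ?e = \<rho> g (f ?e)" .
  qed
qed
end

theory Submission
  imports Defs
begin

text \<open>A diagram in \<open>D(p, r; p)\<close> is the same as a pair \<open>(\<beta>, h)\<close>: the injection \<open>\<beta>\<close> sends each point on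
  the top edge to the lower end of its propagating strand, and \<open>h\<close> is the bijection, between the
  remaining points on the two sides of the wall, given by the other strands.  The group \<open>Sym p\<close>
  acts on \<open>\<beta>\<close> only, and freely, with the image \<open>A\<close> of \<open>\<beta>\<close> as invariant of the orbit; \<open>Sym r\<close> acts by
  transport of structure.  Hence a pure tensor of \<open>v\<close> and \<open>(\<beta>, h)\<close> corresponds to the element of the
  summand indexed by \<open>A\<close> that is the pure tensor of \<open>h\<close> and the equivariant function on frames with
  value \<open>v\<close> at \<open>\<beta>\<close>.  The maps in both directions come from the universal property of the tensor
  product, so that all identities need to be checked on generators only.\<close>

text \<open>The obstacle is that the summand of index \<open>A\<close> has no preferred frame, so
  the map back to the inflation can only be written after choosing a frame of \<open>A\<close>. The
  choice does not matter: another frame is \<open>\<beta> g\<close>, an equivariant function changes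
  by g^-1 along with it, and the balancing relation over the group algebra moves \<open>g\<close>
  across the tensor sign. Where \<open>A\<close> has no frame, the summand is zero. The conventions
  meet because stacking \<open>g\<close> on top replaces \<open>\<beta>\<close> by
  \<open>\<beta> g^-1\<close>, with the same inverse that turns the left action on \<open>V\<close>
  into a right one. Stacking a permutation diagram neither closes a loop nor lowers a propagating
  number, so on basis vectors these products carry the factor \<open>\<delta>^0\<close> and are
  never cut off. Degrees take care of themselves: when r_1 - p_1 and r_2 - p_2 differ, no
  \<open>h\<close> exists and both sides vanish. In the permutation case one isomorphism
  \<open>\<Phi>\<close> has to be compatible with every \<open>T\<close> and \<open>b\<close>, so
  its values on pure tensors are carried along, not only its existence.\<close>

lemma mk_module_simps [simp]:
  "carrier (mk_module C z a s) = C" "zero (mk_module C z a s) = z"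
  "add (mk_module C z a s) = a" "smult (mk_module C z a s) = s"
  by (simp_all add: mk_module_def)

subsection \<open>Linear maps and spanning sets\<close>

lemma linear_mapI:
  assumes "\<And>v. v \<in> carrier V \<Longrightarrow> f v \<in> carrier W"
    and "\<And>v w. v \<in> carrier V \<Longrightarrow> w \<in> carrier V \<Longrightarrow> f (v \<oplus>\<^bsub>V\<^esub> w) = f v \<oplus>\<^bsub>W\<^esub> f w"
    and "\<And>k v. k \<in> carrier K \<Longrightarrow> v \<in> carrier V \<Longrightarrow> f (k \<odot>\<^bsub>V\<^esub> v) = k \<odot>\<^bsub>W\<^esub> f v"
  shows "linear_map K V W f"
  using assms by (simp add: linear_map_def)

lemma linear_mapD:
  assumes "linear_map K V W f"
  shows "v \<in> carrier V \<Longrightarrow> f v \<in> carrier W"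
    and "v \<in> carrier V \<Longrightarrow> w \<in> carrier V \<Longrightarrow> f (v \<oplus>\<^bsub>V\<^esub> w) = f v \<oplus>\<^bsub>W\<^esub> f w"
    and "k \<in> carrier K \<Longrightarrow> v \<in> carrier V \<Longrightarrow> f (k \<odot>\<^bsub>V\<^esub> v) = k \<odot>\<^bsub>W\<^esub> f v"
  using assms by (auto simp: linear_map_def)

lemma linear_map_cong:
  assumes "linear_map K V W f" "module K V" "\<And>v. v \<in> carrier V \<Longrightarrow> f v = g v"
  shows "linear_map K V W g"
proof -
  interpret V: module K V by (rule assms)
  show ?thesis
    using assms(1,3) by (auto simp: linear_map_def Pi_iff)
qed

lemma linear_map_id: "linear_map K V V (\<lambda>v. v)"
  by (simp add: linear_map_def)

lemma linear_map_compose: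
  "linear_map K V W f \<Longrightarrow> linear_map K W X g \<Longrightarrow> linear_map K V X (\<lambda>v. g (f v))"
  by (auto simp: linear_map_def Pi_iff)

lemma linear_map_zero:
  assumes "module K V" "module K W" "linear_map K V W f"
  shows "f \<zero>\<^bsub>V\<^esub> = \<zero>\<^bsub>W\<^esub>"
proof -
  interpret V: module K V by fact
  interpret W: module K W by fact
  have "f (\<zero>\<^bsub>K\<^esub> \<odot>\<^bsub>V\<^esub> \<zero>\<^bsub>V\<^esub>) = \<zero>\<^bsub>K\<^esub> \<odot>\<^bsub>W\<^esub> f \<zero>\<^bsub>V\<^esub>"
    using assms(3) by (intro linear_mapD(3)[OF assms(3)]) auto
  then show ?thesis using linear_mapD(1)[OF assms(3)] by simp
qed

lemma linear_map_zero_map: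
  assumes "module K W"
  shows "linear_map K V W (\<lambda>v. \<zero>\<^bsub>W\<^esub>)"
proof -
  interpret W: module K W by fact
  show ?thesis by (simp add: linear_map_def)
qed


lemma linear_map_smult:
  assumes "module K W" "linear_map K V W f" "k \<in> carrier K"
  shows "linear_map K V W (\<lambda>v. k \<odot>\<^bsub>W\<^esub> f v)"
proof -
  interpret W: module K W by fact
  show ?thesis
    using assms(2,3)
    by (auto simp: linear_map_def Pi_iff W.smult_r_distr W.smult_assoc1[symmetric] W.R.m_comm)
qed

lemma linear_map_finsum:
  assumes "module K W" "finite I" "\<And>i. i \<in> I \<Longrightarrow> linear_map K V W (f i)"
  shows "linear_map K V W (\<lambda>v. \<Oplus>\<^bsub>W\<^esub> i\<in>I. f i v)"
proof -
  interpret W: module K W by fact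
  have c: "f i v \<in> carrier W" if "i \<in> I" "v \<in> carrier V" for i v
    using linear_mapD(1)[OF assms(3)] that by blast
  show ?thesis
  proof (rule linear_mapI)
    fix v assume "v \<in> carrier V"
    then show "(\<Oplus>\<^bsub>W\<^esub> i\<in>I. f i v) \<in> carrier W" using c by (intro W.M.finsum_closed) auto
  next
    fix v w assume vw: "v \<in> carrier V" "w \<in> carrier V"
    have "(\<Oplus>\<^bsub>W\<^esub> i\<in>I. f i (v \<oplus>\<^bsub>V\<^esub> w)) = (\<Oplus>\<^bsub>W\<^esub> i\<in>I. f i v \<oplus>\<^bsub>W\<^esub> f i w)"
      using c vw by (intro W.M.finsum_cong') (auto simp: linear_mapD(2)[OF assms(3)])
    also have "\<dots> = (\<Oplus>\<^bsub>W\<^esub> i\<in>I. f i v) \<oplus>\<^bsub>W\<^esub> (\<Oplus>\<^bsub>W\<^esub> i\<in>I. f i w)"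
      using c vw by (intro W.M.finsum_addf) auto
    finally show "(\<Oplus>\<^bsub>W\<^esub> i\<in>I. f i (v \<oplus>\<^bsub>V\<^esub> w)) = (\<Oplus>\<^bsub>W\<^esub> i\<in>I. f i v) \<oplus>\<^bsub>W\<^esub> (\<Oplus>\<^bsub>W\<^esub> i\<in>I. f i w)" .
  next
    fix k v assume k: "k \<in> carrier K" "v \<in> carrier V"
    have "(\<Oplus>\<^bsub>W\<^esub> i\<in>I. f i (k \<odot>\<^bsub>V\<^esub> v)) = (\<Oplus>\<^bsub>W\<^esub> i\<in>I. k \<odot>\<^bsub>W\<^esub> f i v)"
      using c k by (intro W.M.finsum_cong') (auto simp: linear_mapD(3)[OF assms(3)])
    also have "\<dots> = k \<odot>\<^bsub>W\<^esub> (\<Oplus>\<^bsub>W\<^esub> i\<in>I. f i v)"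
      using c k assms(2) by (intro W.finsum_smult_ldistr[symmetric]) auto
    finally show "(\<Oplus>\<^bsub>W\<^esub> i\<in>I. f i (k \<odot>\<^bsub>V\<^esub> v)) = k \<odot>\<^bsub>W\<^esub> (\<Oplus>\<^bsub>W\<^esub> i\<in>I. f i v)" .
  qed
qed

lemma linear_map_inv_into:
  assumes "module K V" "linear_map K V W f" "bij_betw f (carrier V) (carrier W)"
  shows "linear_map K W V (inv_into (carrier V) f)"
proof -
  interpret V: module K V by fact
  let ?g = "inv_into (carrier V) f"
  have g: "?g w \<in> carrier V" "f (?g w) = w" if "w \<in> carrier W" for w
    using assms(3) that by (auto simp: bij_betw_def inv_into_into f_inv_into_f)
  have gf: "?g (f v) = v" if "v \<in> carrier V" for v
    using assms(3) that by (auto simp: bij_betw_def)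
  show ?thesis
  proof (rule linear_mapI)
    fix v w assume "v \<in> carrier W" "w \<in> carrier W"
    then show "?g (v \<oplus>\<^bsub>W\<^esub> w) = ?g v \<oplus>\<^bsub>V\<^esub> ?g w"
      using gf[of "?g v \<oplus>\<^bsub>V\<^esub> ?g w"] g linear_mapD(2)[OF assms(2)] by simp
  next
    fix k w assume "k \<in> carrier K" "w \<in> carrier W"
    then show "?g (k \<odot>\<^bsub>W\<^esub> w) = k \<odot>\<^bsub>V\<^esub> ?g w"
      using gf[of "k \<odot>\<^bsub>V\<^esub> ?g w"] g linear_mapD(3)[OF assms(2)] by simp
  qed (rule g)
qed

lemma submodule_equalizer:
  assumes "module K V" "module K W" "linear_map K V W f" "linear_map K V W g"
  shows "submodule {v \<in> carrier V. f v = g v} K V"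
proof -
  interpret V: module K V by fact
  interpret W: module K W by fact
  note f = linear_mapD[OF assms(3)] and g = linear_mapD[OF assms(4)]
  \<comment> \<open>Closure of a submodule under negation becomes closure under the scalar -1, which
    linear maps respect.\<close>
  have minus: "\<ominus>\<^bsub>V\<^esub> v = (\<ominus>\<^bsub>K\<^esub> \<one>\<^bsub>K\<^esub>) \<odot>\<^bsub>V\<^esub> v" if "v \<in> carrier V" for v
    using that by (simp add: V.smult_l_minus)
  show ?thesis
    by (rule V.submoduleI)
      (auto simp: f g minus linear_map_zero[OF assms(1,2,3)] linear_map_zero[OF assms(1,2,4)])
qed

text \<open>Spanning is expressed by submodules instead of finite sums: equalizers and preimages are
  submodules, so a property of generators extends by one inclusion.\<close>

definition spanning :: "('k, 'z) ring_scheme \<Rightarrow> ('k, 'v) module \<Rightarrow> 'v set \<Rightarrow> bool" where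
  "spanning K V S \<longleftrightarrow> S \<subseteq> carrier V \<and> (\<forall>N. submodule N K V \<and> S \<subseteq> N \<longrightarrow> carrier V \<subseteq> N)"

lemma linear_map_eqI:
  assumes "module K V" "module K W" "linear_map K V W f" "linear_map K V W g"
    and "spanning K V S" "\<And>s. s \<in> S \<Longrightarrow> f s = g s" "v \<in> carrier V"
  shows "f v = g v"
  using submodule_equalizer[OF assms(1-4)] assms(5-7) unfolding spanning_def by blast

text \<open>The composites in both orders are linear, so they are identities as soon as they fix
  generators. The main isomorphism and both statements about permutation bases rest on this
  criterion.\<close>

lemma linear_bij:
  assumes "module K V" "module K W" "linear_map K V W f" "linear_map K W V g"
    and "spanning K V S" "\<And>s. s \<in> S \<Longrightarrow> g (f s) = s"
    and "spanning K W S'" "\<And>s. s \<in> S' \<Longrightarrow> f (g s) = s"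
  shows "bij_betw f (carrier V) (carrier W)"
proof (rule bij_betw_byWitness[where f' = g])
  show "\<forall>v\<in>carrier V. g (f v) = v"
    using linear_map_eqI[OF assms(1,1) linear_map_compose[OF assms(3,4)] linear_map_id assms(5,6)]
    by blast
  show "\<forall>w\<in>carrier W. f (g w) = w"
    using linear_map_eqI[OF assms(2,2) linear_map_compose[OF assms(4,3)] linear_map_id assms(7,8)]
    by blast
qed (use linear_mapD(1)[OF assms(3)] linear_mapD(1)[OF assms(4)] in auto)

lemma submodule_vimage:
  assumes "module K V" "module K W" "linear_map K V W f" "submodule N K W"
  shows "submodule {v \<in> carrier V. f v \<in> N} K V"
proof -
  interpret V: module K V by fact
  interpret W: module K W by fact
  interpret N: submodule N K W by fact
  note f = linear_mapD[OF assms(3)]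
  have minus: "\<ominus>\<^bsub>V\<^esub> v = (\<ominus>\<^bsub>K\<^esub> \<one>\<^bsub>K\<^esub>) \<odot>\<^bsub>V\<^esub> v" if "v \<in> carrier V" for v
    using that by (simp add: V.smult_l_minus)
  show ?thesis
    using N.one_closed N.m_closed N.smult_closed
    by (intro V.submoduleI) (auto simp: f minus linear_map_zero[OF assms(1,2,3)])
qed

text \<open>The preimage of any submodule that contains the image of \<open>S\<close> contains
  \<open>S\<close>, hence is all of \<open>V\<close>; surjectivity finishes.\<close>

lemma spanning_image:
  assumes "module K V" "module K W" "linear_map K V W f" "f ` carrier V = carrier W"
    and "spanning K V S"
  shows "spanning K W (f ` S)"
  unfolding spanning_def
proof (intro conjI allI impI)
  show "f ` S \<subseteq> carrier W" using assms(4,5) by (auto simp: spanning_def)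
  fix N assume N: "submodule N K W \<and> f ` S \<subseteq> N"
  then have "submodule {v \<in> carrier V. f v \<in> N} K V" "S \<subseteq> {v \<in> carrier V. f v \<in> N}"
    using submodule_vimage[OF assms(1-3), of N] assms(5) by (auto simp: spanning_def)
  then have "carrier V \<subseteq> {v \<in> carrier V. f v \<in> N}"
    using assms(5) unfolding spanning_def by blast
  then have "f ` carrier V \<subseteq> N" by blast
  then show "carrier W \<subseteq> N" using assms(4) by simp
qed

subsection \<open>Free modules\<close>

lemma free_mod_carrier:
  "f \<in> carrier (free_mod K X) \<longleftrightarrow>
     (\<forall>x. f x \<in> carrier K) \<and> finite {x. f x \<noteq> \<zero>\<^bsub>K\<^esub>} \<and> {x. f x \<noteq> \<zero>\<^bsub>K\<^esub>} \<subseteq> X"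
  by (auto simp: free_mod_def)

lemma free_mod_ops:
  "zero (free_mod K X) = (\<lambda>x. \<zero>\<^bsub>K\<^esub>)"
  "f \<oplus>\<^bsub>free_mod K X\<^esub> g = (\<lambda>x. f x \<oplus>\<^bsub>K\<^esub> g x)"
  "k \<odot>\<^bsub>free_mod K X\<^esub> f = (\<lambda>x. k \<otimes>\<^bsub>K\<^esub> f x)"
  by (simp_all add: free_mod_def)

lemma free_mod_module:
  assumes "cring K"
  shows "module K (free_mod K X)"
proof -
  interpret K: cring K by fact
  have fin: "f \<oplus>\<^bsub>free_mod K X\<^esub> g \<in> carrier (free_mod K X)"
    if "f \<in> carrier (free_mod K X)" "g \<in> carrier (free_mod K X)" for f g
  proof -
    have "{x. f x \<oplus>\<^bsub>K\<^esub> g x \<noteq> \<zero>\<^bsub>K\<^esub>} \<subseteq> {x. f x \<noteq> \<zero>\<^bsub>K\<^esub>} \<union> {x. g x \<noteq> \<zero>\<^bsub>K\<^esub>}" by auto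
    then show ?thesis
      using that unfolding free_mod_carrier free_mod_ops
      by (blast intro: finite_subset K.a_closed)
  qed
  have sm: "k \<odot>\<^bsub>free_mod K X\<^esub> f \<in> carrier (free_mod K X)"
    if "k \<in> carrier K" "f \<in> carrier (free_mod K X)" for f k
  proof -
    have "{x. k \<otimes>\<^bsub>K\<^esub> f x \<noteq> \<zero>\<^bsub>K\<^esub>} \<subseteq> {x. f x \<noteq> \<zero>\<^bsub>K\<^esub>}" using that by auto
    then show ?thesis
      using that unfolding free_mod_carrier free_mod_ops
      by (blast intro: finite_subset K.m_closed)
  qed
  have c: "f x \<in> carrier K" if "f \<in> carrier (free_mod K X)" for f x
    using that by (simp add: free_mod_carrier)
  show ?thesis
  proof (rule moduleI)
    show "abelian_group (free_mod K X)"
    proof (rule abelian_groupI)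
      fix f assume f: "f \<in> carrier (free_mod K X)"
      show "\<exists>g\<in>carrier (free_mod K X). g \<oplus>\<^bsub>free_mod K X\<^esub> f = \<zero>\<^bsub>free_mod K X\<^esub>"
      proof
        show "(\<ominus>\<^bsub>K\<^esub> \<one>\<^bsub>K\<^esub>) \<odot>\<^bsub>free_mod K X\<^esub> f \<in> carrier (free_mod K X)"
          using f by (intro sm) auto
        show "(\<ominus>\<^bsub>K\<^esub> \<one>\<^bsub>K\<^esub>) \<odot>\<^bsub>free_mod K X\<^esub> f \<oplus>\<^bsub>free_mod K X\<^esub> f = \<zero>\<^bsub>free_mod K X\<^esub>"
          using c[OF f] by (simp add: free_mod_ops K.l_minus K.l_neg)
      qed
    qed (auto simp: fin, auto simp: free_mod_ops free_mod_carrier K.a_ac)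
  qed (auto simp: assms sm, auto simp: free_mod_ops free_mod_carrier K.l_distr K.r_distr K.m_assoc)
qed

lemma delta_closed:
  assumes "cring K" "x \<in> X"
  shows "delta K x \<in> carrier (free_mod K X)"
proof -
  interpret K: cring K by fact
  have "finite {y. delta K x y \<noteq> \<zero>\<^bsub>K\<^esub>}"
    by (rule finite_subset[of _ "{x}"]) (auto simp: delta_def)
  then show ?thesis using assms(2) by (auto simp: free_mod_carrier delta_def)
qed

text \<open>The linear extension of \<open>u\<close> from basis vectors to \<open>KX\<close>. It is
  the very sum in \<open>perm_rep\<close>, so that being a permutation basis includes bijectivity of
  this map.\<close>

definition lincomb ::
    "('k, 'z) ring_scheme \<Rightarrow> ('k, 'w) module \<Rightarrow> ('x \<Rightarrow> 'w) \<Rightarrow> ('x \<Rightarrow> 'k) \<Rightarrow> 'w" where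
  "lincomb K W u f = (\<Oplus>\<^bsub>W\<^esub> x \<in> {x. f x \<noteq> \<zero>\<^bsub>K\<^esub>}. f x \<odot>\<^bsub>W\<^esub> u x)"

text \<open>Two vectors and their sum have different supports. Padding with zero terms gives all
  three sums a common index set, on which linearity is termwise.\<close>

lemma lincomb_superset:
  assumes "module K W" "u \<in> X \<rightarrow> carrier W" "f \<in> carrier (free_mod K X)"
    and "finite S" "{x. f x \<noteq> \<zero>\<^bsub>K\<^esub>} \<subseteq> S" "S \<subseteq> X"
  shows "lincomb K W u f = (\<Oplus>\<^bsub>W\<^esub> x \<in> S. f x \<odot>\<^bsub>W\<^esub> u x)"
proof -
  interpret W: module K W by fact
  show ?thesis
    unfolding lincomb_def
    using assms(2-6)
    by (intro W.M.add.finprod_mono_neutral_cong_left)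
      (auto simp: free_mod_carrier Pi_iff subset_iff)
qed

lemma lincomb_linear:
  assumes "module K W" "u \<in> X \<rightarrow> carrier W"
  shows "linear_map K (free_mod K X) W (lincomb K W u)"
proof -
  interpret W: module K W by fact
  interpret F: module K "free_mod K X" by (rule free_mod_module[OF W.R.is_cring])
  have sup: "lincomb K W u f = (\<Oplus>\<^bsub>W\<^esub> x \<in> S. f x \<odot>\<^bsub>W\<^esub> u x)"
    if "f \<in> carrier (free_mod K X)" "finite S" "{x. f x \<noteq> \<zero>\<^bsub>K\<^esub>} \<subseteq> S" "S \<subseteq> X" for f S
    by (rule lincomb_superset[OF assms that])
  have u: "u x \<in> carrier W" if "x \<in> X" for x using assms(2) that by auto
  have c: "f x \<in> carrier K" if "f \<in> carrier (free_mod K X)" for f x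
    using that by (simp add: free_mod_carrier)
  show ?thesis
  proof (rule linear_mapI)
    fix f assume f: "f \<in> carrier (free_mod K X)"
    show "lincomb K W u f \<in> carrier W"
      unfolding lincomb_def using f
      by (intro W.M.finsum_closed) (auto simp: free_mod_carrier intro!: u)
  next
    fix f g assume f: "f \<in> carrier (free_mod K X)" and g: "g \<in> carrier (free_mod K X)"
    let ?S = "{x. f x \<noteq> \<zero>\<^bsub>K\<^esub>} \<union> {x. g x \<noteq> \<zero>\<^bsub>K\<^esub>}"
    have S: "finite ?S" "?S \<subseteq> X" using f g by (auto simp: free_mod_carrier)
    have s3: "{x. (f \<oplus>\<^bsub>free_mod K X\<^esub> g) x \<noteq> \<zero>\<^bsub>K\<^esub>} \<subseteq> ?S" by (auto simp: free_mod_ops)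
    have "lincomb K W u (f \<oplus>\<^bsub>free_mod K X\<^esub> g) = (\<Oplus>\<^bsub>W\<^esub> x \<in> ?S. (f x \<oplus>\<^bsub>K\<^esub> g x) \<odot>\<^bsub>W\<^esub> u x)"
      using sup[OF F.M.a_closed[OF f g] S(1) s3 S(2)] by (simp add: free_mod_ops)
    also have "\<dots> = (\<Oplus>\<^bsub>W\<^esub> x \<in> ?S. f x \<odot>\<^bsub>W\<^esub> u x \<oplus>\<^bsub>W\<^esub> g x \<odot>\<^bsub>W\<^esub> u x)"
      using S c[OF f] c[OF g] u by (intro W.M.finsum_cong') (auto simp: W.smult_l_distr subset_iff)
    also have "\<dots> = (\<Oplus>\<^bsub>W\<^esub> x \<in> ?S. f x \<odot>\<^bsub>W\<^esub> u x) \<oplus>\<^bsub>W\<^esub> (\<Oplus>\<^bsub>W\<^esub> x \<in> ?S. g x \<odot>\<^bsub>W\<^esub> u x)"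
      using S c[OF f] c[OF g] u by (intro W.M.finsum_addf) (auto simp: subset_iff)
    also have "\<dots> = lincomb K W u f \<oplus>\<^bsub>W\<^esub> lincomb K W u g"
      using sup[OF f S(1) _ S(2)] sup[OF g S(1) _ S(2)] by simp
    finally show "lincomb K W u (f \<oplus>\<^bsub>free_mod K X\<^esub> g) = lincomb K W u f \<oplus>\<^bsub>W\<^esub> lincomb K W u g" .
  next
    fix k f assume k: "k \<in> carrier K" and f: "f \<in> carrier (free_mod K X)"
    let ?S = "{x. f x \<noteq> \<zero>\<^bsub>K\<^esub>}"
    have S: "finite ?S" "?S \<subseteq> X" using f by (auto simp: free_mod_carrier)
    have s3: "{x. (k \<odot>\<^bsub>free_mod K X\<^esub> f) x \<noteq> \<zero>\<^bsub>K\<^esub>} \<subseteq> ?S" using k by (auto simp: free_mod_ops)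
    have "lincomb K W u (k \<odot>\<^bsub>free_mod K X\<^esub> f) = (\<Oplus>\<^bsub>W\<^esub> x \<in> ?S. (k \<otimes>\<^bsub>K\<^esub> f x) \<odot>\<^bsub>W\<^esub> u x)"
      using sup[OF F.smult_closed[OF k f] S(1) s3 S(2)] by (simp add: free_mod_ops)
    also have "\<dots> = (\<Oplus>\<^bsub>W\<^esub> x \<in> ?S. k \<odot>\<^bsub>W\<^esub> (f x \<odot>\<^bsub>W\<^esub> u x))"
      using S c[OF f] u k by (intro W.M.finsum_cong') (auto simp: W.smult_assoc1 subset_iff)
    also have "\<dots> = k \<odot>\<^bsub>W\<^esub> (\<Oplus>\<^bsub>W\<^esub> x \<in> ?S. f x \<odot>\<^bsub>W\<^esub> u x)"
      using S c[OF f] u k by (intro W.finsum_smult_ldistr[symmetric]) (auto simp: subset_iff)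
    finally show "lincomb K W u (k \<odot>\<^bsub>free_mod K X\<^esub> f) = k \<odot>\<^bsub>W\<^esub> lincomb K W u f"
      by (simp add: lincomb_def)
  qed
qed

lemma lincomb_delta:
  assumes "module K W" "u \<in> X \<rightarrow> carrier W" "x \<in> X"
  shows "lincomb K W u (delta K x) = u x"
proof -
  interpret W: module K W by fact
  have ux: "u x \<in> carrier W" using assms by auto
  have "lincomb K W u (delta K x) = (\<Oplus>\<^bsub>W\<^esub> y \<in> {x}. delta K x y \<odot>\<^bsub>W\<^esub> u y)"
    using assms(3)
    by (intro lincomb_superset[OF assms(1,2) delta_closed[OF W.R.is_cring assms(3)]])
      (auto simp: delta_def)
  also have "\<dots> = u x" using ux by (simp add: delta_def)
  finally show ?thesis .
qed

lemma finsum_in_submodule: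
  assumes "module K V" "submodule N K V" "finite S" "\<And>x. x \<in> S \<Longrightarrow> u x \<in> N"
  shows "(\<Oplus>\<^bsub>V\<^esub> x \<in> S. u x) \<in> N"
proof -
  interpret V: module K V by fact
  interpret N: submodule N K V by fact
  have sub: "x \<in> carrier V" if "x \<in> N" for x using N.subset that by auto
  show ?thesis
    using assms(3,4)
  proof (induction S)
    case empty
    then show ?case using N.one_closed by simp
  next
    case (insert x S)
    then show ?case using N.m_closed sub by (subst V.M.finsum_insert) auto
  qed
qed

lemma free_mod_finsum_apply:
  assumes "cring K" "finite S" "\<And>i. i \<in> S \<Longrightarrow> u i \<in> carrier (free_mod K X)"
  shows "(\<Oplus>\<^bsub>free_mod K X\<^esub> i \<in> S. u i) x = (\<Oplus>\<^bsub>K\<^esub> i \<in> S. u i x)"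
proof -
  interpret K: cring K by fact
  interpret F: module K "free_mod K X" by (rule free_mod_module[OF assms(1)])
  show ?thesis
    using assms(2,3)
  proof (induction S)
    case (insert i S)
    have "(\<Oplus>\<^bsub>free_mod K X\<^esub> i \<in> insert i S. u i) = u i \<oplus>\<^bsub>free_mod K X\<^esub> (\<Oplus>\<^bsub>free_mod K X\<^esub> i \<in> S. u i)"
      using insert by (intro F.M.finsum_insert) auto
    moreover have "(\<Oplus>\<^bsub>K\<^esub> i \<in> insert i S. u i x) = u i x \<oplus>\<^bsub>K\<^esub> (\<Oplus>\<^bsub>K\<^esub> i \<in> S. u i x)"
      using insert by (intro K.finsum_insert) (auto simp: free_mod_carrier)
    ultimately show ?case using insert by (simp add: free_mod_ops)
  qed (simp add: free_mod_ops)
qed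

text \<open>Evaluated at \<open>y\<close>, the sum keeps only the term with \<open>x = y\<close>,
  and that term is absent exactly when \<open>f y\<close> is zero.\<close>

lemma lincomb_delta_id:
  assumes "cring K" "f \<in> carrier (free_mod K X)"
  shows "lincomb K (free_mod K X) (delta K) f = f"
proof
  fix y
  interpret K: cring K by fact
  interpret F: module K "free_mod K X" by (rule free_mod_module[OF assms(1)])
  let ?S = "{x. f x \<noteq> \<zero>\<^bsub>K\<^esub>}"
  have fin: "finite ?S" "?S \<subseteq> X" and c: "\<And>x. f x \<in> carrier K"
    using assms(2) by (auto simp: free_mod_carrier)
  have "lincomb K (free_mod K X) (delta K) f y = (\<Oplus>\<^bsub>K\<^esub> x \<in> ?S. (f x \<odot>\<^bsub>free_mod K X\<^esub> delta K x) y)"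
    unfolding lincomb_def using fin c delta_closed[OF assms(1), of _ X]
    by (intro free_mod_finsum_apply[OF assms(1)] F.smult_closed) auto
  also have "\<dots> = (\<Oplus>\<^bsub>K\<^esub> x \<in> ?S. if y = x then f x else \<zero>\<^bsub>K\<^esub>)"
    using c by (intro K.finsum_cong') (auto simp: free_mod_ops delta_def)
  also have "\<dots> = f y"
  proof (cases "y \<in> ?S")
    case True
    then show ?thesis using fin(1) c by (intro K.finsum_singleton) auto
  next
    case False
    then have "(\<Oplus>\<^bsub>K\<^esub> x \<in> ?S. if y = x then f x else \<zero>\<^bsub>K\<^esub>) = (\<Oplus>\<^bsub>K\<^esub> x \<in> ?S. \<zero>\<^bsub>K\<^esub>)"
      by (intro K.finsum_cong') auto
    then show ?thesis using False by simp
  qed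
  finally show "lincomb K (free_mod K X) (delta K) f y = f y" .
qed

lemma spanning_free_mod:
  assumes "cring K"
  shows "spanning K (free_mod K X) (delta K ` X)"
  unfolding spanning_def
proof (intro conjI allI impI subsetI)
  show "f \<in> carrier (free_mod K X)" if "f \<in> delta K ` X" for f
    using that delta_closed[OF assms] by auto
  fix N f assume N: "submodule N K (free_mod K X) \<and> delta K ` X \<subseteq> N"
    and f: "f \<in> carrier (free_mod K X)"
  interpret F: module K "free_mod K X" by (rule free_mod_module[OF assms(1)])
  interpret N: submodule N K "free_mod K X" using N by blast
  have "lincomb K (free_mod K X) (delta K) f \<in> N"
    unfolding lincomb_def using N f
    by (intro finsum_in_submodule[of K]) (auto simp: F.module_axioms free_mod_carrier intro!: N.smult_closed)
  then show "f \<in> N" using lincomb_delta_id[OF assms f] by simp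
qed

text \<open>Summing over the fibres of \<open>m\<close> is the linear extension of a map from basis
  vectors to basis vectors; linearity of \<open>push\<close> is inherited from
  \<open>lincomb\<close>.\<close>

lemma push_eq:
  assumes "cring K" "f \<in> carrier (free_mod K X)" "m \<in> X \<rightarrow> Y"
  shows "push K m f = lincomb K (free_mod K Y) (\<lambda>x. delta K (m x)) f"
proof
  fix y
  interpret K: cring K by fact
  interpret F: module K "free_mod K Y" by (rule free_mod_module[OF assms(1)])
  let ?S = "{x. f x \<noteq> \<zero>\<^bsub>K\<^esub>}"
  have fin: "finite ?S" "?S \<subseteq> X" and c: "\<And>x. f x \<in> carrier K"
    using assms(2) by (auto simp: free_mod_carrier)
  have "lincomb K (free_mod K Y) (\<lambda>x. delta K (m x)) f y
      = (\<Oplus>\<^bsub>K\<^esub> x \<in> ?S. (f x \<odot>\<^bsub>free_mod K Y\<^esub> delta K (m x)) y)"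
    unfolding lincomb_def using fin c delta_closed[OF assms(1), of _ Y] assms(3)
    by (intro free_mod_finsum_apply[OF assms(1)] F.smult_closed) auto
  also have "\<dots> = (\<Oplus>\<^bsub>K\<^esub> x \<in> ?S. if m x = y then f x else \<zero>\<^bsub>K\<^esub>)"
    using c by (intro K.finsum_cong') (auto simp: free_mod_ops delta_def)
  also have "\<dots> = push K m f y"
    unfolding push_def using fin c
    by (intro K.add.finprod_mono_neutral_cong_right) auto
  finally show "push K m f y = lincomb K (free_mod K Y) (\<lambda>x. delta K (m x)) f y" by simp
qed

lemma push_linear:
  assumes "cring K" "m \<in> X \<rightarrow> Y"
  shows "linear_map K (free_mod K X) (free_mod K Y) (push K m)"
proof (rule linear_map_cong)
  show "linear_map K (free_mod K X) (free_mod K Y) (lincomb K (free_mod K Y) (\<lambda>x. delta K (m x)))"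
    using assms by (intro lincomb_linear free_mod_module) (auto intro!: delta_closed)
qed (use assms push_eq in \<open>auto intro: free_mod_module push_eq[OF _ _ assms(2), symmetric]\<close>)

lemma push_delta:
  assumes "cring K" "m \<in> X \<rightarrow> Y" "x \<in> X"
  shows "push K m (delta K x) = delta K (m x)"
  using assms
  by (subst push_eq[OF assms(1) _ assms(2)])
    (auto intro!: delta_closed lincomb_delta[where X = X] free_mod_module)

subsection \<open>Quotient modules\<close>

lemma submodule_abelian_subgroup:
  assumes "module K V" "submodule N K V"
  shows "abelian_subgroup N V"
proof -
  interpret V: module K V by fact
  interpret N: submodule N K V by fact
  show ?thesis
    by (rule abelian_subgroupI3) (use N.subgroup_axioms V.M.abelian_group_axioms in \<open>auto simp: additive_subgroup_def\<close>)
qed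

lemma quot_mod_simps:
  "carrier (quot_mod V N) = a_rcosets\<^bsub>V\<^esub> N" "zero (quot_mod V N) = N"
  "add (quot_mod V N) = set_add V"
  "smult (quot_mod V N) k X = (\<Union>x\<in>X. N +>\<^bsub>V\<^esub> (k \<odot>\<^bsub>V\<^esub> x))"
  by (simp_all add: quot_mod_def)

context
  fixes K :: "('k, 'z) ring_scheme" and V :: "('k, 'v) module" and N :: "'v set"
  assumes V: "module K V" and N: "submodule N K V"
begin

interpretation V: module K V by (rule V)
interpretation N: submodule N K V by (rule N)
interpretation A: abelian_subgroup N V by (rule submodule_abelian_subgroup[OF V N])

lemma quot_carrier: "X \<in> carrier (quot_mod V N) \<longleftrightarrow> (\<exists>x\<in>carrier V. X = N +>\<^bsub>V\<^esub> x)"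
  by (auto simp: quot_mod_simps A_RCOSETS_def' )

lemma coset_closed: "x \<in> carrier V \<Longrightarrow> N +>\<^bsub>V\<^esub> x \<in> carrier (quot_mod V N)"
  by (auto simp: quot_carrier)

lemma coset_add: "x \<in> carrier V \<Longrightarrow> y \<in> carrier V \<Longrightarrow>
    (N +>\<^bsub>V\<^esub> x) \<oplus>\<^bsub>quot_mod V N\<^esub> (N +>\<^bsub>V\<^esub> y) = N +>\<^bsub>V\<^esub> (x \<oplus>\<^bsub>V\<^esub> y)"
  by (simp add: quot_mod_simps A.a_rcos_sum)

lemma coset_eq_iff: "x \<in> carrier V \<Longrightarrow> y \<in> carrier V \<Longrightarrow>
    N +>\<^bsub>V\<^esub> x = N +>\<^bsub>V\<^esub> y \<longleftrightarrow> x \<ominus>\<^bsub>V\<^esub> y \<in> N"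
  using A.a_rcos_module[of y x] A.a_repr_independence'[of x y] A.a_rcos_self[of x]
  by (auto simp: a_minus_def)

lemma coset_memD:
  assumes "x \<in> carrier V" "y \<in> N +>\<^bsub>V\<^esub> x"
  shows "y \<in> carrier V" "N +>\<^bsub>V\<^esub> y = N +>\<^bsub>V\<^esub> x"
  using assms A.a_elemrcos_carrier A.a_repr_independence' by auto

lemma coset_self: "x \<in> carrier V \<Longrightarrow> x \<in> N +>\<^bsub>V\<^esub> x"
  by (rule A.a_rcos_self)

text \<open>Scalar multiplication on quotients and \<open>tensor_map\<close> are unions over all
  representatives. Such a union is a single value once the representatives agree.\<close>

lemma Union_coset:
  assumes "\<And>y. y \<in> N +>\<^bsub>V\<^esub> x \<Longrightarrow> h y = h x" "x \<in> carrier V"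
  shows "(\<Union>y \<in> N +>\<^bsub>V\<^esub> x. h y) = h x"
  using assms coset_self[OF assms(2)] by blast

lemma coset_smult:
  assumes "k \<in> carrier K" "x \<in> carrier V"
  shows "k \<odot>\<^bsub>quot_mod V N\<^esub> (N +>\<^bsub>V\<^esub> x) = N +>\<^bsub>V\<^esub> (k \<odot>\<^bsub>V\<^esub> x)"
  unfolding quot_mod_simps
proof (rule Union_coset[OF _ assms(2)])
  fix y assume "y \<in> N +>\<^bsub>V\<^esub> x"
  note y = coset_memD[OF assms(2) this]
  have "k \<odot>\<^bsub>V\<^esub> y \<ominus>\<^bsub>V\<^esub> k \<odot>\<^bsub>V\<^esub> x = k \<odot>\<^bsub>V\<^esub> (y \<ominus>\<^bsub>V\<^esub> x)"
    using assms y by (simp add: a_minus_def V.smult_r_distr V.smult_r_minus)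
  moreover have "y \<ominus>\<^bsub>V\<^esub> x \<in> N" using coset_eq_iff[OF y(1) assms(2)] y(2) by simp
  ultimately show "N +>\<^bsub>V\<^esub> (k \<odot>\<^bsub>V\<^esub> y) = N +>\<^bsub>V\<^esub> (k \<odot>\<^bsub>V\<^esub> x)"
    using coset_eq_iff assms y by simp
qed

lemma coset_linear: "linear_map K V (quot_mod V N) (\<lambda>x. N +>\<^bsub>V\<^esub> x)"
  by (rule linear_mapI) (simp_all add: coset_closed coset_add coset_smult)

lemma quot_module: "module K (quot_mod V N)"
proof (rule moduleI)
  have zero: "\<zero>\<^bsub>quot_mod V N\<^esub> = N +>\<^bsub>V\<^esub> \<zero>\<^bsub>V\<^esub>"
    using N.subset by (simp add: quot_mod_simps)
  show "abelian_group (quot_mod V N)"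
  proof (rule abelian_groupI)
    fix X assume "X \<in> carrier (quot_mod V N)"
    then obtain x where x: "x \<in> carrier V" "X = N +>\<^bsub>V\<^esub> x" by (auto simp: quot_carrier)
    then show "\<exists>Y\<in>carrier (quot_mod V N). Y \<oplus>\<^bsub>quot_mod V N\<^esub> X = \<zero>\<^bsub>quot_mod V N\<^esub>"
      by (intro bexI[of _ "N +>\<^bsub>V\<^esub> (\<ominus>\<^bsub>V\<^esub> x)"])
        (simp_all add: coset_add coset_closed zero V.M.l_neg)
  qed (auto simp: quot_carrier zero coset_add V.M.a_ac coset_closed)
qed (auto simp: quot_carrier coset_add coset_smult V.R.is_cring
      V.smult_l_distr V.smult_r_distr V.smult_assoc1)

lemma quot_lift:
  assumes W: "module K W" and h: "linear_map K V W h" and 0: "\<And>n. n \<in> N \<Longrightarrow> h n = \<zero>\<^bsub>W\<^esub>"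
  shows "\<exists>h'. linear_map K (quot_mod V N) W h' \<and> (\<forall>x\<in>carrier V. h' (N +>\<^bsub>V\<^esub> x) = h x)"
proof (intro exI conjI ballI)
  interpret W: module K W by (rule W)
  \<comment> \<open>An arbitrary representative serves, since two of them differ by an element of
    \<open>N\<close>, where \<open>h\<close> vanishes.\<close>
  define h' where "h' X = h (SOME x. x \<in> X)" for X
  show h': "h' (N +>\<^bsub>V\<^esub> x) = h x" if x: "x \<in> carrier V" for x
  proof -
    let ?y = "SOME y. y \<in> N +>\<^bsub>V\<^esub> x"
    have "?y \<in> N +>\<^bsub>V\<^esub> x" using coset_self[OF x] by (rule someI)
    note y = coset_memD[OF x this]
    have n: "?y \<ominus>\<^bsub>V\<^esub> x \<in> N" using coset_eq_iff[OF y(1) x] y(2) by simp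
    have "?y = (?y \<ominus>\<^bsub>V\<^esub> x) \<oplus>\<^bsub>V\<^esub> x" using x y by (simp add: a_minus_def V.M.a_assoc V.M.l_neg)
    then have "h ?y = h (?y \<ominus>\<^bsub>V\<^esub> x) \<oplus>\<^bsub>W\<^esub> h x"
      using linear_mapD(2)[OF h, of "?y \<ominus>\<^bsub>V\<^esub> x" x] x y by simp
    then show ?thesis using 0[OF n] linear_mapD(1)[OF h x] by (simp add: h'_def)
  qed
  show "linear_map K (quot_mod V N) W h'"
    by (rule linear_mapI)
      (auto simp: quot_carrier h' coset_add coset_smult linear_mapD[OF h])
qed

end

subsection \<open>Tensor products\<close>

lemma gen_submodule_submodule:
  assumes "module K V" "S \<subseteq> carrier V"
  shows "submodule (gen_submodule K V S) K V"
proof -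
  interpret V: module K V by fact
  \<comment> \<open>The carrier is one of the submodules being intersected, which keeps the
    intersection inside the carrier.\<close>
  have "submodule (carrier V) K V" by (rule V.submoduleI) auto
  then have "gen_submodule K V S \<subseteq> carrier V"
    using assms(2) by (auto simp: gen_submodule_def)
  then show ?thesis
  proof (rule V.submoduleI)
    show "\<zero>\<^bsub>V\<^esub> \<in> gen_submodule K V S"
      using subgroup.one_closed[OF submodule.axioms(1)] by (fastforce simp: gen_submodule_def)
  qed (use V.submoduleE(3-5) in \<open>simp_all add: gen_submodule_def\<close>)
qed

lemma gen_submodule_superset: "S \<subseteq> gen_submodule K V S"
  by (auto simp: gen_submodule_def)

lemma gen_submodule_least: "submodule N K V \<Longrightarrow> S \<subseteq> N \<Longrightarrow> gen_submodule K V S \<subseteq> N"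
  by (auto simp: gen_submodule_def)

text \<open>One locale covers both kinds of tensor product: over the group algebra for the
  inflation, and over \<open>K\<close> for the product of species. Closure of the two actions puts
  the relators into the free module.\<close>

locale tensor_product = V: module K V + M: module K M
  for K :: "('k, 'z) ring_scheme" and V :: "('k, 'v) module" and M :: "('k, 'm) module" +
  fixes A :: "'a set" and ra :: "'v \<Rightarrow> 'a \<Rightarrow> 'v" and la :: "'a \<Rightarrow> 'm \<Rightarrow> 'm"
  assumes ra_closed: "v \<in> carrier V \<Longrightarrow> a \<in> A \<Longrightarrow> ra v a \<in> carrier V"
    and la_closed: "m \<in> carrier M \<Longrightarrow> a \<in> A \<Longrightarrow> la a m \<in> carrier M"
begin

abbreviation "F \<equiv> free_mod K (carrier V \<times> carrier M)"
abbreviation "N \<equiv> tensor_rel K A ra V la M"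
abbreviation "VM \<equiv> tensor K A ra V la M"
abbreviation "pure \<equiv> pure_tensor K A ra V la M"

sublocale F: module K F by (rule free_mod_module[OF V.R.is_cring])

lemma delta_F: "v \<in> carrier V \<Longrightarrow> m \<in> carrier M \<Longrightarrow> delta K (v, m) \<in> carrier F"
  by (rule delta_closed) (simp_all add: V.R.is_cring)

definition relators :: "('v \<times> 'm \<Rightarrow> 'k) set" where
  "relators = (let e = (\<lambda>v m. delta K (v, m)) in
     {e (v \<oplus>\<^bsub>V\<^esub> v') m \<ominus>\<^bsub>F\<^esub> (e v m \<oplus>\<^bsub>F\<^esub> e v' m) | v v' m.
          v \<in> carrier V \<and> v' \<in> carrier V \<and> m \<in> carrier M} \<union>
       {e v (m \<oplus>\<^bsub>M\<^esub> m') \<ominus>\<^bsub>F\<^esub> (e v m \<oplus>\<^bsub>F\<^esub> e v m') | v m m'.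
          v \<in> carrier V \<and> m \<in> carrier M \<and> m' \<in> carrier M} \<union>
       {e (k \<odot>\<^bsub>V\<^esub> v) m \<ominus>\<^bsub>F\<^esub> (k \<odot>\<^bsub>F\<^esub> e v m) | k v m.
          k \<in> carrier K \<and> v \<in> carrier V \<and> m \<in> carrier M} \<union>
       {e v (k \<odot>\<^bsub>M\<^esub> m) \<ominus>\<^bsub>F\<^esub> (k \<odot>\<^bsub>F\<^esub> e v m) | k v m.
          k \<in> carrier K \<and> v \<in> carrier V \<and> m \<in> carrier M} \<union>
       {e (ra v a) m \<ominus>\<^bsub>F\<^esub> e v (la a m) | v a m.
          v \<in> carrier V \<and> a \<in> A \<and> m \<in> carrier M})"

lemma N_eq: "N = gen_submodule K F relators"
  by (simp add: tensor_rel_def relators_def Let_def)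

lemma relators_closed: "relators \<subseteq> carrier F"
  unfolding relators_def Let_def
  by (intro Un_least subsetI; elim CollectE exE conjE)
    (simp_all add: delta_F ra_closed la_closed)

lemma N_submodule: "submodule N K F"
  unfolding N_eq by (rule gen_submodule_submodule[OF F.module_axioms relators_closed])

lemma relatorsI: "x \<in> relators \<Longrightarrow> x \<in> N"
  using gen_submodule_superset[of relators K F] by (auto simp: N_eq)

lemma tensor_module: "module K VM"
  unfolding tensor_def by (rule quot_module[OF F.module_axioms N_submodule])

lemma coset_map: "linear_map K F VM (\<lambda>x. N +>\<^bsub>F\<^esub> x)"
  unfolding tensor_def by (rule coset_linear[OF F.module_axioms N_submodule])

lemma pure_closed: "v \<in> carrier V \<Longrightarrow> m \<in> carrier M \<Longrightarrow> pure v m \<in> carrier VM"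
  unfolding pure_tensor_def by (rule linear_mapD(1)[OF coset_map]) (rule delta_F)

lemma coset_relatorI:
  assumes "x \<in> carrier F" "y \<in> carrier F" "x \<ominus>\<^bsub>F\<^esub> y \<in> relators"
  shows "N +>\<^bsub>F\<^esub> x = N +>\<^bsub>F\<^esub> y"
  using coset_eq_iff[OF F.module_axioms N_submodule assms(1,2)] relatorsI[OF assms(3)] by blast

lemma pure_add_left:
  assumes "v \<in> carrier V" "v' \<in> carrier V" "m \<in> carrier M"
  shows "pure (v \<oplus>\<^bsub>V\<^esub> v') m = pure v m \<oplus>\<^bsub>VM\<^esub> pure v' m"
proof -
  have "N +>\<^bsub>F\<^esub> delta K (v \<oplus>\<^bsub>V\<^esub> v', m) = N +>\<^bsub>F\<^esub> (delta K (v, m) \<oplus>\<^bsub>F\<^esub> delta K (v', m))"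
    using assms by (intro coset_relatorI) (simp_all add: delta_F relators_def, blast)
  then show ?thesis
    using assms linear_mapD(2)[OF coset_map] by (simp add: pure_tensor_def delta_F)
qed

lemma pure_add_right:
  assumes "v \<in> carrier V" "m \<in> carrier M" "m' \<in> carrier M"
  shows "pure v (m \<oplus>\<^bsub>M\<^esub> m') = pure v m \<oplus>\<^bsub>VM\<^esub> pure v m'"
proof -
  have "N +>\<^bsub>F\<^esub> delta K (v, m \<oplus>\<^bsub>M\<^esub> m') = N +>\<^bsub>F\<^esub> (delta K (v, m) \<oplus>\<^bsub>F\<^esub> delta K (v, m'))"
    using assms by (intro coset_relatorI) (simp_all add: delta_F relators_def, blast)
  then show ?thesis
    using assms linear_mapD(2)[OF coset_map] by (simp add: pure_tensor_def delta_F)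
qed

lemma pure_smult_left:
  assumes "v \<in> carrier V" "m \<in> carrier M" "k \<in> carrier K"
  shows "pure (k \<odot>\<^bsub>V\<^esub> v) m = k \<odot>\<^bsub>VM\<^esub> pure v m"
proof -
  have "N +>\<^bsub>F\<^esub> delta K (k \<odot>\<^bsub>V\<^esub> v, m) = N +>\<^bsub>F\<^esub> (k \<odot>\<^bsub>F\<^esub> delta K (v, m))"
    using assms by (intro coset_relatorI) (simp_all add: delta_F relators_def, blast)
  then show ?thesis
    using assms linear_mapD(3)[OF coset_map] by (simp add: pure_tensor_def delta_F)
qed

lemma pure_smult_right:
  assumes "v \<in> carrier V" "m \<in> carrier M" "k \<in> carrier K"
  shows "pure v (k \<odot>\<^bsub>M\<^esub> m) = k \<odot>\<^bsub>VM\<^esub> pure v m"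
proof -
  have "N +>\<^bsub>F\<^esub> delta K (v, k \<odot>\<^bsub>M\<^esub> m) = N +>\<^bsub>F\<^esub> (k \<odot>\<^bsub>F\<^esub> delta K (v, m))"
    using assms by (intro coset_relatorI) (simp_all add: delta_F relators_def, blast)
  then show ?thesis
    using assms linear_mapD(3)[OF coset_map] by (simp add: pure_tensor_def delta_F)
qed

lemma pure_balanced:
  assumes "v \<in> carrier V" "m \<in> carrier M" "a \<in> A"
  shows "pure (ra v a) m = pure v (la a m)"
  unfolding pure_tensor_def
  using assms by (intro coset_relatorI) (simp_all add: delta_F ra_closed la_closed relators_def, blast)

lemma pure_linear_left: "m \<in> carrier M \<Longrightarrow> linear_map K V VM (\<lambda>v. pure v m)"
  by (rule linear_mapI) (simp_all add: pure_closed pure_add_left pure_smult_left)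

lemma pure_linear_right: "v \<in> carrier V \<Longrightarrow> linear_map K M VM (pure v)"
  by (rule linear_mapI) (simp_all add: pure_closed pure_add_right pure_smult_right)

text \<open>Two stages: for fixed \<open>v\<close>, a submodule that contains the pure tensors with
  \<open>m\<close> in \<open>S\<close> contains them for every \<open>m\<close>; and the pure
  tensors are the cosets of the basis vectors of the free module.\<close>

lemma spanning_pure:
  assumes "spanning K M S"
  shows "spanning K VM {pure v m | v m. v \<in> carrier V \<and> m \<in> S}"
  unfolding spanning_def
proof (intro conjI allI impI)
  have S: "S \<subseteq> carrier M" using assms by (simp add: spanning_def)
  then show "{pure v m | v m. v \<in> carrier V \<and> m \<in> S} \<subseteq> carrier VM"
    using pure_closed by blast
  fix P assume P: "submodule P K VM \<and> {pure v m | v m. v \<in> carrier V \<and> m \<in> S} \<subseteq> P"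
  have pure: "pure v m \<in> P" if vm: "v \<in> carrier V" "m \<in> carrier M" for v m
  proof -
    have "submodule {m \<in> carrier M. pure v m \<in> P} K M"
      using P vm(1) by (intro submodule_vimage[OF M.module_axioms tensor_module pure_linear_right]) auto
    moreover have "S \<subseteq> {m \<in> carrier M. pure v m \<in> P}" using P S vm(1) by blast
    ultimately have "carrier M \<subseteq> {m \<in> carrier M. pure v m \<in> P}"
      using assms unfolding spanning_def by simp
    then show ?thesis using vm(2) by blast
  qed
  have "submodule {x \<in> carrier F. N +>\<^bsub>F\<^esub> x \<in> P} K F"
    using P by (intro submodule_vimage[OF F.module_axioms tensor_module coset_map]) auto
  moreover have "delta K ` (carrier V \<times> carrier M) \<subseteq> {x \<in> carrier F. N +>\<^bsub>F\<^esub> x \<in> P}"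
    using pure delta_F by (auto simp: pure_tensor_def)
  ultimately have "carrier F \<subseteq> {x \<in> carrier F. N +>\<^bsub>F\<^esub> x \<in> P}"
    using spanning_free_mod[OF V.R.is_cring, of "carrier V \<times> carrier M"] unfolding spanning_def by simp
  then show "carrier VM \<subseteq> P"
    unfolding tensor_def subset_iff quot_carrier[OF F.module_axioms N_submodule] by blast
qed

text \<open>The universal property. The last conjunct describes the map on every coset, not only on
  pure tensors; it is what identifies \<open>tensor_map\<close>, a union over representatives, with
  a lift.\<close>

lemma tensor_lift:
  assumes W: "module K W"
    and left: "\<And>m. m \<in> carrier M \<Longrightarrow> linear_map K V W (\<lambda>v. B v m)"
    and right: "\<And>v. v \<in> carrier V \<Longrightarrow> linear_map K M W (B v)"
    and bal: "\<And>v a m. v \<in> carrier V \<Longrightarrow> a \<in> A \<Longrightarrow> m \<in> carrier M \<Longrightarrow> B (ra v a) m = B v (la a m)"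
  shows "\<exists>\<phi>. linear_map K VM W \<phi> \<and>
    (\<forall>v\<in>carrier V. \<forall>m\<in>carrier M. \<phi> (pure v m) = B v m) \<and>
    (\<forall>x\<in>carrier F. \<phi> (N +>\<^bsub>F\<^esub> x) = lincomb K W (case_prod B) x)"
proof -
  interpret W: module K W by (rule W)
  have Bc: "case_prod B \<in> carrier V \<times> carrier M \<rightarrow> carrier W"
    using linear_mapD(1)[OF left] by auto
  let ?h = "lincomb K W (case_prod B)"
  have h: "linear_map K F W ?h" by (rule lincomb_linear[OF W Bc])
  have hd: "?h (delta K (v, m)) = B v m" if "v \<in> carrier V" "m \<in> carrier M" for v m
    using lincomb_delta[OF W Bc, of "(v, m)"] that by simp
  have hm: "?h (x \<ominus>\<^bsub>F\<^esub> y) = \<zero>\<^bsub>W\<^esub>" if "x \<in> carrier F" "y \<in> carrier F" "?h x = ?h y" for x y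
  proof -
    have "x = (x \<ominus>\<^bsub>F\<^esub> y) \<oplus>\<^bsub>F\<^esub> y" using that by (simp add: a_minus_def F.M.a_assoc F.M.l_neg)
    then have "?h y = ?h (x \<ominus>\<^bsub>F\<^esub> y) \<oplus>\<^bsub>W\<^esub> ?h y"
      using linear_mapD(2)[OF h, of "x \<ominus>\<^bsub>F\<^esub> y" y] that by simp
    then show ?thesis
      using linear_mapD(1)[OF h, of y] linear_mapD(1)[OF h, of "x \<ominus>\<^bsub>F\<^esub> y"] that
        W.M.add.r_cancel_one'[of "?h y" "?h (x \<ominus>\<^bsub>F\<^esub> y)"] by simp
  qed
  have rel: "relators \<subseteq> {x \<in> carrier F. ?h x = \<zero>\<^bsub>W\<^esub>}"
  proof
    fix x assume x: "x \<in> relators"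
    then have "?h x = \<zero>\<^bsub>W\<^esub>"
      unfolding relators_def Let_def
    proof (elim UnE CollectE exE conjE)
      fix v v' m assume "x = delta K (v \<oplus>\<^bsub>V\<^esub> v', m) \<ominus>\<^bsub>F\<^esub> (delta K (v, m) \<oplus>\<^bsub>F\<^esub> delta K (v', m))"
        "v \<in> carrier V" "v' \<in> carrier V" "m \<in> carrier M"
      then show ?thesis
        using linear_mapD(2)[OF h] linear_mapD(2)[OF left] by (simp add: hm delta_F hd)
    next
      fix v m m' assume "x = delta K (v, m \<oplus>\<^bsub>M\<^esub> m') \<ominus>\<^bsub>F\<^esub> (delta K (v, m) \<oplus>\<^bsub>F\<^esub> delta K (v, m'))"
        "v \<in> carrier V" "m \<in> carrier M" "m' \<in> carrier M"
      then show ?thesis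
        using linear_mapD(2)[OF h] linear_mapD(2)[OF right] by (simp add: hm delta_F hd)
    next
      fix k v m assume "x = delta K (k \<odot>\<^bsub>V\<^esub> v, m) \<ominus>\<^bsub>F\<^esub> k \<odot>\<^bsub>F\<^esub> delta K (v, m)"
        "k \<in> carrier K" "v \<in> carrier V" "m \<in> carrier M"
      then show ?thesis
        using linear_mapD(3)[OF h] linear_mapD(3)[OF left] by (simp add: hm delta_F hd)
    next
      fix k v m assume "x = delta K (v, k \<odot>\<^bsub>M\<^esub> m) \<ominus>\<^bsub>F\<^esub> k \<odot>\<^bsub>F\<^esub> delta K (v, m)"
        "k \<in> carrier K" "v \<in> carrier V" "m \<in> carrier M"
      then show ?thesis
        using linear_mapD(3)[OF h] linear_mapD(3)[OF right] by (simp add: hm delta_F hd)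
    next
      fix v a m assume "x = delta K (ra v a, m) \<ominus>\<^bsub>F\<^esub> delta K (v, la a m)"
        "v \<in> carrier V" "a \<in> A" "m \<in> carrier M"
      then show ?thesis by (simp add: hm delta_F hd ra_closed la_closed bal)
    qed
    then show "x \<in> {x \<in> carrier F. ?h x = \<zero>\<^bsub>W\<^esub>}" using x relators_closed by blast
  qed
  \<comment> \<open>The kernel is the equalizer with the zero map; since it contains the relators,
    it contains all of \<open>N\<close>.\<close>
  have "submodule {x \<in> carrier F. ?h x = \<zero>\<^bsub>W\<^esub>} K F"
    by (rule submodule_equalizer[OF F.module_axioms W h linear_map_zero_map[OF W]])
  from gen_submodule_least[OF this rel] have 0: "?h n = \<zero>\<^bsub>W\<^esub>" if "n \<in> N" for n
    using that by (auto simp: N_eq)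
  obtain \<phi> where phi: "linear_map K VM W \<phi>" "\<forall>x\<in>carrier F. \<phi> (N +>\<^bsub>F\<^esub> x) = ?h x"
    using quot_lift[OF F.module_axioms N_submodule W h 0] unfolding tensor_def by blast
  then show ?thesis
    by (intro exI[of _ \<phi>]) (simp add: pure_tensor_def delta_F hd)
qed

end

text \<open>Lift the balanced map that sends \<open>v\<close> and \<open>m\<close> to the pure
  tensor of \<open>f v\<close> and \<open>g m\<close>; the union defining \<open>tensor_map\<close>
  then returns the value of this lift on each coset.\<close>

lemma tensor_map_pure_linear:
  assumes T1: "tensor_product K V M A ra la" and T2: "tensor_product K V' M' A' ra' la'"
    and f: "linear_map K V V' f" and g: "linear_map K M M' g"
    and bal: "\<And>v a m. v \<in> carrier V \<Longrightarrow> a \<in> A \<Longrightarrow> m \<in> carrier M \<Longrightarrow>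
      pure_tensor K A' ra' V' la' M' (f (ra v a)) (g m) =
      pure_tensor K A' ra' V' la' M' (f v) (g (la a m))"
  shows "linear_map K (tensor K A ra V la M) (tensor K A' ra' V' la' M')
      (tensor_map K A' ra' V' la' M' f g)"
    and "v \<in> carrier V \<Longrightarrow> m \<in> carrier M \<Longrightarrow>
      tensor_map K A' ra' V' la' M' f g (pure_tensor K A ra V la M v m) =
      pure_tensor K A' ra' V' la' M' (f v) (g m)"
proof -
  interpret T1: tensor_product K V M A ra la by (rule T1)
  interpret T2: tensor_product K V' M' A' ra' la' by (rule T2)
  let ?B = "\<lambda>v m. T2.pure (f v) (g m)"
  have cr: "cring K" by (rule T1.V.R.is_cring)
  note fc = linear_mapD(1)[OF f] and gc = linear_mapD(1)[OF g]
  have fg: "map_prod f g \<in> carrier V \<times> carrier M \<rightarrow> carrier V' \<times> carrier M'"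
    using fc gc by auto
  have Bc: "case_prod ?B \<in> carrier V \<times> carrier M \<rightarrow> carrier T2.VM"
    using fc gc T2.pure_closed by auto
  have l: "linear_map K V T2.VM (\<lambda>v. ?B v m)" if "m \<in> carrier M" for m
    by (rule linear_map_compose[OF f T2.pure_linear_left[OF gc[OF that]]])
  have r: "linear_map K M T2.VM (?B v)" if "v \<in> carrier V" for v
    by (rule linear_map_compose[OF g T2.pure_linear_right[OF fc[OF that]]])
  have "\<exists>\<phi>. linear_map K T1.VM T2.VM \<phi> \<and>
    (\<forall>v\<in>carrier V. \<forall>m\<in>carrier M. \<phi> (T1.pure v m) = ?B v m) \<and>
    (\<forall>x\<in>carrier T1.F. \<phi> (T1.N +>\<^bsub>T1.F\<^esub> x) = lincomb K T2.VM (case_prod ?B) x)"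
    by (rule T1.tensor_lift[OF T2.tensor_module]) (fact l r bal)+
  then obtain \<phi> where "linear_map K T1.VM T2.VM \<phi> \<and>
    (\<forall>v\<in>carrier V. \<forall>m\<in>carrier M. \<phi> (T1.pure v m) = ?B v m) \<and>
    (\<forall>x\<in>carrier T1.F. \<phi> (T1.N +>\<^bsub>T1.F\<^esub> x) = lincomb K T2.VM (case_prod ?B) x)"
    by (rule exE)
  then have phi: "linear_map K T1.VM T2.VM \<phi>"
    and phi_pure: "\<And>v m. v \<in> carrier V \<Longrightarrow> m \<in> carrier M \<Longrightarrow> \<phi> (T1.pure v m) = ?B v m"
    and phi_coset: "\<And>x. x \<in> carrier T1.F \<Longrightarrow>
      \<phi> (T1.N +>\<^bsub>T1.F\<^esub> x) = lincomb K T2.VM (case_prod ?B) x"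
    by simp_all
  \<comment> \<open>Both sides are linear in \<open>x\<close>, so only basis vectors are
    compared.\<close>
  have coset: "T2.N +>\<^bsub>T2.F\<^esub> push K (map_prod f g) x = lincomb K T2.VM (case_prod ?B) x"
    if "x \<in> carrier T1.F" for x
  proof (rule linear_map_eqI[where f = "\<lambda>x. T2.N +>\<^bsub>T2.F\<^esub> push K (map_prod f g) x"
        and g = "lincomb K T2.VM (case_prod ?B)",
        OF T1.F.module_axioms T2.tensor_module _ _ spanning_free_mod[OF cr] _ that])
    show "linear_map K T1.F T2.VM (\<lambda>x. T2.N +>\<^bsub>T2.F\<^esub> push K (map_prod f g) x)"
      by (rule linear_map_compose[OF push_linear[OF cr fg] T2.coset_map])
    show "linear_map K T1.F T2.VM (lincomb K T2.VM (case_prod ?B))"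
      by (rule lincomb_linear[OF T2.tensor_module Bc])
    fix s assume "s \<in> delta K ` (carrier V \<times> carrier M)"
    then obtain v m where vm: "(v, m) \<in> carrier V \<times> carrier M" "s = delta K (v, m)" by auto
    show "T2.N +>\<^bsub>T2.F\<^esub> push K (map_prod f g) s = lincomb K T2.VM (case_prod ?B) s"
      using lincomb_delta[OF T2.tensor_module Bc vm(1)] push_delta[OF cr fg vm(1)]
      by (simp only: vm(2) map_prod_simp case_prod_conv) (simp only: pure_tensor_def)
  qed
  have eq: "tensor_map K A' ra' V' la' M' f g X = \<phi> X" if "X \<in> carrier T1.VM" for X
  proof -
    have "\<exists>x\<in>carrier T1.F. X = T1.N +>\<^bsub>T1.F\<^esub> x"
      using that by (simp only: tensor_def quot_carrier[OF T1.F.module_axioms T1.N_submodule])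
    then obtain x where x: "x \<in> carrier T1.F" "X = T1.N +>\<^bsub>T1.F\<^esub> x"
      by (rule bexE)
    have "tensor_map K A' ra' V' la' M' f g X = T2.N +>\<^bsub>T2.F\<^esub> push K (map_prod f g) x"
      unfolding tensor_map_def x(2)
    proof (rule Union_coset[OF T1.F.module_axioms T1.N_submodule _ x(1)])
      fix y assume "y \<in> T1.N +>\<^bsub>T1.F\<^esub> x"
      note y = coset_memD[OF T1.F.module_axioms T1.N_submodule x(1) this]
      show "T2.N +>\<^bsub>T2.F\<^esub> push K (map_prod f g) y = T2.N +>\<^bsub>T2.F\<^esub> push K (map_prod f g) x"
        unfolding coset[OF x(1)] coset[OF y(1)] phi_coset[OF x(1), symmetric] phi_coset[OF y(1), symmetric] y(2) ..
    qed
    then show ?thesis using coset[OF x(1)] phi_coset[OF x(1)] x(2) by simp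
  qed
  show "linear_map K T1.VM T2.VM (tensor_map K A' ra' V' la' M' f g)"
    by (rule linear_map_cong[OF phi T1.tensor_module]) (simp add: eq)
  show "tensor_map K A' ra' V' la' M' f g (T1.pure v m) = T2.pure (f v) (g m)"
    if "v \<in> carrier V" "m \<in> carrier M"
    using eq[OF T1.pure_closed[OF that]] phi_pure[OF that] by simp
qed

lemma tensor_product_K:
  assumes "module K V" "module K W"
  shows "tensor_product K V W (carrier K) (\<lambda>v k. k \<odot>\<^bsub>V\<^esub> v) (smult W)"
proof -
  interpret V: module K V by fact
  interpret W: module K W by fact
  show ?thesis by unfold_locales simp_all
qed

text \<open>Over \<open>K\<close> itself the balancing condition is automatic: a scalar passes out
  of either factor by linearity.\<close>

lemma tensor_map_K_pure_linear:
  assumes V: "module K V" and W: "module K W" and V': "module K V'" and W': "module K W'"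
    and f: "linear_map K V V' f" and g: "linear_map K W W' g"
  shows "linear_map K (tensor_K K V W) (tensor_K K V' W') (tensor_map_K K V' W' f g)"
    and "v \<in> carrier V \<Longrightarrow> w \<in> carrier W \<Longrightarrow>
      tensor_map_K K V' W' f g (pure_tensor_K K V W v w) = pure_tensor_K K V' W' (f v) (g w)"
proof -
  interpret T2: tensor_product K V' W' "carrier K" "\<lambda>v k. k \<odot>\<^bsub>V'\<^esub> v" "smult W'"
    by (rule tensor_product_K[OF V' W'])
  have bal: "T2.pure (f (k \<odot>\<^bsub>V\<^esub> v)) (g w) = T2.pure (f v) (g (k \<odot>\<^bsub>W\<^esub> w))"
    if "v \<in> carrier V" "k \<in> carrier K" "w \<in> carrier W" for v k w
    using that linear_mapD(1,3)[OF f] linear_mapD(1,3)[OF g]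
    by (simp add: T2.pure_smult_left T2.pure_smult_right)
  show "linear_map K (tensor_K K V W) (tensor_K K V' W') (tensor_map_K K V' W' f g)"
    by (rule tensor_map_pure_linear(1)[OF tensor_product_K[OF V W] T2.tensor_product_axioms f g])
      (use bal in auto)
  show "tensor_map_K K V' W' f g (pure_tensor_K K V W v w) = pure_tensor_K K V' W' (f v) (g w)"
    if "v \<in> carrier V" "w \<in> carrier W"
    by (rule tensor_map_pure_linear(2)[OF tensor_product_K[OF V W] T2.tensor_product_axioms f g])
      (use bal that in auto)
qed

subsection \<open>Direct sums\<close>

lemma dsum_carrier: "f \<in> carrier (dsum I V) \<longleftrightarrow> f \<in> (\<Pi>\<^sub>E i\<in>I. carrier (V i))"
  by (simp add: dsum_def)

lemma dsum_ops:
  "zero (dsum I V) = (\<lambda>i\<in>I. \<zero>\<^bsub>V i\<^esub>)"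
  "f \<oplus>\<^bsub>dsum I V\<^esub> g = (\<lambda>i\<in>I. f i \<oplus>\<^bsub>V i\<^esub> g i)"
  "k \<odot>\<^bsub>dsum I V\<^esub> f = (\<lambda>i\<in>I. k \<odot>\<^bsub>V i\<^esub> f i)"
  by (simp_all add: dsum_def)

definition dsum_single :: "'i set \<Rightarrow> ('i \<Rightarrow> ('k, 'v) module) \<Rightarrow> 'i \<Rightarrow> 'v \<Rightarrow> 'i \<Rightarrow> 'v" where
  "dsum_single I V i x = (\<lambda>j\<in>I. if j = i then x else \<zero>\<^bsub>V j\<^esub>)"

context
  fixes K :: "('k, 'z) ring_scheme" and I :: "'i set" and V :: "'i \<Rightarrow> ('k, 'v) module"
  assumes K: "cring K" and V: "\<And>i. i \<in> I \<Longrightarrow> module K (V i)"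
begin

lemma dsum_module: "module K (dsum I V)"
proof -
  interpret K: cring K by (rule K)
  have ag: "abelian_group (V i)" if "i \<in> I" for i
    using V[OF that] by (rule module.axioms)
  note am = abelian_group.axioms(1)[OF ag]
  show ?thesis
  proof (rule moduleI)
    show "abelian_group (dsum I V)"
    proof (rule abelian_groupI)
      fix f assume f: "f \<in> carrier (dsum I V)"
      show "\<exists>g\<in>carrier (dsum I V). g \<oplus>\<^bsub>dsum I V\<^esub> f = \<zero>\<^bsub>dsum I V\<^esub>"
      proof
        show "(\<lambda>i\<in>I. \<ominus>\<^bsub>V i\<^esub> f i) \<in> carrier (dsum I V)"
          using f abelian_group.a_inv_closed[OF ag] by (auto simp: dsum_carrier)
        show "(\<lambda>i\<in>I. \<ominus>\<^bsub>V i\<^esub> f i) \<oplus>\<^bsub>dsum I V\<^esub> f = \<zero>\<^bsub>dsum I V\<^esub>"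
          using f abelian_group.l_neg[OF ag]
          by (auto simp: dsum_carrier dsum_ops PiE_iff intro!: restrict_ext)
      qed
    qed (auto simp: dsum_carrier dsum_ops PiE_iff abelian_monoid.a_closed[OF am] abelian_monoid.zero_closed[OF am]
        abelian_monoid.a_assoc[OF am] abelian_monoid.a_comm[OF am] abelian_monoid.l_zero[OF am]
        abelian_monoid.a_lcomm[OF am] abelian_monoid.r_zero[OF am]
        intro!: restrict_ext extensionalityI[of _ I])
  qed (auto simp: K dsum_carrier dsum_ops PiE_iff module.smult_closed[OF V] module.smult_l_distr[OF V]
      module.smult_r_distr[OF V] module.smult_assoc1[OF V] module.smult_one[OF V]
      intro!: restrict_ext extensionalityI[of _ I])
qed

lemma dsum_single_closed:
  assumes "x \<in> carrier (V i)"
  shows "dsum_single I V i x \<in> carrier (dsum I V)"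
proof -
  have "\<zero>\<^bsub>V j\<^esub> \<in> carrier (V j)" if "j \<in> I" for j
    using abelian_monoid.zero_closed[OF abelian_group.axioms(1)[OF module.axioms(2)[OF V[OF that]]]] .
  then show ?thesis using assms by (auto simp: dsum_carrier dsum_single_def)
qed

lemma dsum_single_linear:
  "linear_map K (V i) (dsum I V) (dsum_single I V i)"
proof (rule linear_mapI)
  have am: "abelian_monoid (V j)" if "j \<in> I" for j
    using abelian_group.axioms(1)[OF module.axioms(2)[OF V[OF that]]] .
  fix x y assume "x \<in> carrier (V i)" "y \<in> carrier (V i)"
  show "dsum_single I V i (x \<oplus>\<^bsub>V i\<^esub> y) = dsum_single I V i x \<oplus>\<^bsub>dsum I V\<^esub> dsum_single I V i y"
    using abelian_monoid.l_zero[OF am abelian_monoid.zero_closed[OF am]]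
    by (auto simp: dsum_single_def dsum_ops intro!: restrict_ext)
next
  fix k x assume "k \<in> carrier K" "x \<in> carrier (V i)"
  then show "dsum_single I V i (k \<odot>\<^bsub>V i\<^esub> x) = k \<odot>\<^bsub>dsum I V\<^esub> dsum_single I V i x"
    using module.smult_r_null[OF V] by (auto simp: dsum_single_def dsum_ops intro!: restrict_ext)
qed (rule dsum_single_closed)

text \<open>Finiteness of \<open>I\<close> allows an element to be rebuilt one component at a time:
  the induction runs over the sets \<open>J\<close> of components already in place.\<close>

lemma dsum_spanning:
  assumes fin: "finite I" and S: "\<And>i. i \<in> I \<Longrightarrow> spanning K (V i) (S i)"
  shows "spanning K (dsum I V) {dsum_single I V i x | i x. i \<in> I \<and> x \<in> S i}"
  unfolding spanning_def
proof (intro conjI allI impI)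
  show "{dsum_single I V i x | i x. i \<in> I \<and> x \<in> S i} \<subseteq> carrier (dsum I V)"
    using S by (auto simp: spanning_def subset_iff intro!: dsum_single_closed)
  fix P assume P: "submodule P K (dsum I V) \<and> {dsum_single I V i x | i x. i \<in> I \<and> x \<in> S i} \<subseteq> P"
  interpret P: submodule P K "dsum I V" using P by blast
  interpret D: module K "dsum I V" by (rule dsum_module)
  have am: "abelian_monoid (V j)" if "j \<in> I" for j
    using abelian_group.axioms(1)[OF module.axioms(2)[OF V[OF that]]] .
  have single: "dsum_single I V i x \<in> P" if i: "i \<in> I" and x: "x \<in> carrier (V i)" for i x
  proof -
    have "submodule {x \<in> carrier (V i). dsum_single I V i x \<in> P} K (V i)"
      by (rule submodule_vimage[OF V[OF i] dsum_module dsum_single_linear P.submodule_axioms])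
    moreover have "S i \<subseteq> {x \<in> carrier (V i). dsum_single I V i x \<in> P}"
      using P i S[OF i] by (auto simp: spanning_def)
    ultimately have "carrier (V i) \<subseteq> {x \<in> carrier (V i). dsum_single I V i x \<in> P}"
      using S[OF i] unfolding spanning_def by simp
    then show ?thesis using x by blast
  qed
  show "carrier (dsum I V) \<subseteq> P"
  proof
    fix f assume f: "f \<in> carrier (dsum I V)"
    have "(\<lambda>i\<in>I. if i \<in> J then f i else \<zero>\<^bsub>V i\<^esub>) \<in> P" if "J \<subseteq> I" for J
      using finite_subset[OF that fin] that
    proof (induction J)
      case empty
      then show ?case using P.one_closed by (simp add: dsum_ops restrict_def cong: if_cong)
    next
      case (insert j J)
      have "(\<lambda>i\<in>I. if i \<in> insert j J then f i else \<zero>\<^bsub>V i\<^esub>)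
          = dsum_single I V j (f j) \<oplus>\<^bsub>dsum I V\<^esub> (\<lambda>i\<in>I. if i \<in> J then f i else \<zero>\<^bsub>V i\<^esub>)"
        using insert.prems insert.hyps f abelian_monoid.l_zero[OF am] abelian_monoid.r_zero[OF am]
          abelian_monoid.zero_closed[OF am]
        by (auto simp: dsum_single_def dsum_ops dsum_carrier PiE_iff intro!: restrict_ext)
      moreover have "dsum_single I V j (f j) \<in> P"
        using insert.prems f by (intro single) (auto simp: dsum_carrier)
      moreover have "(\<lambda>i\<in>I. if i \<in> J then f i else \<zero>\<^bsub>V i\<^esub>) \<in> P"
        using insert.prems by (intro insert.IH) blast
      ultimately show ?case using P.m_closed by (simp only: monoid_record_simps)
    qed
    from this[OF subset_refl] show "f \<in> P"
      using f extensional_restrict[of f I] by (simp add: dsum_carrier PiE_iff cong: restrict_cong)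
  qed
qed

lemma dsum_proj_linear: "i \<in> I \<Longrightarrow> linear_map K (dsum I V) (V i) (\<lambda>f. f i)"
  by (rule linear_mapI) (auto simp: dsum_carrier dsum_ops)

text \<open>Maps out of the summands add up to one map out of the sum; on an element supported at
  \<open>i\<close> all other terms are images of zero.\<close>

lemma dsum_copair:
  assumes fin: "finite I" and W: "module K W" and psi: "\<And>i. i \<in> I \<Longrightarrow> linear_map K (V i) W (\<psi> i)"
  shows "linear_map K (dsum I V) W (\<lambda>f. \<Oplus>\<^bsub>W\<^esub> i\<in>I. \<psi> i (f i))"
    and "i \<in> I \<Longrightarrow> x \<in> carrier (V i) \<Longrightarrow> (\<Oplus>\<^bsub>W\<^esub> j\<in>I. \<psi> j (dsum_single I V i x j)) = \<psi> i x"
proof -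
  interpret W: module K W by (rule W)
  show "linear_map K (dsum I V) W (\<lambda>f. \<Oplus>\<^bsub>W\<^esub> i\<in>I. \<psi> i (f i))"
    by (rule linear_map_finsum[OF W fin linear_map_compose[OF dsum_proj_linear psi]])
  assume i: "i \<in> I" and x: "x \<in> carrier (V i)"
  have "(\<Oplus>\<^bsub>W\<^esub> j\<in>I. \<psi> j (dsum_single I V i x j)) = (\<Oplus>\<^bsub>W\<^esub> j\<in>I. if i = j then \<psi> i x else \<zero>\<^bsub>W\<^esub>)"
    using linear_map_zero[OF V W psi] linear_mapD(1)[OF psi[OF i] x]
    by (intro W.M.finsum_cong') (auto simp: dsum_single_def)
  also have "\<dots> = \<psi> i x"
    using linear_mapD(1)[OF psi[OF i] x] by (intro W.M.finsum_singleton[OF i fin]) auto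
  finally show "(\<Oplus>\<^bsub>W\<^esub> j\<in>I. \<psi> j (dsum_single I V i x j)) = \<psi> i x" .
qed

end

subsection \<open>Composition with permutation diagrams\<close>

text \<open>A criterion for a guessed list of connected components: each set is closed under steps
  and connected by them. It is then the class of any of its points, and disjointness
  follows.\<close>

lemma quotient_rtrancl_eq:
  assumes closed: "\<And>C a b. C \<in> \<C> \<Longrightarrow> a \<in> C \<Longrightarrow> (a, b) \<in> R \<Longrightarrow> b \<in> C"
    and connected: "\<And>C a b. C \<in> \<C> \<Longrightarrow> a \<in> C \<Longrightarrow> b \<in> C \<Longrightarrow> (a, b) \<in> R\<^sup>*"
    and nonempty: "{} \<notin> \<C>"
  shows "\<Union>\<C> // R\<^sup>* = \<C>"
proof -
  have cls: "R\<^sup>* `` {a} = C" if "C \<in> \<C>" "a \<in> C" for C a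
  proof -
    have "b \<in> C" if "(a, b) \<in> R\<^sup>*" for b
      using that \<open>a \<in> C\<close> by (induction rule: rtrancl_induct) (auto intro: closed[OF \<open>C \<in> \<C>\<close>])
    then show ?thesis using connected[OF that] by blast
  qed
  show ?thesis
  proof
    show "\<Union>\<C> // R\<^sup>* \<subseteq> \<C>" using cls by (auto simp: quotient_def)
    show "\<C> \<subseteq> \<Union>\<C> // R\<^sup>*"
    proof
      fix C assume C: "C \<in> \<C>"
      then obtain a where "a \<in> C" using nonempty by (metis ex_in_conv)
      then show "C \<in> \<Union>\<C> // R\<^sup>*" using cls[OF C] C by (auto simp: quotient_def)
    qed
  qed
qed

text \<open>\<open>E1\<close> stands for the strands of a diagram, and each \<open>a\<close> in
  \<open>Q\<close> is a new end hung by a pendant edge on the old end \<open>\<sigma> a\<close>.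
  Prolonging neither merges nor splits strands, so components correspond to strands.\<close>

lemma components_prolong:
  assumes E1: "\<And>e. e \<in> E1 \<Longrightarrow> card e = 2" "disjoint E1"
    and \<sigma>: "inj_on \<sigma> Q" "\<sigma> ` Q \<subseteq> \<Union>E1" "Q \<inter> \<Union>E1 = {}"
    and E: "E = E1 \<union> (\<lambda>a. {\<sigma> a, a}) ` Q"
  shows "\<Union>E // {(a, b). {a, b} \<in> E}\<^sup>* = (\<lambda>e. e \<union> {a \<in> Q. \<sigma> a \<in> e}) ` E1"
proof -
  let ?R = "{(a, b). {a, b} \<in> E}" and ?c = "\<lambda>e. e \<union> {a \<in> Q. \<sigma> a \<in> e}"
  have un: "\<Union>E = \<Union>(?c ` E1)" using \<sigma>(2) by (auto simp: E)
  have eqE: "e = e'" if "e \<in> E1" "e' \<in> E1" "x \<in> e" "x \<in> e'" for e e' x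
    using E1(2) that by (auto simp: disjoint_def)
  show ?thesis
    unfolding un
  proof (rule quotient_rtrancl_eq)
    show "{} \<notin> ?c ` E1" using E1(1) by fastforce
  next
    fix C a b assume "C \<in> ?c ` E1" and a: "a \<in> C" and ab: "(a, b) \<in> ?R"
    then obtain e where e: "e \<in> E1" "C = ?c e" by auto
    from ab consider "{a, b} \<in> E1" | c where "c \<in> Q" "{a, b} = {\<sigma> c, c}" by (auto simp: E)
    then show "b \<in> C"
    proof cases
      case 1
      then have "a \<in> e" using a e \<sigma>(3) by auto
      then show ?thesis using eqE[OF e(1) 1] e by auto
    next
      case 2
      then have "a = \<sigma> c \<and> b = c \<or> a = c \<and> b = \<sigma> c" by (auto simp: doubleton_eq_iff)
      then show ?thesis using 2(1) a e \<sigma>(2,3) by auto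
    qed
  next
    fix C a b assume "C \<in> ?c ` E1" and ab: "a \<in> C" "b \<in> C"
    then obtain e where e: "e \<in> E1" "C = ?c e" by auto
    have clique: "(x, y) \<in> ?R\<^sup>*" if "x \<in> e" "y \<in> e" for x y
    proof (cases "x = y")
      case False
      have "finite e" "card e = card {x, y}" using E1(1)[OF e(1)] False by (auto intro: card_ge_0_finite)
      then have "e = {x, y}" using that by (metis card_subset_eq empty_subsetI insert_subset)
      then show ?thesis using e(1) by (auto simp: E)
    qed simp
    \<comment> \<open>Every point of \<open>C\<close> is at most one pendant edge away from
      \<open>e\<close>, so connectivity reduces to the two ends of \<open>e\<close>.\<close>
    have foot: "\<exists>y\<in>e. (x, y) \<in> ?R\<^sup>* \<and> (y, x) \<in> ?R\<^sup>*" if "x \<in> C" for x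
    proof (cases "x \<in> e")
      case False
      then have x: "x \<in> Q" "\<sigma> x \<in> e" using that e by auto
      then have "{x, \<sigma> x} \<in> E" by (auto simp: E insert_commute)
      then have "(x, \<sigma> x) \<in> ?R" "(\<sigma> x, x) \<in> ?R" by (auto simp: insert_commute)
      then show ?thesis using x by blast
    qed blast
    obtain y z where "y \<in> e" "z \<in> e" "(a, y) \<in> ?R\<^sup>*" "(z, b) \<in> ?R\<^sup>*"
      using foot[OF ab(1)] foot[OF ab(2)] by blast
    then show "(a, b) \<in> ?R\<^sup>*" using clique[of y z] by (meson rtrancl_trans)
  qed
qed

text \<open>Every middle point of a strand carries an outer end in \<open>Q\<close>, so no component
  stays in the middle and there are no loops. Deleting the middle points replaces each middle end by
  its outer one, which is \<open>\<tau>\<close>.\<close>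

lemma prolonged_strands:
  assumes E1: "\<And>e. e \<in> E1 \<Longrightarrow> card e = 2"
    and Q: "\<sigma> ` Q = \<Union>E1 \<inter> mid_points" "Q \<inter> mid_points = {}"
    and \<tau>: "\<And>a. a \<in> Q \<Longrightarrow> \<tau> (\<sigma> a) = a" "\<And>x. x \<notin> mid_points \<Longrightarrow> \<tau> x = x"
    and S: "S = (\<lambda>e. e \<union> {a \<in> Q. \<sigma> a \<in> e}) ` E1"
  shows "{C \<in> S. C \<subseteq> mid_points} = {}"
    and "{C - mid_points | C. C \<in> S \<and> \<not> C \<subseteq> mid_points} = (\<lambda>e. \<tau> ` e) ` E1"
proof -
  let ?c = "\<lambda>e. e \<union> {a \<in> Q. \<sigma> a \<in> e}"
  have nsub: "\<not> ?c e \<subseteq> mid_points" if e: "e \<in> E1" for e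
  proof
    assume sub: "?c e \<subseteq> mid_points"
    obtain x where x: "x \<in> e" using E1[OF e] by (metis card.empty ex_in_conv zero_neq_numeral)
    then have "x \<in> \<sigma> ` Q" using sub e unfolding Q(1) by auto
    then show False using x sub Q(2) by auto
  qed
  then show "{C \<in> S. C \<subseteq> mid_points} = {}" by (auto simp: S)
  have img: "?c e - mid_points = \<tau> ` e" if e: "e \<in> E1" for e
  proof
    show "?c e - mid_points \<subseteq> \<tau> ` e"
    proof
      fix x assume x: "x \<in> ?c e - mid_points"
      then show "x \<in> \<tau> ` e"
      proof (cases "x \<in> e")
        case True
        then have "\<tau> x = x" using \<tau>(2)[of x] x e by blast
        then show ?thesis using True by force
      next
        case False
        then have "x \<in> Q" "\<sigma> x \<in> e" using x by auto
        then show ?thesis using \<tau>(1)[of x] by force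
      qed
    qed
    show "\<tau> ` e \<subseteq> ?c e - mid_points"
    proof
      fix y assume "y \<in> \<tau> ` e"
      then obtain x where x: "x \<in> e" "y = \<tau> x" by auto
      show "y \<in> ?c e - mid_points"
      proof (cases "x \<in> mid_points")
        case True
        then have "x \<in> \<sigma> ` Q" using x e unfolding Q(1) by auto
        then show ?thesis using x \<tau>(1) Q(2) by auto
      next
        case False
        then have "\<tau> x = x" using \<tau>(2)[of x] x e by blast
        then show ?thesis using x False by auto
      qed
    qed
  qed
  show "{C - mid_points | C. C \<in> S \<and> \<not> C \<subseteq> mid_points} = (\<lambda>e. \<tau> ` e) ` E1"
  proof -
    have "\<forall>C\<in>S. \<not> C \<subseteq> mid_points" unfolding S using nsub by blast
    then have "{C. C \<in> S \<and> \<not> C \<subseteq> mid_points} = S" by fast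
    then have "{C - mid_points | C. C \<in> S \<and> \<not> C \<subseteq> mid_points} = (\<lambda>C. C - mid_points) ` S"
      by (simp only: setcompr_eq_image)
    also have "\<dots> = (\<lambda>e. \<tau> ` e) ` E1"
      unfolding S image_image by (intro image_cong refl img)
    finally show ?thesis .
  qed
qed

section \<open>Permutations, edges and levels of diagrams\<close>

lemma all_side: "(\<forall>w. P w) \<longleftrightarrow> P Lft \<and> P Rgt"
  by (metis side.exhaust)

lemma Sym_carrier_iff: "g \<in> carrier (Sym r) \<longleftrightarrow> (\<forall>w. sel w g permutes {1..sel w r})"
  by (simp add: all_side DirProd_def sym_group_carrier mem_Times_iff)

lemma sel_inv:
  assumes "g \<in> carrier (Sym r)"
  shows "sel w (inv\<^bsub>Sym r\<^esub> g) = inv' (sel w g)"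
proof -
  have "fst g \<in> carrier (sym_group (fst r))" "snd g \<in> carrier (sym_group (snd r))"
    using assms by (auto simp: DirProd_def mem_Times_iff)
  then have "inv\<^bsub>Sym r\<^esub> (fst g, snd g) = (inv' (fst g), inv' (snd g))"
    by (simp only: inv_DirProd[OF sym_group_is_group sym_group_is_group] sym_group_inv_equality)
  then show ?thesis by (cases w) (simp_all only: sel.simps prod.collapse fst_conv snd_conv)
qed

lemma diagrams_strands:
  assumes "d \<in> diagrams r s"
  shows "\<And>e. e \<in> d \<Longrightarrow> card e = 2" "disjoint d" "\<Union>d = points r s"
  using assms by (auto simp: diagrams_def partition_on_def)

lemma relevel_strands:
  assumes "d \<in> diagrams r s" "inj_on f {Top, Bot}"
  shows "\<And>e. e \<in> relevel f d \<Longrightarrow> card e = 2" "disjoint (relevel f d)"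
    "\<Union>(relevel f d) = (\<lambda>(l, w, i). (f l, w, i)) ` points r s"
proof -
  let ?f = "\<lambda>(l, w, i). (f l, w, i)"
  have inj: "inj_on ?f (points r s)"
    using assms(2) by (auto simp: inj_on_def points_def)
  have sub: "e \<subseteq> points r s" if "e \<in> d" for e
    using that diagrams_strands(3)[OF assms(1)] by auto
  show "card e = 2" if e: "e \<in> relevel f d" for e
  proof -
    obtain e' where e': "e' \<in> d" "e = ?f ` e'" using e unfolding relevel_def by blast
    then show ?thesis
      using card_image[OF inj_on_subset[OF inj sub[OF e'(1)]]] diagrams_strands(1)[OF assms(1)] by simp
  qed
  show "\<Union>(relevel f d) = ?f ` points r s"
    unfolding relevel_def diagrams_strands(3)[OF assms(1), symmetric] by blast
  have "?f ` e \<inter> ?f ` e' = {}" if "e \<in> d" "e' \<in> d" "e \<noteq> e'" for e e'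
    using inj_on_image_Int[OF inj sub[OF that(1)] sub[OF that(2)]] diagrams_strands(2)[OF assms(1)] that
    by (auto simp: disjoint_def)
  then show "disjoint (relevel f d)" unfolding relevel_def disjoint_def by blast
qed

definition slots :: "level \<Rightarrow> nat \<times> nat \<Rightarrow> point set" where
  "slots l r = (\<lambda>(w, i). (l, w, i)) ` (SIGMA w : UNIV. {1..sel w r})"

lemma slots_iff: "(l, w, i) \<in> slots l' r \<longleftrightarrow> l = l' \<and> i \<in> {1..sel w r}"
  by (auto simp: slots_def)

lemma slotsE:
  assumes "x \<in> slots l r"
  obtains w i where "x = (l, w, i)" "i \<in> {1..sel w r}"
  using assms by (auto simp: slots_def)

lemma points_slots: "points r s = slots Top r \<union> slots Bot s"
  by (auto simp: points_def slots_iff)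

lemma relevel_slots: "(\<lambda>(l, w, i). (f l, w, i)) ` slots l r = slots (f l) r"
  unfolding slots_def image_image by (intro image_cong refl) auto

lemma perm_diagram_image:
  "perm_diagram r g = (\<lambda>(w, i). {(Top, w, sel w g i), (Bot, w, i)}) ` (SIGMA w : UNIV. {1..sel w r})"
proof (intro equalityI subsetI)
  fix e assume "e \<in> (\<lambda>(w, i). {(Top, w, sel w g i), (Bot, w, i)}) ` (SIGMA w : UNIV. {1..sel w r})"
  then obtain w i where "i \<in> {1..sel w r}" "e = {(Top, w, sel w g i), (Bot, w, i)}" by auto
  then show "e \<in> perm_diagram r g" unfolding perm_diagram_def by blast
qed (auto simp: perm_diagram_def)

lemma relevel_perm_diagram:
  "relevel f (perm_diagram r g) =
    (\<lambda>(w, i). {(f Top, w, sel w g i), (f Bot, w, i)}) ` (SIGMA w : UNIV. {1..sel w r})"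
  unfolding relevel_def perm_diagram_image image_image by (intro image_cong refl) auto

text \<open>Renumbering of the positions on one edge; this is what stacking a permutation diagram
  does to a diagram.\<close>

definition relabel :: "level \<Rightarrow> (side \<Rightarrow> nat \<Rightarrow> nat) \<Rightarrow> diagram \<Rightarrow> diagram" where
  "relabel l0 \<pi> d = (\<lambda>e. (\<lambda>(l, w, i). if l = l0 then (l, w, \<pi> w i) else (l, w, i)) ` e) ` d"

lemma Sym_permutes_slots:
  assumes g: "g \<in> carrier (Sym p)"
  shows "(\<lambda>(w, i). (w, sel w g i)) ` (SIGMA w : UNIV. {1..sel w p}) = (SIGMA w : UNIV. {1..sel w p})"
    (is "_ ` ?S = _")
proof
  have perm: "sel w g permutes {1..sel w p}" for w using g unfolding Sym_carrier_iff by blast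
  show "(\<lambda>(w, i). (w, sel w g i)) ` ?S \<subseteq> ?S" using permutes_in_image[OF perm] by auto
  show "?S \<subseteq> (\<lambda>(w, i). (w, sel w g i)) ` ?S"
  proof
    fix x assume "x \<in> ?S"
    then obtain w i where x: "x = (w, i)" "i \<in> {1..sel w p}" by auto
    then obtain j where "j \<in> {1..sel w p}" "i = sel w g j" using permutes_image[OF perm, of w] by blast
    then show "x \<in> (\<lambda>(w, i). (w, sel w g i)) ` ?S" using x by force
  qed
qed

text \<open>Both orders of stacking are treated at once. \<open>l\<close> is the outer edge of the
  permutation diagram, whose strands run from \<open>\<pi> w i\<close> in the middle to
  \<open>i\<close> on \<open>l\<close>; a strand of \<open>d\<close> that ends in the middle at
  \<open>j\<close> therefore surfaces on \<open>l\<close> at the inverse image of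
  \<open>j\<close>.\<close>

lemma stack_perm:
  assumes d: "d \<in> diagrams a c"
    and l: "l = Bot \<and> q = c \<and> l' = Top \<and> q' = a \<or> l = Top \<and> q = a \<and> l' = Bot \<and> q' = c"
    and perm: "\<And>w. \<pi> w permutes {1..sel w q}"
    and E: "relevel (\<lambda>l. if l = Bot then Mid else l) x \<union> relevel (\<lambda>l. if l = Top then Mid else l) y =
      relevel (\<lambda>k. if k = l then Mid else k) d \<union>
      (\<lambda>(w, i). {(Mid, w, \<pi> w i), (l, w, i)}) ` (SIGMA w : UNIV. {1..sel w q})"
  shows "dcomp x y = relabel l (\<lambda>w. inv' (\<pi> w)) d" and "loops x y = 0"
proof -
  let ?f = "\<lambda>k. if k = l then Mid else k"
  define Q where "Q = slots l q"
  define \<sigma> :: "point \<Rightarrow> point" where "\<sigma> = (\<lambda>(k, w, i). (Mid, w, \<pi> w i))"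
  define \<tau> :: "point \<Rightarrow> point" where "\<tau> = (\<lambda>(k, w, i). if k = Mid then (l, w, inv' (\<pi> w) i) else (k, w, i))"
  let ?E1 = "relevel ?f d"
  have injf: "inj_on ?f {Top, Bot}" by (auto simp: inj_on_def)
  note E1 = relevel_strands[OF d injf]
  have lM: "l \<noteq> Mid" "l' \<noteq> Mid" "l \<noteq> l'" using l by auto
  have inv: "inv' (\<pi> w) (\<pi> w i) = i" "\<pi> w (inv' (\<pi> w) i) = i" for w i
    using permutes_inverses[OF perm] by auto
  have in_iff: "\<pi> w i \<in> {1..sel w q} \<longleftrightarrow> i \<in> {1..sel w q}"
    "inv' (\<pi> w) i \<in> {1..sel w q} \<longleftrightarrow> i \<in> {1..sel w q}" for w i
    using permutes_in_image[OF perm] permutes_in_image[OF permutes_inv[OF perm]] by auto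
  have pts: "\<Union>?E1 = slots l' q' \<union> slots Mid q"
    unfolding E1(3) points_slots image_Un relevel_slots using l by (elim disjE conjE) (simp_all add: Un_commute)
  have E2: "(\<lambda>(w, i). {(Mid, w, \<pi> w i), (l, w, i)}) ` (SIGMA w : UNIV. {1..sel w q}) = (\<lambda>a. {\<sigma> a, a}) ` Q"
    unfolding Q_def slots_def image_image by (intro image_cong refl) (auto simp: \<sigma>_def)
  have Qmid: "\<sigma> ` Q = \<Union>?E1 \<inter> mid_points"
  proof -
    have "(Mid, w, i) \<in> \<sigma> ` Q" if "i \<in> {1..sel w q}" for w i
      using that in_iff(2)[of w i] inv[of w i]
      by (intro image_eqI[of _ _ "(l, w, inv' (\<pi> w) i)"]) (auto simp: \<sigma>_def Q_def slots_iff)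
    moreover have "\<sigma> a \<in> slots Mid q" if "a \<in> Q" for a
      using that in_iff(1) by (auto simp: Q_def \<sigma>_def slots_iff elim!: slotsE)
    ultimately have "\<sigma> ` Q = slots Mid q" by (auto elim!: slotsE)
    then show ?thesis unfolding pts using lM by (auto simp: mid_points_def slots_iff elim!: slotsE)
  qed
  have comps: "stack_components x y = (\<lambda>e. e \<union> {a \<in> Q. \<sigma> a \<in> e}) ` ?E1"
    unfolding stack_components_def Let_def E E2
  proof (rule components_prolong)
    show "inj_on \<sigma> Q" by (rule inj_on_inverseI[of _ \<tau>]) (auto simp: \<sigma>_def \<tau>_def Q_def inv elim!: slotsE)
    show "\<sigma> ` Q \<subseteq> \<Union>?E1" using Qmid by blast
    show "Q \<inter> \<Union>?E1 = {}" unfolding pts using lM by (auto simp: Q_def elim!: slotsE)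
  qed (fact E1(1) E1(2) refl)+
  have 1: "Q \<inter> mid_points = {}" using lM by (auto simp: Q_def mid_points_def elim!: slotsE)
  have 2: "\<tau> (\<sigma> a) = a" if "a \<in> Q" for a using that by (auto simp: \<sigma>_def \<tau>_def Q_def inv elim!: slotsE)
  have 3: "\<tau> x = x" if "x \<notin> mid_points" for x using that by (auto simp: \<tau>_def mid_points_def split: prod.splits)
  note prolonged = prolonged_strands[where ?E1.0 = ?E1 and \<sigma> = \<sigma> and \<tau> = \<tau> and Q = Q]
  have "{C \<in> stack_components x y. C \<subseteq> mid_points} = {}"
    by (rule prolonged(1)) (fact E1(1) Qmid 1 2 3 comps)+
  then show "loops x y = 0" unfolding loops_def by (simp only: card.empty)
  have "dcomp x y = (\<lambda>e. \<tau> ` e) ` ?E1"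
    unfolding dcomp_def by (rule prolonged(2)) (fact E1(1) Qmid 1 2 3 comps)+
  also have "\<dots> = relabel l (\<lambda>w. inv' (\<pi> w)) d"
    unfolding relevel_def relabel_def image_image
  proof (intro image_cong refl)
    fix e x assume "e \<in> d" "x \<in> e"
    then have "x \<in> points a c" using diagrams_strands(3)[OF d] by auto
    then show "\<tau> (case x of (l, w, i) \<Rightarrow> (?f l, w, i))
        = (case x of (k, w, i) \<Rightarrow> if k = l then (k, w, inv' (\<pi> w) i) else (k, w, i))"
      by (auto simp: \<tau>_def points_def)
  qed
  finally show "dcomp x y = relabel l (\<lambda>w. inv' (\<pi> w)) d" .
qed

lemma dcomp_perm_right:
  assumes d: "d \<in> diagrams p r" and g: "g \<in> carrier (Sym r)"
  shows "dcomp d (perm_diagram r g) = relabel Bot (\<lambda>w. inv' (sel w g)) d"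
    and "loops d (perm_diagram r g) = 0"
proof -
  have perm: "sel w g permutes {1..sel w r}" for w using g unfolding Sym_carrier_iff by blast
  have l: "Bot = Bot \<and> r = r \<and> Top = Top \<and> p = p \<or> Bot = Top \<and> r = p \<and> Top = Bot \<and> p = r" by simp
  note * = stack_perm[OF d l perm]
  show "dcomp d (perm_diagram r g) = relabel Bot (\<lambda>w. inv' (sel w g)) d" "loops d (perm_diagram r g) = 0"
    by (rule *; simp add: relevel_perm_diagram)+
qed

lemma dcomp_perm_left:
  assumes d: "d \<in> diagrams p r" and g: "g \<in> carrier (Sym p)"
  shows "dcomp (perm_diagram p g) d = relabel Top (\<lambda>w. sel w g) d"
    and "loops (perm_diagram p g) d = 0"
proof -
  let ?S = "SIGMA w : UNIV. {1..sel w p}"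
  have perm: "sel w g permutes {1..sel w p}" for w using g unfolding Sym_carrier_iff by blast
  have l: "Top = Bot \<and> p = r \<and> Bot = Top \<and> r = p \<or> Top = Top \<and> p = p \<and> Bot = Bot \<and> r = r" by simp
  \<comment> \<open>Substituting \<open>sel w g i\<close> for \<open>i\<close> indexes the strands
    by their middle ends instead of their top ends; this exhibits the permutation diagram in the
    form required by \<open>stack_perm\<close>, with the inverse permutation as
    \<open>\<pi>\<close>.\<close>
  have "(\<lambda>(w, i). {(Mid, w, inv' (sel w g) i), (Top, w, i)}) ` ?S =
      (\<lambda>(w, i). {(Mid, w, inv' (sel w g) i), (Top, w, i)}) ` (\<lambda>(w, i). (w, sel w g i)) ` ?S"
    unfolding Sym_permutes_slots[OF g] ..
  also have "\<dots> = (\<lambda>(w, i). {(Top, w, sel w g i), (Mid, w, i)}) ` ?S"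
    unfolding image_image using permutes_inverses(2)[OF perm] by (intro image_cong refl) auto
  finally have E: "relevel (\<lambda>l. if l = Bot then Mid else l) (perm_diagram p g) \<union>
        relevel (\<lambda>l. if l = Top then Mid else l) d =
      relevel (\<lambda>l. if l = Top then Mid else l) d \<union>
      (\<lambda>(w, i). {(Mid, w, inv' (sel w g) i), (Top, w, i)}) ` ?S"
    unfolding relevel_perm_diagram by (simp add: Un_commute)
  have "inv' (inv' (sel w g)) = sel w g" for w by (rule inv_inv_eq[OF permutes_bij[OF perm]])
  then show "dcomp (perm_diagram p g) d = relabel Top (\<lambda>w. sel w g) d" "loops (perm_diagram p g) d = 0"
    using stack_perm[OF d l permutes_inv[OF perm] E] by simp_all
qed

subsection \<open>Diagrams as pairs of a frame and a bijection\<close>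

text \<open>There are no arcs on the top edge, since all top points propagate. The arcs on the
  bottom edge cross the wall, so listing them by their left ends gives the graph of
  \<open>h\<close>.\<close>

definition mk_diagram :: "nat \<times> nat \<Rightarrow> nat \<times> nat \<Rightarrow> (nat \<Rightarrow> nat) \<times> (nat \<Rightarrow> nat) \<Rightarrow> (nat \<Rightarrow> nat) \<Rightarrow> diagram" where
  "mk_diagram p r \<beta> h = {{(Top, w, i), (Bot, w, sel w \<beta> i)} | w i. i \<in> {1..sel w p}} \<union>
     {{(Bot, Lft, x), (Bot, Rgt, h x)} | x. x \<in> {1..fst r} - fst \<beta> ` {1..fst p}}"

definition frame_image :: "nat \<times> nat \<Rightarrow> (nat \<Rightarrow> 'u) \<times> (nat \<Rightarrow> 'u) \<Rightarrow> 'u set \<times> 'u set" where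
  "frame_image p \<beta> = (fst \<beta> ` {1..fst p}, snd \<beta> ` {1..snd p})"

text \<open>The set \<open>A\<close> of bottom points that propagate is not stored: it is the image
  of \<open>\<beta>\<close>. Extensionality in both components makes the code of a diagram
  unique.\<close>

definition codes :: "nat \<times> nat \<Rightarrow> nat \<times> nat \<Rightarrow> (((nat \<Rightarrow> nat) \<times> (nat \<Rightarrow> nat)) \<times> (nat \<Rightarrow> nat)) set" where
  "codes p r = {(\<beta>, h). frame_image p \<beta> \<in> parts (std r) \<and> \<beta> \<in> frames p (frame_image p \<beta>) \<and>
     h \<in> sobj bij_species (diff2 (std r) (frame_image p \<beta>))}"

lemma frames_iff: "\<beta> \<in> frames p A \<longleftrightarrow>
    (\<forall>w. sel w \<beta> \<in> extensional {1..sel w p} \<and> bij_betw (sel w \<beta>) {1..sel w p} (sel w A))"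
  by (auto simp: frames_def all_side mem_Times_iff)

lemma frame_image_eq: "\<beta> \<in> frames p A \<Longrightarrow> frame_image p \<beta> = A"
  by (auto simp: frames_def frame_image_def bij_betw_def prod_eq_iff)

lemma sel_frame_image: "sel w (frame_image p \<beta>) = sel w \<beta> ` {1..sel w p}"
  by (cases w) (simp_all add: frame_image_def)

lemma codesI:
  assumes "A \<in> parts (std r)" "\<beta> \<in> frames p A" "h \<in> sobj bij_species (diff2 (std r) A)"
  shows "(\<beta>, h) \<in> codes p r"
  using assms frame_image_eq[OF assms(2)] by (simp add: codes_def)

lemma codes_iff: "(\<beta>, h) \<in> codes p r \<longleftrightarrow>
    (\<forall>w. sel w \<beta> \<in> extensional {1..sel w p} \<and> inj_on (sel w \<beta>) {1..sel w p} \<and>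
       sel w \<beta> ` {1..sel w p} \<subseteq> {1..sel w r}) \<and>
    h \<in> extensional ({1..fst r} - fst \<beta> ` {1..fst p}) \<and>
    bij_betw h ({1..fst r} - fst \<beta> ` {1..fst p}) ({1..snd r} - snd \<beta> ` {1..snd p})"
  by (auto simp: codes_def frames_iff sel_frame_image bij_betw_def all_side parts_def frame_image_def
      bij_species_def diff2_def)

text \<open>Reads \<open>\<beta>\<close> off the diagram, as the next lemma does for
  \<open>h\<close>. The levels tell the two kinds of strands apart.\<close>

lemma mk_diagram_top: "{(Top, w, i), (Bot, w', j)} \<in> mk_diagram p r \<beta> h \<longleftrightarrow>
    w' = w \<and> i \<in> {1..sel w p} \<and> j = sel w \<beta> i"
  by (auto simp: mk_diagram_def doubleton_eq_iff)

lemma mk_diagram_bot: "{(Bot, Lft, x), (Bot, Rgt, y)} \<in> mk_diagram p r \<beta> h \<longleftrightarrow>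
    x \<in> {1..fst r} - fst \<beta> ` {1..fst p} \<and> y = h x"
  by (auto simp: mk_diagram_def doubleton_eq_iff)

lemma mk_diagramE:
  assumes "e \<in> mk_diagram p r \<beta> h"
  obtains w i where "e = {(Top, w, i), (Bot, w, sel w \<beta> i)}" "i \<in> {1..sel w p}"
  | x where "e = {(Bot, Lft, x), (Bot, Rgt, h x)}" "x \<in> {1..fst r} - fst \<beta> ` {1..fst p}"
  using assms unfolding mk_diagram_def by blast

lemma Union_mk_diagram:
  assumes "(\<beta>, h) \<in> codes p r"
  shows "\<Union>(mk_diagram p r \<beta> h) = points p r"
proof
  note c = assms[unfolded codes_iff]
  have sub: "sel w \<beta> i \<in> {1..sel w r}" if "i \<in> {1..sel w p}" for w i using c that by blast
  have h: "h ` ({1..fst r} - fst \<beta> ` {1..fst p}) = {1..snd r} - snd \<beta> ` {1..snd p}"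
    using c by (simp add: bij_betw_def)
  show "\<Union>(mk_diagram p r \<beta> h) \<subseteq> points p r"
  proof
    fix x assume "x \<in> \<Union>(mk_diagram p r \<beta> h)"
    then obtain e where e: "e \<in> mk_diagram p r \<beta> h" "x \<in> e" by blast
    from e(1) show "x \<in> points p r"
    proof (cases rule: mk_diagramE)
      case (1 w i)
      then show ?thesis using e(2) sub[of i w] by (auto simp: points_slots slots_iff)
    next
      case (2 y)
      then have "h y \<in> {1..snd r}" using h by blast
      then show ?thesis using e(2) 2 by (auto simp: points_slots slots_iff)
    qed
  qed
  show "points p r \<subseteq> \<Union>(mk_diagram p r \<beta> h)"
  proof
    fix x assume "x \<in> points p r"
    then consider w i where "x = (Top, w, i)" "i \<in> {1..sel w p}"
      | w j where "x = (Bot, w, j)" "j \<in> {1..sel w r}"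
      by (auto simp: points_slots elim!: slotsE)
    then show "x \<in> \<Union>(mk_diagram p r \<beta> h)"
    proof cases
      case (1 w i)
      have "{(Top, w, i), (Bot, w, sel w \<beta> i)} \<in> mk_diagram p r \<beta> h" using 1 mk_diagram_top by blast
      then show ?thesis using 1 by blast
    next
      case (2 w j)
      show ?thesis
      proof (cases "j \<in> sel w \<beta> ` {1..sel w p}")
        case True
        then obtain i where "i \<in> {1..sel w p}" "j = sel w \<beta> i" by blast
        then have "{(Top, w, i), (Bot, w, j)} \<in> mk_diagram p r \<beta> h" using mk_diagram_top by blast
        then show ?thesis using 2 by blast
      next
        case False
        have "\<exists>x y. {(Bot, Lft, x), (Bot, Rgt, y)} \<in> mk_diagram p r \<beta> h \<and>
            ((w = Lft \<and> j = x) \<or> (w = Rgt \<and> j = y))"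
        proof (cases w)
          case Lft
          then show ?thesis using 2 False mk_diagram_bot by (intro exI[of _ j] exI[of _ "h j"]) auto
        next
          case Rgt
          then have "j \<in> h ` ({1..fst r} - fst \<beta> ` {1..fst p})" unfolding h using 2 False by simp
          then obtain x where "x \<in> {1..fst r} - fst \<beta> ` {1..fst p}" "j = h x" by blast
          then show ?thesis using Rgt mk_diagram_bot by blast
        qed
        then show ?thesis using 2 by blast
      qed
    qed
  qed
qed

lemma mk_diagram_disjoint:
  assumes "(\<beta>, h) \<in> codes p r"
  shows "disjoint (mk_diagram p r \<beta> h)"
proof (rule disjointI)
  note c = assms[unfolded codes_iff]
  have inj: "i = j" if "i \<in> {1..sel w p}" "j \<in> {1..sel w p}" "sel w \<beta> i = sel w \<beta> j" for w i j
    using c that by (blast dest: inj_onD)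
  let ?X = "{1..fst r} - fst \<beta> ` {1..fst p}"
  have hinj: "x = y" if "x \<in> ?X" "y \<in> ?X" "h x = h y" for x y
    using c that by (blast dest: inj_onD bij_betw_imp_inj_on)
  have h: "h x \<notin> sel Rgt \<beta> ` {1..sel Rgt p}" if "x \<in> ?X" for x
  proof -
    have "bij_betw h ?X ({1..snd r} - snd \<beta> ` {1..snd p})" using c by blast
    from bij_betwE[OF this] that have "h x \<in> {1..snd r} - snd \<beta> ` {1..snd p}" by blast
    then show ?thesis by simp
  qed
  have hl: "x \<notin> sel Lft \<beta> ` {1..sel Lft p}" if "x \<in> ?X" for x using that by simp
  fix e e' assume e: "e \<in> mk_diagram p r \<beta> h" "e' \<in> mk_diagram p r \<beta> h" and ne: "e \<noteq> e'"
  have "e = e'" if y: "y \<in> e" "y \<in> e'" for y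
    using e(1)
  proof (cases rule: mk_diagramE)
    case (1 w i)
    note A = 1
    from e(2) show ?thesis
    proof (cases rule: mk_diagramE)
      case (1 w' i')
      then have w: "w' = w" and "i' = i \<or> sel w \<beta> i' = sel w \<beta> i" using A(1) y by auto
      then have "i' = i" using inj[of i' w i] A(2) 1(2) by blast
      then show ?thesis using A(1) 1(1) w by simp
    next
      case (2 x)
      then have "(w = Lft \<and> x = sel w \<beta> i) \<or> (w = Rgt \<and> h x = sel w \<beta> i)" using A(1) y by auto
      then show ?thesis using A(2) h[OF 2(2)] hl[OF 2(2)] by blast
    qed
  next
    case (2 x)
    note A = 2
    from e(2) show ?thesis
    proof (cases rule: mk_diagramE)
      case (1 w i)
      then have "(w = Lft \<and> x = sel w \<beta> i) \<or> (w = Rgt \<and> h x = sel w \<beta> i)" using A(1) y by auto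
      then show ?thesis using 1(2) h[OF A(2)] hl[OF A(2)] by blast
    next
      case (2 x')
      then have "x = x' \<or> h x = h x'" using A(1) y by auto
      then have "x = x'" using hinj[OF A(2) 2(2)] by blast
      then show ?thesis using A(1) 2(1) by simp
    qed
  qed
  then show "e \<inter> e' = {}" using ne by blast
qed

lemma card_mk_diagram: "e \<in> mk_diagram p r \<beta> h \<Longrightarrow> card e = 2"
  by (erule mk_diagramE) simp_all

lemma mk_diagram_prop:
  assumes c: "(\<beta>, h) \<in> codes p r"
  shows "mk_diagram p r \<beta> h \<in> prop_diagrams p r p"
proof -
  have ne: "{} \<notin> mk_diagram p r \<beta> h" using card_mk_diagram[of "{}" p r \<beta> h] by auto
  have wall: "l \<noteq> l' \<longleftrightarrow> w = w'" if "{(l, w, i), (l', w', j)} \<in> mk_diagram p r \<beta> h" for l w i l' w' j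
    using that by (cases rule: mk_diagramE) (auto simp: doubleton_eq_iff)
  have diag: "mk_diagram p r \<beta> h \<in> diagrams p r"
    unfolding diagrams_def partition_on_def
    using ne wall card_mk_diagram Union_mk_diagram[OF c] mk_diagram_disjoint[OF c] by blast
  have "prop_number w (mk_diagram p r \<beta> h) = sel w p" for w
  proof -
    have "{e \<in> mk_diagram p r \<beta> h. \<exists>i j. e = {(Top, w, i), (Bot, w, j)}}
        = (\<lambda>i. {(Top, w, i), (Bot, w, sel w \<beta> i)}) ` {1..sel w p}"
    proof (intro equalityI subsetI)
      fix e assume "e \<in> {e \<in> mk_diagram p r \<beta> h. \<exists>i j. e = {(Top, w, i), (Bot, w, j)}}"
      then obtain i j where e: "e \<in> mk_diagram p r \<beta> h" "e = {(Top, w, i), (Bot, w, j)}" by auto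
      then have "i \<in> {1..sel w p}" "j = sel w \<beta> i" by (simp_all only: mk_diagram_top)
      then show "e \<in> (\<lambda>i. {(Top, w, i), (Bot, w, sel w \<beta> i)}) ` {1..sel w p}" using e(2) by simp
    next
      fix e assume "e \<in> (\<lambda>i. {(Top, w, i), (Bot, w, sel w \<beta> i)}) ` {1..sel w p}"
      then obtain i where i: "i \<in> {1..sel w p}" "e = {(Top, w, i), (Bot, w, sel w \<beta> i)}" by (rule imageE)
      then have "e \<in> mk_diagram p r \<beta> h" by (simp only: mk_diagram_top)
      then show "e \<in> {e \<in> mk_diagram p r \<beta> h. \<exists>i j. e = {(Top, w, i), (Bot, w, j)}}" using i(2) by blast
    qed
    moreover have "inj_on (\<lambda>i. {(Top, w, i), (Bot, w, sel w \<beta> i)}) {1..sel w p}"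
      by (auto simp: inj_on_def doubleton_eq_iff)
    ultimately show ?thesis by (simp add: prop_number_def card_image)
  qed
  then show ?thesis using diag by (simp add: prop_diagrams_def)
qed

lemma mk_diagram_inj:
  assumes "(\<beta>, h) \<in> codes p r" "(\<beta>', h') \<in> codes p r"
    and eq: "mk_diagram p r \<beta> h = mk_diagram p r \<beta>' h'"
  shows "\<beta> = \<beta>'" "h = h'"
proof -
  note c = assms(1)[unfolded codes_iff] and c' = assms(2)[unfolded codes_iff]
  have val: "sel w \<beta> i = sel w \<beta>' i" if "i \<in> {1..sel w p}" for w i
    using mk_diagram_top[of w i w "sel w \<beta> i" p r \<beta> h] mk_diagram_top[of w i w "sel w \<beta> i" p r \<beta>' h'] eq that
    by simp
  have sel: "sel w \<beta> = sel w \<beta>'" for w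
    by (rule extensionalityI[of _ "{1..sel w p}"]) (use c c' val in auto)
  show b: "\<beta> = \<beta>'" using sel[of Lft] sel[of Rgt] by (simp add: prod_eq_iff)
  let ?X = "{1..fst r} - fst \<beta> ` {1..fst p}"
  have "h x = h' x" if "x \<in> ?X" for x
    using mk_diagram_bot[of x "h x" p r \<beta> h] mk_diagram_bot[of x "h x" p r \<beta>' h'] eq that by simp
  then show "h = h'" using c c' b by (intro extensionalityI[of _ ?X]) auto
qed

text \<open>Counting forces the shape: on each side there are as many propagating strands as top
  points, so every top point propagates. A bottom point not reached from the top is then joined to
  one on the other side of the wall.\<close>

lemma mk_diagram_surj:
  assumes d: "d \<in> prop_diagrams p r p"
  obtains \<beta> h where "(\<beta>, h) \<in> codes p r" "d = mk_diagram p r \<beta> h"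
proof -
  have dd: "d \<in> diagrams p r" and pn: "\<And>w. prop_number w d = sel w p"
    using d by (auto simp: prop_diagrams_def)
  note strand = diagrams_strands[OF dd]
  have wall: "\<And>l w i l' w' j. {(l, w, i), (l', w', j)} \<in> d \<Longrightarrow> l \<noteq> l' \<longleftrightarrow> w = w'"
    using dd unfolding diagrams_def by blast
  have uniq: "e = e'" if "e \<in> d" "e' \<in> d" "x \<in> e" "x \<in> e'" for e e' x
    using strand(2) that by (auto simp: disjoint_def)
  have pt: "x \<in> points p r" if "e \<in> d" "x \<in> e" for e x using strand(3) that by blast
  have through: "\<exists>j. {(Top, w, i), (Bot, w, j)} \<in> d" if i: "i \<in> {1..sel w p}" for w i
  proof -
    let ?P = "{e \<in> d. \<exists>i j. e = {(Top, w, i), (Bot, w, j)}}"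
    let ?J = "{i. \<exists>j. {(Top, w, i), (Bot, w, j)} \<in> d}"
    have J: "?J \<subseteq> {1..sel w p}"
      using pt by (fastforce simp: points_slots slots_iff)
    define f where "f i = (SOME j. {(Top, w, i), (Bot, w, j)} \<in> d)" for i
    have f: "{(Top, w, i), (Bot, w, f i)} \<in> d" if "i \<in> ?J" for i
      using that unfolding f_def by (intro someI_ex[where P = "\<lambda>j. {(Top, w, i), (Bot, w, j)} \<in> d"]) simp
    \<comment> \<open>A propagating strand is determined by its top end, which bounds the
      propagating number by the number of top points in use.\<close>
    have "?P \<subseteq> (\<lambda>i. {(Top, w, i), (Bot, w, f i)}) ` ?J"
    proof
      fix e assume "e \<in> ?P"
      then obtain i j where e: "e \<in> d" "e = {(Top, w, i), (Bot, w, j)}" by auto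
      then have i: "i \<in> ?J" by auto
      have "e = {(Top, w, i), (Bot, w, f i)}"
        by (rule uniq[OF e(1) f[OF i], of "(Top, w, i)"]) (simp_all add: e(2))
      then show "e \<in> (\<lambda>i. {(Top, w, i), (Bot, w, f i)}) ` ?J" using i by (rule image_eqI)
    qed
    then have "card ?P \<le> card ?J"
      by (rule surj_card_le[rotated]) (rule finite_subset[OF J finite_atLeastAtMost])
    then have "sel w p \<le> card ?J" using pn[of w] by (simp add: prop_number_def)
    then have "?J = {1..sel w p}"
      using J card_mono[OF finite_atLeastAtMost J] by (intro card_subset_eq) simp_all
    then show ?thesis using i by (simp add: set_eq_iff)
  qed
  define b where "b w = (\<lambda>i\<in>{1..sel w p}. SOME j. {(Top, w, i), (Bot, w, j)} \<in> d)" for w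
  define \<beta> where "\<beta> = (b Lft, b Rgt)"
  have sb: "sel w \<beta> = b w" for w by (cases w) (simp_all add: \<beta>_def)
  have b: "{(Top, w, i), (Bot, w, b w i)} \<in> d" if "i \<in> {1..sel w p}" for w i
    using someI_ex[OF through[OF that]] that by (simp add: b_def)
  have binj: "inj_on (b w) {1..sel w p}" for w
  proof (rule inj_onI)
    fix i j assume ij: "i \<in> {1..sel w p}" "j \<in> {1..sel w p}" "b w i = b w j"
    have "{(Top, w, i), (Bot, w, b w i)} = {(Top, w, j), (Bot, w, b w j)}"
      using b[OF ij(1)] b[OF ij(2)] ij(3) by (intro uniq[of _ _ "(Bot, w, b w i)"]) auto
    then show "i = j" by (auto simp: doubleton_eq_iff)
  qed
  have bsub: "b w ` {1..sel w p} \<subseteq> {1..sel w r}" for w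
  proof (rule image_subsetI)
    fix i assume "i \<in> {1..sel w p}"
    then have "(Bot, w, b w i) \<in> points p r" by (intro pt[OF b[of i w]]) simp_all
    then show "b w i \<in> {1..sel w r}" by (simp add: points_slots slots_iff)
  qed
  have partner: "\<exists>y. y \<in> {1..sel w' r} - b w' ` {1..sel w' p} \<and> {(Bot, w, x), (Bot, w', y)} \<in> d"
    if x: "x \<in> {1..sel w r} - b w ` {1..sel w p}" and w: "w' \<noteq> w" for w w' x
  proof -
    have "(Bot, w, x) \<in> points p r" using x by (simp add: points_slots slots_iff)
    then obtain e where e: "e \<in> d" "(Bot, w, x) \<in> e" using strand(3) by blast
    then obtain q where q: "e = {(Bot, w, x), q}" "q \<noteq> (Bot, w, x)"
      using strand(1)[OF e(1)] by (auto simp: card_2_iff)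
    obtain l v y where lvy: "q = (l, v, y)" by (cases q)
    have qp: "q \<in> points p r" using pt[OF e(1)] q by blast
    \<comment> \<open>Otherwise the strand is the propagating strand of its top end, and
      \<open>x\<close> lies in the image of \<open>b w\<close>.\<close>
    have "l \<noteq> Top"
    proof
      assume l: "l = Top"
      have v: "v = w" using wall[of Bot w x Top v y] e(1) q(1) lvy l by auto
      have y: "y \<in> {1..sel w p}" using qp lvy l v by (auto simp: points_slots slots_iff)
      have "e = {(Top, w, y), (Bot, w, b w y)}"
        using b[OF y] e(1) q(1) lvy l v by (intro uniq[of _ _ "(Top, w, y)"]) auto
      then have "x = b w y" using q(1) lvy l by (auto simp: doubleton_eq_iff)
      then show False using x y by blast
    qed
    then have l: "l = Bot" using qp lvy by (auto simp: points_slots slots_iff)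
    have "v \<noteq> w" using wall[of Bot w x Bot v y] e(1) q(1) lvy l by auto
    then have v: "v = w'" using w by (cases v; cases w; cases w') auto
    have y: "y \<in> {1..sel w' r}" using qp lvy l v by (auto simp: points_slots slots_iff)
    have "y \<notin> b w' ` {1..sel w' p}"
    proof
      assume "y \<in> b w' ` {1..sel w' p}"
      then obtain i where i: "i \<in> {1..sel w' p}" "y = b w' i" by blast
      have "e = {(Top, w', i), (Bot, w', b w' i)}"
        using b[OF i(1)] e(1) q(1) lvy l v i(2) by (intro uniq[of _ _ "(Bot, w', y)"]) auto
      then show False using q(1) w lvy l by (auto simp: doubleton_eq_iff)
    qed
    then show ?thesis using y e(1) q(1) lvy l v by blast
  qed
  let ?X = "{1..fst r} - b Lft ` {1..fst p}" and ?Y = "{1..snd r} - b Rgt ` {1..snd p}"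
  define h where "h = (\<lambda>x\<in>?X. SOME y. y \<in> ?Y \<and> {(Bot, Lft, x), (Bot, Rgt, y)} \<in> d)"
  have h: "h x \<in> ?Y" "{(Bot, Lft, x), (Bot, Rgt, h x)} \<in> d" if "x \<in> ?X" for x
  proof -
    have "\<exists>y. y \<in> ?Y \<and> {(Bot, Lft, x), (Bot, Rgt, y)} \<in> d"
      using partner[of x Lft Rgt] that by simp
    from someI_ex[OF this] that show "h x \<in> ?Y" "{(Bot, Lft, x), (Bot, Rgt, h x)} \<in> d"
      by (simp_all add: h_def)
  qed
  have "bij_betw h ?X ?Y"
  proof (rule bij_betw_imageI)
    show "inj_on h ?X"
    proof (rule inj_onI)
      fix x y assume xy: "x \<in> ?X" "y \<in> ?X" "h x = h y"
      have "{(Bot, Lft, x), (Bot, Rgt, h x)} = {(Bot, Lft, y), (Bot, Rgt, h y)}"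
        using h(2)[OF xy(1)] h(2)[OF xy(2)] xy(3) by (intro uniq[of _ _ "(Bot, Rgt, h x)"]) auto
      then show "x = y" by (auto simp: doubleton_eq_iff)
    qed
    show "h ` ?X = ?Y"
    proof
      show "?Y \<subseteq> h ` ?X"
      proof
        fix y assume "y \<in> ?Y"
        then obtain x where x: "x \<in> ?X" "{(Bot, Rgt, y), (Bot, Lft, x)} \<in> d"
          using partner[of y Rgt Lft] by auto
        have "{(Bot, Lft, x), (Bot, Rgt, h x)} = {(Bot, Rgt, y), (Bot, Lft, x)}"
          using h(2)[OF x(1)] x(2) by (intro uniq[of _ _ "(Bot, Lft, x)"]) auto
        then have "y = h x" by (auto simp: doubleton_eq_iff)
        then show "y \<in> h ` ?X" using x(1) by blast
      qed
      show "h ` ?X \<subseteq> ?Y" using h(1) by (rule image_subsetI)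
    qed
  qed
  then have c: "(\<beta>, h) \<in> codes p r"
    using binj bsub unfolding codes_iff sb by (auto simp: \<beta>_def b_def h_def)
  have sub: "mk_diagram p r \<beta> h \<subseteq> d"
  proof
    fix e assume "e \<in> mk_diagram p r \<beta> h"
    then show "e \<in> d"
    proof (cases rule: mk_diagramE)
      case (1 w i)
      then show ?thesis using b[of i w] by (simp only: sb)
    next
      case (2 x)
      then show ?thesis using h(2)[of x] by (simp add: \<beta>_def)
    qed
  qed
  \<comment> \<open>The strands of \<open>mk_diagram p r \<beta> h\<close> already cover all points,
    so each strand of \<open>d\<close> meets one of them and, strands being disjoint, equals
    it.\<close>
  have "d \<subseteq> mk_diagram p r \<beta> h"
  proof
    fix e assume e: "e \<in> d"
    then obtain x where x: "x \<in> e" using strand(1)[OF e] by (metis card.empty ex_in_conv zero_neq_numeral)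
    then have "x \<in> \<Union>(mk_diagram p r \<beta> h)" unfolding Union_mk_diagram[OF c] using pt[OF e] by blast
    then obtain e' where "e' \<in> mk_diagram p r \<beta> h" "x \<in> e'" by blast
    then show "e \<in> mk_diagram p r \<beta> h" using uniq[OF e _ x] sub by blast
  qed
  then show thesis using that[OF c] sub by blast
qed

lemma bij_mk_diagram:
  "bij_betw (\<lambda>(\<beta>, h). mk_diagram p r \<beta> h) (codes p r) (prop_diagrams p r p)"
proof (rule bij_betw_imageI)
  show "inj_on (\<lambda>(\<beta>, h). mk_diagram p r \<beta> h) (codes p r)"
  proof (rule inj_onI, clarsimp)
    fix a b h a' b' h'
    assume "((a, b), h) \<in> codes p r" "((a', b'), h') \<in> codes p r"
      "mk_diagram p r (a, b) h = mk_diagram p r (a', b') h'"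
    from mk_diagram_inj[OF this] show "a = a' \<and> b = b' \<and> h = h'" by simp
  qed
  show "(\<lambda>(\<beta>, h). mk_diagram p r \<beta> h) ` codes p r = prop_diagrams p r p"
  proof
    show "(\<lambda>(\<beta>, h). mk_diagram p r \<beta> h) ` codes p r \<subseteq> prop_diagrams p r p"
      by (rule image_subsetI) (use mk_diagram_prop in \<open>simp add: case_prod_beta\<close>)
    show "prop_diagrams p r p \<subseteq> (\<lambda>(\<beta>, h). mk_diagram p r \<beta> h) ` codes p r"
    proof
      fix d assume "d \<in> prop_diagrams p r p"
      then obtain \<beta> h where "(\<beta>, h) \<in> codes p r" "d = mk_diagram p r \<beta> h" by (rule mk_diagram_surj)
      then show "d \<in> (\<lambda>(\<beta>, h). mk_diagram p r \<beta> h) ` codes p r"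
        by (intro image_eqI[of _ _ "(\<beta>, h)"]) simp_all
    qed
  qed
qed

definition decode :: "nat \<times> nat \<Rightarrow> nat \<times> nat \<Rightarrow> diagram \<Rightarrow> ((nat \<Rightarrow> nat) \<times> (nat \<Rightarrow> nat)) \<times> (nat \<Rightarrow> nat)" where
  "decode p r = inv_into (codes p r) (\<lambda>(\<beta>, h). mk_diagram p r \<beta> h)"

lemma decode_mk_diagram:
  assumes "(\<beta>, h) \<in> codes p r"
  shows "decode p r (mk_diagram p r \<beta> h) = (\<beta>, h)"
  unfolding decode_def
  using inv_into_f_f[OF bij_betw_imp_inj_on[OF bij_mk_diagram] assms] by simp

lemma prop_diagrams_sub: "prop_diagrams r s p \<subseteq> diagrams r s"
  by (auto simp: prop_diagrams_def)

lemma finite_diagrams: "finite (diagrams r s)"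
proof -
  have U: "(UNIV :: side set) = {Lft, Rgt}" using side.exhaust by auto
  have "finite (UNIV :: side set)" unfolding U by simp
  then have "finite (points r s)"
    unfolding points_slots slots_def by (intro finite_UnI finite_imageI finite_SigmaI) simp_all
  moreover have "diagrams r s \<subseteq> Pow (Pow (points r s))"
    by (auto simp: diagrams_def partition_on_def)
  ultimately show ?thesis by (simp only: finite_subset finite_Pow_iff)
qed

lemma finite_prop_diagrams: "finite (prop_diagrams r s p)"
  by (rule finite_subset[OF prop_diagrams_sub finite_diagrams])

subsection \<open>The actions of the symmetric groups on codes\<close>

lemma mk_diagram_image:
  "mk_diagram p r \<beta> h =
     (\<lambda>(w, i). {(Top, w, i), (Bot, w, sel w \<beta> i)}) ` (SIGMA w : UNIV. {1..sel w p}) \<union>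
     (\<lambda>x. {(Bot, Lft, x), (Bot, Rgt, h x)}) ` ({1..fst r} - fst \<beta> ` {1..fst p})"
proof -
  have "{{(Top, w, i), (Bot, w, sel w \<beta> i)} | w i. i \<in> {1..sel w p}} =
     (\<lambda>(w, i). {(Top, w, i), (Bot, w, sel w \<beta> i)}) ` (SIGMA w : UNIV. {1..sel w p})"
    (is "?A = ?B")
  proof (intro equalityI subsetI)
    fix e assume "e \<in> ?B"
    then obtain w i where "i \<in> {1..sel w p}" "e = {(Top, w, i), (Bot, w, sel w \<beta> i)}" by auto
    then show "e \<in> ?A" by blast
  qed auto
  then show ?thesis unfolding mk_diagram_def by (simp only: setcompr_eq_image Collect_mem_eq)
qed

section \<open>Frames as a torsor, and transport of codes\<close>

definition frame_push ::
    "nat \<times> nat \<Rightarrow> ('u \<Rightarrow> 'u) \<times> ('u \<Rightarrow> 'u) \<Rightarrow> (nat \<Rightarrow> 'u) \<times> (nat \<Rightarrow> 'u) \<Rightarrow> (nat \<Rightarrow> 'u) \<times> (nat \<Rightarrow> 'u)" where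
  "frame_push p \<sigma> \<beta> = (\<lambda>i\<in>{1..fst p}. fst \<sigma> (fst \<beta> i), \<lambda>i\<in>{1..snd p}. snd \<sigma> (snd \<beta> i))"

lemma sel_frame_push: "sel w (frame_push p \<sigma> \<beta>) = (\<lambda>i\<in>{1..sel w p}. sel w \<sigma> (sel w \<beta> i))"
  by (cases w) (simp_all add: frame_push_def)

lemma sel_frame_right: "sel w (frame_right p \<beta> g) = (\<lambda>i\<in>{1..sel w p}. sel w \<beta> (sel w g i))"
  by (cases w) (simp_all add: frame_right_def)

lemma frame_push_frames:
  assumes "\<beta> \<in> frames p A" "inj2 A \<sigma>"
  shows "frame_push p \<sigma> \<beta> \<in> frames p (im2 \<sigma> A)"
proof -
  have "bij_betw (\<lambda>i\<in>{1..n}. f (b i)) {1..n} (f ` B)"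
    if "inj_on f B" "bij_betw b {1..n} B" for f :: "'a \<Rightarrow> 'a" and B b and n :: nat
    using bij_betw_trans[OF that(2) inj_on_imp_bij_betw[OF that(1)]]
    by (simp add: bij_betw_restrict_eq comp_def)
  then show ?thesis
    using assms by (auto simp: frames_def frame_push_def im2_def inj2_def)
qed

lemma frame_pull_push:
  assumes "\<beta> \<in> frames p A" "inj2 A \<sigma>"
  shows "frame_pull p A \<sigma> (frame_push p \<sigma> \<beta>) = \<beta>"
proof -
  have *: "(\<lambda>i\<in>{1..n}. inv_into B f ((\<lambda>i\<in>{1..n}. f (b i)) i)) = b"
    if "inj_on f B" "bij_betw b {1..n} B" "b \<in> extensional {1..n}" for f :: "'a \<Rightarrow> 'a" and B b and n :: nat
    using that bij_betwE[OF that(2)] by (intro extensionalityI[of _ "{1..n}"]) auto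
  show ?thesis
    using assms *[of "fst \<sigma>" "fst A" "fst \<beta>" "fst p"] *[of "snd \<sigma>" "snd A" "snd \<beta>" "snd p"]
    by (auto simp: frame_pull_def frame_push_def frames_def inj2_def mem_Times_iff)
qed

text \<open>Transitivity of the right action: on the index range the only candidate is
  \<open>\<beta>'\<close> followed by the inverse of \<open>\<beta>\<close>.\<close>

lemma frame_torsor:
  assumes "\<beta> \<in> frames p A" "\<beta>' \<in> frames p A"
  obtains g where "g \<in> carrier (Sym p)" "\<beta>' = frame_right p \<beta> g"
proof -
  \<comment> \<open>Permutations are functions on all natural numbers, hence the identity outside
    the index range.\<close>
  define g where "g w i = (if i \<in> {1..sel w p} then inv_into {1..sel w p} (sel w \<beta>) (sel w \<beta>' i) else i)"
    for w i
  have b: "bij_betw (sel w \<beta>) {1..sel w p} (sel w A)" "bij_betw (sel w \<beta>') {1..sel w p} (sel w A)"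
    "sel w \<beta>' \<in> extensional {1..sel w p}" for w
    using assms unfolding frames_iff by blast+
  have perm: "g w permutes {1..sel w p}" for w
  proof (rule bij_imp_permutes)
    have "bij_betw (inv_into {1..sel w p} (sel w \<beta>) \<circ> sel w \<beta>') {1..sel w p} {1..sel w p}"
      by (rule bij_betw_trans[OF b(2) bij_betw_inv_into[OF b(1)]])
    then show "bij_betw (g w) {1..sel w p} {1..sel w p}"
      by (rule bij_betw_cong[THEN iffD1, rotated]) (simp add: g_def)
  qed (auto simp: g_def)
  have val: "sel w \<beta> (g w i) = sel w \<beta>' i" if "i \<in> {1..sel w p}" for w i
    using that bij_betwE[OF b(2)] b(1) by (auto simp: g_def bij_betw_def f_inv_into_f)
  have sel: "sel w (g Lft, g Rgt) = g w" for w by (cases w) simp_all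
  show thesis
  proof (rule that)
    show "(g Lft, g Rgt) \<in> carrier (Sym p)" unfolding Sym_carrier_iff sel using perm by blast
    have "sel w (frame_right p \<beta> (g Lft, g Rgt)) = sel w \<beta>'" for w
      unfolding sel_frame_right sel using val b(3)
      by (intro extensionalityI[of _ "{1..sel w p}"]) auto
    from this[of Lft] this[of Rgt] show "\<beta>' = frame_right p \<beta> (g Lft, g Rgt)"
      by (simp add: prod_eq_iff)
  qed
qed

text \<open>Freeness of the right action, from injectivity of the frame. Together with transitivity
  it makes the frames of \<open>A\<close> a torsor.\<close>

lemma frame_right_cancel:
  assumes "\<beta> \<in> frames p A" "g \<in> carrier (Sym p)" "h \<in> carrier (Sym p)"
    and eq: "frame_right p \<beta> g = frame_right p \<beta> h"
  shows "g = h"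
proof -
  have perm: "sel w g permutes {1..sel w p}" "sel w h permutes {1..sel w p}" for w
    using assms(2,3) unfolding Sym_carrier_iff by blast+
  have inj: "inj_on (sel w \<beta>) {1..sel w p}" for w
    using assms(1) unfolding frames_iff bij_betw_def by blast
  have "sel w g i = sel w h i" for w i
  proof (cases "i \<in> {1..sel w p}")
    case True
    then have "sel w \<beta> (sel w g i) = sel w \<beta> (sel w h i)"
      using fun_cong[OF arg_cong[OF eq, of "sel w"], of i] by (simp add: sel_frame_right)
    then show ?thesis
      using inj_onD[OF inj] permutes_in_image[OF perm(1)] permutes_in_image[OF perm(2)] True by blast
  next
    case False
    then show ?thesis using permutes_not_in[OF perm(1)] permutes_not_in[OF perm(2)] by simp
  qed
  then have "sel w g = sel w h" for w by blast
  from this[of Lft] this[of Rgt] show ?thesis by (simp add: prod_eq_iff)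
qed

lemma codes_right:
  assumes "(\<beta>, h) \<in> codes p r" "g \<in> carrier (Sym p)"
  shows "(frame_right p \<beta> g, h) \<in> codes p r"
    "frame_image p (frame_right p \<beta> g) = frame_image p \<beta>"
proof -
  have f: "frame_right p \<beta> g \<in> frames p (frame_image p \<beta>)"
    using assms by (intro frame_right_frames) (auto simp: codes_def)
  then show "frame_image p (frame_right p \<beta> g) = frame_image p \<beta>" by (rule frame_image_eq)
  show "(frame_right p \<beta> g, h) \<in> codes p r"
    using assms(1) by (intro codesI[OF _ f]) (auto simp: codes_def)
qed

lemma im2_Sym:
  assumes "g \<in> carrier (Sym r)"
  shows "im2 g (std r) = std r" "inj2 U g"
proof -
  have "sel w g permutes {1..sel w r}" for w using assms unfolding Sym_carrier_iff by blast
  from this[of Lft] this[of Rgt] show "im2 g (std r) = std r" "inj2 U g"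
    by (auto simp: im2_def inj2_def permutes_image dest: permutes_inj intro: inj_on_subset)
qed

lemma diff2_im2:
  assumes "inj2 U \<sigma>" "A \<in> parts U"
  shows "diff2 (im2 \<sigma> U) (im2 \<sigma> A) = im2 \<sigma> (diff2 U A)"
proof -
  have "fst A \<subseteq> fst U" "snd A \<subseteq> snd U" using assms(2) by (auto simp: parts_def)
  then show ?thesis
    using assms(1) inj_on_image_set_diff[of "fst \<sigma>" "fst U" "fst U" "fst A"]
      inj_on_image_set_diff[of "snd \<sigma>" "snd U" "snd U" "snd A"]
    unfolding diff2_def im2_def inj2_def by simp
qed

lemma parts_im2: "A \<in> parts U \<Longrightarrow> im2 \<sigma> A \<in> parts (im2 \<sigma> U)"
  by (auto simp: parts_def im2_def)

lemma fin2_diff2: "fin2 U \<Longrightarrow> fin2 (diff2 U A)"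
  by (simp add: fin2_def diff2_def)

lemma codes_push:
  assumes c: "(\<beta>, h) \<in> codes p r" and g: "g \<in> carrier (Sym r)"
  shows "(frame_push p g \<beta>, smap bij_species (diff2 (std r) (frame_image p \<beta>)) g h) \<in> codes p r"
    "frame_image p (frame_push p g \<beta>) = im2 g (frame_image p \<beta>)"
proof -
  let ?A = "frame_image p \<beta>"
  have A: "?A \<in> parts (std r)" "\<beta> \<in> frames p ?A" "h \<in> sobj bij_species (diff2 (std r) ?A)"
    using c by (auto simp: codes_def)
  have f: "frame_push p g \<beta> \<in> frames p (im2 g ?A)" by (rule frame_push_frames[OF A(2) im2_Sym(2)[OF g]])
  then show "frame_image p (frame_push p g \<beta>) = im2 g ?A" by (rule frame_image_eq)
  have "smap bij_species (diff2 (std r) ?A) g h \<in> sobj bij_species (im2 g (diff2 (std r) ?A))"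
    by (rule funcset_mem[OF is_set_species.smap_closed[OF bij_species_is_set_species fin2_diff2 im2_Sym(2)[OF g]] A(3)])
      (simp add: fin2_def)
  then show "(frame_push p g \<beta>, smap bij_species (diff2 (std r) ?A) g h) \<in> codes p r"
    using parts_im2[OF A(1), of g] diff2_im2[OF im2_Sym(2)[OF g] A(1)]
    by (intro codesI[OF _ f]) (simp_all only: im2_Sym(1)[OF g])
qed

text \<open>Renumbering the top ends by \<open>g\<close> turns the strand from \<open>i\<close> to
  \<open>\<beta> i\<close> into one that starts at \<open>g i\<close>; so the strand at
  \<open>j\<close> now ends where the strand at g^-1 j ended. The bottom edge, hence
  \<open>h\<close>, is untouched.\<close>

lemma dcomp_perm_mk_diagram:
  assumes c: "(\<beta>, h) \<in> codes p r" and g: "g \<in> carrier (Sym p)"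
  shows "dcomp (perm_diagram p g) (mk_diagram p r \<beta> h) = mk_diagram p r (frame_right p \<beta> (inv\<^bsub>Sym p\<^esub> g)) h"
proof -
  let ?S = "SIGMA w : UNIV. {1..sel w p}" and ?b = "frame_right p \<beta> (inv\<^bsub>Sym p\<^esub> g)"
  have d: "mk_diagram p r \<beta> h \<in> diagrams p r" using mk_diagram_prop[OF c] prop_diagrams_sub by blast
  have perm: "sel w g permutes {1..sel w p}" for w using g unfolding Sym_carrier_iff by blast
  note S = Sym_permutes_slots[OF g]
  have val: "sel w ?b (sel w g i) = sel w \<beta> i" if "i \<in> {1..sel w p}" for w i
    using that permutes_in_image[OF perm] permutes_inverses(2)[OF perm]
    unfolding sel_frame_right sel_inv[OF g] by simp
  have img: "fst ?b ` {1..fst p} = fst \<beta> ` {1..fst p}"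
    using codes_right(2)[OF c group.inv_closed[OF group_Sym g]] by (simp add: frame_image_def)
  have "dcomp (perm_diagram p g) (mk_diagram p r \<beta> h) =
      (\<lambda>(w, i). {(Top, w, sel w g i), (Bot, w, sel w \<beta> i)}) ` ?S \<union>
      (\<lambda>x. {(Bot, Lft, x), (Bot, Rgt, h x)}) ` ({1..fst r} - fst \<beta> ` {1..fst p})"
    unfolding dcomp_perm_left(1)[OF d g]
    unfolding mk_diagram_image relabel_def image_Un image_image
    by (intro arg_cong2[where f = "(\<union>)"] image_cong refl) auto
  also have "(\<lambda>(w, i). {(Top, w, sel w g i), (Bot, w, sel w \<beta> i)}) ` ?S =
      (\<lambda>(w, i). {(Top, w, i), (Bot, w, sel w ?b i)}) ` (\<lambda>(w, i). (w, sel w g i)) ` ?S"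
    unfolding image_image using val by (intro image_cong refl) auto
  finally show ?thesis
    unfolding S mk_diagram_image[of p r ?b] img .
qed

text \<open>\<open>Sym r\<close> acts through the inverse permutation diagram, and stacking below
  renumbers by an inverse once more, so the bottom points move by \<open>g\<close>. Both parts of
  the code undergo transport of structure, \<open>h\<close> becoming g_2 h g_1^-1.\<close>

lemma dcomp_mk_diagram_perm:
  assumes c: "(\<beta>, h) \<in> codes p r" and g: "g \<in> carrier (Sym r)"
  shows "dcomp (mk_diagram p r \<beta> h) (perm_diagram r (inv\<^bsub>Sym r\<^esub> g)) =
    mk_diagram p r (frame_push p g \<beta>) (smap bij_species (diff2 (std r) (frame_image p \<beta>)) g h)"
proof -
  let ?S = "SIGMA w : UNIV. {1..sel w p}"
  let ?X = "{1..fst r} - fst \<beta> ` {1..fst p}"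
  let ?h = "smap bij_species (diff2 (std r) (frame_image p \<beta>)) g h"
  have d: "mk_diagram p r \<beta> h \<in> diagrams p r" using mk_diagram_prop[OF c] prop_diagrams_sub by blast
  have perm: "sel w g permutes {1..sel w r}" for w using g unfolding Sym_carrier_iff by blast
  have inv: "inv' (sel w (inv\<^bsub>Sym r\<^esub> g)) = sel w g" for w
    unfolding sel_inv[OF g] by (rule inv_inv_eq[OF permutes_bij[OF perm]])
  have inj: "inj (fst g)" using permutes_inj[OF perm[of Lft]] by simp
  have hv: "?h (fst g x) = snd g (h x)" if "x \<in> ?X" for x
    using that inj_on_subset[OF inj, of ?X] by (simp add: bij_species_def diff2_def frame_image_def)
  have X: "{1..fst r} - fst (frame_push p g \<beta>) ` {1..fst p} = fst g ` ?X"
  proof -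
    have "fst (frame_push p g \<beta>) ` {1..fst p} = fst g ` fst \<beta> ` {1..fst p}"
      unfolding frame_push_def fst_conv image_image by (intro image_cong) auto
    then show ?thesis using permutes_image[OF perm[of Lft]] by (simp add: image_set_diff[OF inj])
  qed
  have "dcomp (mk_diagram p r \<beta> h) (perm_diagram r (inv\<^bsub>Sym r\<^esub> g)) =
      (\<lambda>(w, i). {(Top, w, i), (Bot, w, sel w g (sel w \<beta> i))}) ` ?S \<union>
      (\<lambda>x. {(Bot, Lft, fst g x), (Bot, Rgt, snd g (h x))}) ` ?X"
    unfolding dcomp_perm_right(1)[OF d group.inv_closed[OF group_Sym g]]
    unfolding inv mk_diagram_image relabel_def image_Un image_image
    by (intro arg_cong2[where f = "(\<union>)"] image_cong refl) auto
  also have "(\<lambda>(w, i). {(Top, w, i), (Bot, w, sel w g (sel w \<beta> i))}) ` ?S =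
      (\<lambda>(w, i). {(Top, w, i), (Bot, w, sel w (frame_push p g \<beta>) i)}) ` ?S"
    by (intro image_cong refl) (auto simp: sel_frame_push)
  also have "(\<lambda>x. {(Bot, Lft, fst g x), (Bot, Rgt, snd g (h x))}) ` ?X =
      (\<lambda>x. {(Bot, Lft, x), (Bot, Rgt, ?h x)}) ` fst g ` ?X"
    unfolding image_image using hv by (intro image_cong refl) simp
  finally show ?thesis
    unfolding X[symmetric] mk_diagram_image[of p r "frame_push p g \<beta>"] .
qed

text \<open>The case \<open>r = p\<close>: no bottom points are left over, and the only extensional
  function on the empty set is constantly \<open>undefined\<close>.\<close>

lemma perm_diagram_code:
  assumes g: "g \<in> carrier (Sym p)"
  shows "perm_diagram p (inv\<^bsub>Sym p\<^esub> g) = mk_diagram p p (frame_right p (std_frame p) g) (\<lambda>x. undefined)"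
proof -
  let ?S = "SIGMA w : UNIV. {1..sel w p}" and ?b = "frame_right p (std_frame p) g"
  have perm: "sel w g permutes {1..sel w p}" for w using g unfolding Sym_carrier_iff by blast
  have sf: "sel w (std_frame p) = (\<lambda>i\<in>{1..sel w p}. i)" for w by (cases w) (simp_all add: std_frame_def)
  note S = Sym_permutes_slots[OF g]
  have b: "sel w ?b i = sel w g i" if "i \<in> {1..sel w p}" for w i
    using that permutes_in_image[OF perm] by (simp add: sel_frame_right sf)
  have "perm_diagram p (inv\<^bsub>Sym p\<^esub> g)
      = (\<lambda>(w, i). {(Top, w, inv' (sel w g) i), (Bot, w, i)}) ` (\<lambda>(w, i). (w, sel w g i)) ` ?S"
    unfolding perm_diagram_image sel_inv[OF g] S ..
  also have "\<dots> = (\<lambda>(w, i). {(Top, w, i), (Bot, w, sel w ?b i)}) ` ?S"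
    unfolding image_image using b permutes_inverses(2)[OF perm] by (intro image_cong refl) auto
  finally have eq: "perm_diagram p (inv\<^bsub>Sym p\<^esub> g)
      = (\<lambda>(w, i). {(Top, w, i), (Bot, w, sel w ?b i)}) ` ?S" .
  have X: "{1..fst p} - fst ?b ` {1..fst p} = {}"
    using b[of _ Lft] permutes_image[OF perm[of Lft]] by (auto simp: image_iff)
  show ?thesis unfolding mk_diagram_image[of p p ?b] X eq by simp
qed

text \<open>A code with \<open>r = p\<close> is a frame of \<open>std p\<close>, since an injection
  of a finite set into itself is onto. So the permutation diagrams index a basis of the algebra over
  which the tensor product is taken, and finiteness of the group follows from that of the set of
  diagrams.\<close>

lemma bij_perm_diagram: "bij_betw (perm_diagram p) (carrier (Sym p)) (prop_diagrams p p p)"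
proof (rule bij_betw_imageI)
  interpret G: group "Sym p" by (rule group_Sym)
  let ?u = "\<lambda>x :: nat. undefined :: nat"
  have code: "(frame_right p (std_frame p) g, ?u) \<in> codes p p" if "g \<in> carrier (Sym p)" for g
  proof (rule codesI)
    show "frame_right p (std_frame p) g \<in> frames p (std p)"
      by (rule frame_right_frames[OF std_frame_frames that])
    show "std p \<in> parts (std p)" by (simp add: parts_def)
    show "?u \<in> sobj bij_species (diff2 (std p) (std p))"
      by (simp add: bij_species_def diff2_def bij_betw_def)
  qed
  have eq: "perm_diagram p g = mk_diagram p p (frame_right p (std_frame p) (inv\<^bsub>Sym p\<^esub> g)) ?u"
    if "g \<in> carrier (Sym p)" for g
    using perm_diagram_code[OF G.inv_closed[OF that]] by (simp only: G.inv_inv[OF that])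
  show "inj_on (perm_diagram p) (carrier (Sym p))"
  proof (rule inj_onI)
    fix g h assume g: "g \<in> carrier (Sym p)" and h: "h \<in> carrier (Sym p)"
      and "perm_diagram p g = perm_diagram p h"
    then have "frame_right p (std_frame p) (inv\<^bsub>Sym p\<^esub> g) = frame_right p (std_frame p) (inv\<^bsub>Sym p\<^esub> h)"
      by (intro mk_diagram_inj(1)[OF code[OF G.inv_closed[OF g]] code[OF G.inv_closed[OF h]]])
        (simp only: eq)
    then have "inv\<^bsub>Sym p\<^esub> g = inv\<^bsub>Sym p\<^esub> h"
      by (rule frame_right_inj[OF G.inv_closed[OF g] G.inv_closed[OF h]])
    then show "g = h" by (rule inj_onD[OF G.inv_inj _ g h])
  qed
  show "perm_diagram p ` carrier (Sym p) = prop_diagrams p p p"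
  proof
    show "perm_diagram p ` carrier (Sym p) \<subseteq> prop_diagrams p p p"
      by (rule image_subsetI) (simp only: eq mk_diagram_prop[OF code[OF G.inv_closed]])
    show "prop_diagrams p p p \<subseteq> perm_diagram p ` carrier (Sym p)"
    proof
      fix d assume "d \<in> prop_diagrams p p p"
      then obtain \<beta> h where c: "(\<beta>, h) \<in> codes p p" "d = mk_diagram p p \<beta> h" by (rule mk_diagram_surj)
      have im: "sel w (frame_image p \<beta>) = {1..sel w p}" for w
      proof -
        have "inj_on (sel w \<beta>) {1..sel w p}" "sel w \<beta> ` {1..sel w p} \<subseteq> {1..sel w p}"
          using c(1) unfolding codes_iff by blast+
        then show ?thesis unfolding sel_frame_image by (intro endo_inj_surj) simp_all
      qed
      have A: "frame_image p \<beta> = std p" using im[of Lft] im[of Rgt] by (simp add: prod_eq_iff)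
      have b: "\<beta> \<in> frames p (std p)" and h: "h \<in> sobj bij_species (diff2 (std p) (std p))"
        using c(1) unfolding codes_def mem_Collect_eq prod.case A by blast+
      have hu: "h = ?u" using h by (auto simp: bij_species_def diff2_def)
      obtain g where g: "g \<in> carrier (Sym p)" "\<beta> = frame_right p (std_frame p) g"
        using b by (rule frame_of_perm)
      have "d = perm_diagram p (inv\<^bsub>Sym p\<^esub> g)" unfolding c(2) hu g(2) perm_diagram_code[OF g(1)] ..
      then show "d \<in> perm_diagram p ` carrier (Sym p)" using G.inv_closed[OF g(1)] by blast
    qed
  qed
qed

lemma finite_Sym: "finite (carrier (Sym p))"
  using bij_betw_finite[OF bij_perm_diagram] finite_prop_diagrams by blast

subsection \<open>Multiplication of diagrams\<close>

lemma dmult_closed: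
  assumes "cring K" "\<delta> \<in> carrier K" "finite Z" "f \<in> carrier (free_mod K X')" "g \<in> carrier (free_mod K Y')"
  shows "dmult K \<delta> X Y Z f g \<in> carrier (free_mod K Z)"
proof -
  interpret K: cring K by fact
  have c: "f x \<in> carrier K" "g x \<in> carrier K" for x using assms(4,5) by (simp_all add: free_mod_carrier)
  have "dmult K \<delta> X Y Z f g z \<in> carrier K" for z
    using c assms(2) by (auto simp: dmult_def intro!: K.finsum_closed)
  moreover have "{z. dmult K \<delta> X Y Z f g z \<noteq> \<zero>\<^bsub>K\<^esub>} \<subseteq> Z" by (auto simp: dmult_def split: if_splits)
  ultimately show ?thesis using finite_subset[OF _ assms(3)] by (auto simp: free_mod_carrier)
qed

lemma dmult_linear_left:
  assumes "cring K" "\<delta> \<in> carrier K" "finite X" "finite Y" "finite Z" "g \<in> carrier (free_mod K Y')"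
  shows "linear_map K (free_mod K X') (free_mod K Z) (\<lambda>f. dmult K \<delta> X Y Z f g)"
proof -
  interpret K: cring K by fact
  have g: "g x \<in> carrier K" for x using assms(6) by (simp add: free_mod_carrier)
  have fin: "finite {q \<in> X \<times> Y. dcomp (fst q) (snd q) = z}" for z using assms(3,4) by simp
  show ?thesis
  proof (rule linear_mapI)
    fix f f' assume "f \<in> carrier (free_mod K X')" "f' \<in> carrier (free_mod K X')"
    then have f: "f x \<in> carrier K" "f' x \<in> carrier K" for x by (simp_all add: free_mod_carrier)
    show "dmult K \<delta> X Y Z (f \<oplus>\<^bsub>free_mod K X'\<^esub> f') g =
        dmult K \<delta> X Y Z f g \<oplus>\<^bsub>free_mod K Z\<^esub> dmult K \<delta> X Y Z f' g"
    proof
      fix z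
      show "dmult K \<delta> X Y Z (f \<oplus>\<^bsub>free_mod K X'\<^esub> f') g z =
          (dmult K \<delta> X Y Z f g \<oplus>\<^bsub>free_mod K Z\<^esub> dmult K \<delta> X Y Z f' g) z"
        using f g assms(2)
        by (simp add: free_mod_ops dmult_def K.l_distr K.r_distr K.finsum_addf Pi_def)
    qed
  next
    fix k f assume k: "k \<in> carrier K" and "f \<in> carrier (free_mod K X')"
    then have f: "f x \<in> carrier K" for x by (simp add: free_mod_carrier)
    show "dmult K \<delta> X Y Z (k \<odot>\<^bsub>free_mod K X'\<^esub> f) g = k \<odot>\<^bsub>free_mod K Z\<^esub> dmult K \<delta> X Y Z f g"
    proof
      fix z
      show "dmult K \<delta> X Y Z (k \<odot>\<^bsub>free_mod K X'\<^esub> f) g z = (k \<odot>\<^bsub>free_mod K Z\<^esub> dmult K \<delta> X Y Z f g) z"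
        using f g k assms(2)
        by (simp add: free_mod_ops dmult_def K.finsum_rdistr[OF fin] Pi_def K.m_ac)
    qed
  qed (rule dmult_closed[OF assms(1,2,5) _ assms(6)])
qed

lemma dmult_linear_right:
  assumes "cring K" "\<delta> \<in> carrier K" "finite X" "finite Y" "finite Z" "f \<in> carrier (free_mod K X')"
  shows "linear_map K (free_mod K Y') (free_mod K Z) (dmult K \<delta> X Y Z f)"
proof -
  interpret K: cring K by fact
  have f: "f x \<in> carrier K" for x using assms(6) by (simp add: free_mod_carrier)
  have fin: "finite {q \<in> X \<times> Y. dcomp (fst q) (snd q) = z}" for z using assms(3,4) by simp
  show ?thesis
  proof (rule linear_mapI)
    fix g g' assume "g \<in> carrier (free_mod K Y')" "g' \<in> carrier (free_mod K Y')"
    then have g: "g x \<in> carrier K" "g' x \<in> carrier K" for x by (simp_all add: free_mod_carrier)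
    show "dmult K \<delta> X Y Z f (g \<oplus>\<^bsub>free_mod K Y'\<^esub> g') =
        dmult K \<delta> X Y Z f g \<oplus>\<^bsub>free_mod K Z\<^esub> dmult K \<delta> X Y Z f g'"
    proof
      fix z
      show "dmult K \<delta> X Y Z f (g \<oplus>\<^bsub>free_mod K Y'\<^esub> g') z =
          (dmult K \<delta> X Y Z f g \<oplus>\<^bsub>free_mod K Z\<^esub> dmult K \<delta> X Y Z f g') z"
        using f g assms(2)
        by (simp add: free_mod_ops dmult_def K.r_distr K.finsum_addf Pi_def)
    qed
  next
    fix k g assume k: "k \<in> carrier K" and "g \<in> carrier (free_mod K Y')"
    then have g: "g x \<in> carrier K" for x by (simp add: free_mod_carrier)
    show "dmult K \<delta> X Y Z f (k \<odot>\<^bsub>free_mod K Y'\<^esub> g) = k \<odot>\<^bsub>free_mod K Z\<^esub> dmult K \<delta> X Y Z f g"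
    proof
      fix z
      show "dmult K \<delta> X Y Z f (k \<odot>\<^bsub>free_mod K Y'\<^esub> g) z = (k \<odot>\<^bsub>free_mod K Z\<^esub> dmult K \<delta> X Y Z f g) z"
        using f g k assms(2)
        by (simp add: free_mod_ops dmult_def K.finsum_rdistr[OF fin] Pi_def K.m_ac)
    qed
  qed (rule dmult_closed[OF assms(1,2,5,6)])
qed

text \<open>Of all pairs only \<open>(x, y)\<close> contributes, with coefficient
  \<open>\<delta>^0 = 1\<close>. The condition on \<open>Z\<close> says that the product is not one
  of those set to zero.\<close>

lemma dmult_delta:
  assumes "cring K" "\<delta> \<in> carrier K" "finite X" "finite Y" "x \<in> X" "y \<in> Y"
    and "dcomp x y \<in> Z" "loops x y = 0"
  shows "dmult K \<delta> X Y Z (delta K x) (delta K y) = delta K (dcomp x y)"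
proof
  fix z
  interpret K: cring K by fact
  let ?Q = "{q \<in> X \<times> Y. dcomp (fst q) (snd q) = z}"
  let ?t = "\<lambda>q. (\<delta> [^]\<^bsub>K\<^esub> loops (fst q) (snd q)) \<otimes>\<^bsub>K\<^esub> (delta K x (fst q) \<otimes>\<^bsub>K\<^esub> delta K y (snd q))"
  have fin: "finite ?Q" using assms(3,4) by simp
  have t: "?t q = (if (x, y) = q then \<one>\<^bsub>K\<^esub> else \<zero>\<^bsub>K\<^esub>)" for q
    using assms(2,8) by (cases q) (auto simp: delta_def)
  have sum: "(\<Oplus>\<^bsub>K\<^esub> q \<in> ?Q. ?t q) = (if dcomp x y = z then \<one>\<^bsub>K\<^esub> else \<zero>\<^bsub>K\<^esub>)"
  proof (cases "dcomp x y = z")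
    case True
    then have "(x, y) \<in> ?Q" using assms(5,6) by simp
    then show ?thesis
      unfolding t using K.finsum_singleton[OF _ fin, of "(x, y)" "\<lambda>q. \<one>\<^bsub>K\<^esub>"] True by simp
  next
    case False
    then have "(\<Oplus>\<^bsub>K\<^esub> q \<in> ?Q. ?t q) = (\<Oplus>\<^bsub>K\<^esub> q \<in> ?Q. \<zero>\<^bsub>K\<^esub>)"
      unfolding t by (intro K.finsum_cong') auto
    then show ?thesis using False by simp
  qed
  show "dmult K \<delta> X Y Z (delta K x) (delta K y) z = delta K (dcomp x y) z"
    unfolding dmult_def sum using assms(7) by (auto simp: delta_def)
qed

subsection \<open>The inflated module\<close>

locale inflation =
  fixes K :: "('k, 'z) ring_scheme" and \<delta> :: 'k and p r :: "nat \<times> nat"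
    and V :: "('k, 'v) module" and \<rho> :: "(nat \<Rightarrow> nat) \<times> (nat \<Rightarrow> nat) \<Rightarrow> 'v \<Rightarrow> 'v"
  assumes K: "cring K" and \<delta>: "\<delta> \<in> carrier K" and rep: "is_rep K (Sym p) V \<rho>"
begin

abbreviation "D \<equiv> prop_diagrams p r p"
abbreviation "KD \<equiv> free_mod K D"
abbreviation "SA \<equiv> carrier (sym_alg K \<delta> p)"
abbreviation "I \<equiv> infl K \<delta> p r V \<rho>"
abbreviation "I_act \<equiv> restrict_sym K r (infl_act K \<delta> p r V \<rho>)"
abbreviation "tens v d \<equiv> infl_pure K \<delta> p r V \<rho> v (delta K d)"

sublocale G: group "Sym p" by (rule group_Sym)

lemma V_module: "module K V" using rep by (simp add: is_rep_def)
lemma rep_linear: "g \<in> carrier (Sym p) \<Longrightarrow> linear_map K V V (\<rho> g)" using rep unfolding is_rep_def by blast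
lemma rep_action: "group_action (Sym p) (carrier V) \<rho>" using rep by (simp add: is_rep_def)

lemma sym_alg_carrier: "SA = carrier (free_mod K (prop_diagrams p p p))"
  by (simp add: sym_alg_def)

lemma perm_prop: "g \<in> carrier (Sym p) \<Longrightarrow> perm_diagram p g \<in> prop_diagrams p p p"
  using bij_betwE[OF bij_perm_diagram] by blast

lemma perm_delta: "g \<in> carrier (Sym p) \<Longrightarrow> delta K (perm_diagram p g) \<in> SA"
  unfolding sym_alg_carrier by (rule delta_closed[OF K perm_prop])

section \<open>The group algebra acting on both tensor factors\<close>

lemma right_act_linear_left:
  assumes "a \<in> SA"
  shows "linear_map K V V (\<lambda>v. rep_right_act p V \<rho> v a)"
  unfolding rep_right_act_def
proof (rule linear_map_finsum[OF V_module finite_Sym])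
  fix g assume g: "g \<in> carrier (Sym p)"
  show "linear_map K V V (\<lambda>v. a (perm_diagram p g) \<odot>\<^bsub>V\<^esub> \<rho> (inv\<^bsub>Sym p\<^esub> g) v)"
    by (rule linear_map_smult[OF V_module rep_linear[OF G.inv_closed[OF g]]])
      (use assms in \<open>simp add: sym_alg_carrier free_mod_carrier\<close>)
qed

lemma right_act_linear_right:
  assumes v: "v \<in> carrier V"
  shows "linear_map K (free_mod K (prop_diagrams p p p)) V (rep_right_act p V \<rho> v)"
  unfolding rep_right_act_def
proof (rule linear_map_finsum[OF V_module finite_Sym])
  interpret V: module K V by (rule V_module)
  fix g assume "g \<in> carrier (Sym p)"
  then have w: "\<rho> (inv\<^bsub>Sym p\<^esub> g) v \<in> carrier V" by (intro linear_mapD(1)[OF rep_linear v] G.inv_closed)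
  show "linear_map K (free_mod K (prop_diagrams p p p)) V
      (\<lambda>a. a (perm_diagram p g) \<odot>\<^bsub>V\<^esub> \<rho> (inv\<^bsub>Sym p\<^esub> g) v)"
    using w by (intro linear_mapI) (simp_all add: free_mod_carrier free_mod_ops V.smult_l_distr V.smult_assoc1)
qed

text \<open>Injectivity of \<open>perm_diagram\<close> singles out one summand.\<close>

lemma right_act_delta:
  assumes v: "v \<in> carrier V" and g: "g \<in> carrier (Sym p)"
  shows "rep_right_act p V \<rho> v (delta K (perm_diagram p g)) = \<rho> (inv\<^bsub>Sym p\<^esub> g) v"
proof -
  interpret V: module K V by (rule V_module)
  have w: "\<rho> (inv\<^bsub>Sym p\<^esub> h) v \<in> carrier V" if "h \<in> carrier (Sym p)" for h
    using that by (intro linear_mapD(1)[OF rep_linear v] G.inv_closed)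
  have "rep_right_act p V \<rho> v (delta K (perm_diagram p g)) =
      (\<Oplus>\<^bsub>V\<^esub> h \<in> carrier (Sym p). if g = h then \<rho> (inv\<^bsub>Sym p\<^esub> h) v else \<zero>\<^bsub>V\<^esub>)"
    unfolding rep_right_act_def
  proof (rule V.M.finsum_cong')
    fix h assume h: "h \<in> carrier (Sym p)"
    have "perm_diagram p h = perm_diagram p g \<longleftrightarrow> g = h"
      using inj_onD[OF bij_betw_imp_inj_on[OF bij_perm_diagram] _ h g] by blast
    then show "delta K (perm_diagram p g) (perm_diagram p h) \<odot>\<^bsub>V\<^esub> \<rho> (inv\<^bsub>Sym p\<^esub> h) v =
        (if g = h then \<rho> (inv\<^bsub>Sym p\<^esub> h) v else \<zero>\<^bsub>V\<^esub>)"
      using w[OF h] by (simp add: delta_def)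
  qed (use w in auto)
  also have "\<dots> = \<rho> (inv\<^bsub>Sym p\<^esub> g) v" using w by (intro V.M.finsum_singleton[OF g finite_Sym]) auto
  finally show ?thesis .
qed

lemma left_mult_linear_left:
  assumes "m \<in> carrier KD"
  shows "linear_map K (free_mod K (prop_diagrams p p p)) KD (\<lambda>a. bimod_left K \<delta> p r a m)"
  unfolding bimod_left_def
  by (rule dmult_linear_left[OF K \<delta> finite_diagrams finite_prop_diagrams finite_prop_diagrams assms])

lemma left_mult_linear_right:
  assumes "a \<in> SA"
  shows "linear_map K KD KD (bimod_left K \<delta> p r a)"
  unfolding bimod_left_def
  by (rule dmult_linear_right[OF K \<delta> finite_diagrams finite_prop_diagrams finite_prop_diagrams
        assms[unfolded sym_alg_carrier]])

lemma perm_left_prop: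
  assumes "d \<in> D" "g \<in> carrier (Sym p)"
  shows "dcomp (perm_diagram p g) d \<in> D"
proof -
  obtain \<beta> h where c: "(\<beta>, h) \<in> codes p r" "d = mk_diagram p r \<beta> h" using assms(1) by (rule mk_diagram_surj)
  show ?thesis
    unfolding c(2) dcomp_perm_mk_diagram[OF c(1) assms(2)]
    by (rule mk_diagram_prop[OF codes_right(1)[OF c(1) G.inv_closed[OF assms(2)]]])
qed

lemma perm_right_prop:
  assumes "d \<in> D" "g \<in> carrier (Sym r)"
  shows "dcomp d (perm_diagram r g) \<in> D"
proof -
  interpret Gr: group "Sym r" by (rule group_Sym)
  obtain \<beta> h where c: "(\<beta>, h) \<in> codes p r" "d = mk_diagram p r \<beta> h" using assms(1) by (rule mk_diagram_surj)
  show ?thesis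
    using mk_diagram_prop[OF codes_push(1)[OF c(1) Gr.inv_closed[OF assms(2)]]]
      dcomp_mk_diagram_perm[OF c(1) Gr.inv_closed[OF assms(2)]]
    unfolding c(2) Gr.inv_inv[OF assms(2)] by simp
qed

lemma left_mult_delta:
  assumes "d \<in> D" "g \<in> carrier (Sym p)"
  shows "bimod_left K \<delta> p r (delta K (perm_diagram p g)) (delta K d) = delta K (dcomp (perm_diagram p g) d)"
  unfolding bimod_left_def
proof (rule dmult_delta[OF K \<delta> finite_diagrams finite_prop_diagrams])
  show "perm_diagram p g \<in> diagrams p p" using perm_prop[OF assms(2)] prop_diagrams_sub by blast
  show "loops (perm_diagram p g) d = 0"
    using dcomp_perm_left(2)[OF _ assms(2)] assms(1) prop_diagrams_sub by blast
qed (use assms perm_left_prop in auto)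

sublocale T: tensor_product K V KD SA "rep_right_act p V \<rho>" "bimod_left K \<delta> p r"
proof (intro tensor_product.intro tensor_product_axioms.intro)
  show "module K V" by (rule V_module)
  show "module K KD" by (rule free_mod_module[OF K])
qed (rule linear_mapD(1)[OF right_act_linear_left] linear_mapD(1)[OF left_mult_linear_right]; assumption)+

lemma infl_module: "module K I"
  unfolding infl_def by (rule T.tensor_module)

lemma D_delta: "d \<in> D \<Longrightarrow> delta K d \<in> carrier KD"
  by (rule delta_closed[OF K])

lemma tens_closed: "v \<in> carrier V \<Longrightarrow> d \<in> D \<Longrightarrow> tens v d \<in> carrier I"
  unfolding infl_def infl_pure_def by (intro T.pure_closed D_delta)

lemma tens_linear: "d \<in> D \<Longrightarrow> linear_map K V I (\<lambda>v. tens v d)"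
  unfolding infl_def infl_pure_def by (intro T.pure_linear_left D_delta)

text \<open>The balancing relation in the form used from here on: a permutation crosses the tensor
  sign.\<close>

lemma tens_move:
  assumes "v \<in> carrier V" "d \<in> D" "g \<in> carrier (Sym p)"
  shows "tens (\<rho> (inv\<^bsub>Sym p\<^esub> g) v) d = tens v (dcomp (perm_diagram p g) d)"
  using T.pure_balanced[OF assms(1) D_delta[OF assms(2)] perm_delta[OF assms(3)]]
  unfolding right_act_delta[OF assms(1,3)] left_mult_delta[OF assms(2,3)] infl_pure_def .

lemma spanning_tens: "spanning K I {tens v d | v d. v \<in> carrier V \<and> d \<in> D}"
proof -
  have "{T.pure v m | v m. v \<in> carrier V \<and> m \<in> delta K ` D} = {tens v d | v d. v \<in> carrier V \<and> d \<in> D}"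
    unfolding infl_pure_def by blast
  then show ?thesis
    using T.spanning_pure[OF spanning_free_mod[OF K, of D]] unfolding infl_def by simp
qed

text \<open>Both sides are linear in \<open>a\<close> and in \<open>m\<close>. With \<open>m\<close>
  a diagram, \<open>a\<close> is reduced to the basis of permutation diagrams; with \<open>a\<close>
  arbitrary, \<open>m\<close> is then reduced to the basis of diagrams.\<close>

lemma balancedI:
  assumes W: "module K W"
    and left: "\<And>m. m \<in> carrier KD \<Longrightarrow> linear_map K V W (\<lambda>v. B v m)"
    and right: "\<And>v. v \<in> carrier V \<Longrightarrow> linear_map K KD W (B v)"
    and bal: "\<And>v d g. v \<in> carrier V \<Longrightarrow> d \<in> D \<Longrightarrow> g \<in> carrier (Sym p) \<Longrightarrow>
      B (\<rho> (inv\<^bsub>Sym p\<^esub> g) v) (delta K d) = B v (delta K (dcomp (perm_diagram p g) d))"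
    and v: "v \<in> carrier V" and a: "a \<in> SA" and m: "m \<in> carrier KD"
  shows "B (rep_right_act p V \<rho> v a) m = B v (bimod_left K \<delta> p r a m)"
proof -
  let ?KP = "free_mod K (prop_diagrams p p p)"
  have KP: "module K ?KP" and KDm: "module K KD" by (rule free_mod_module[OF K])+
  have aP: "a \<in> carrier ?KP" using a unfolding sym_alg_carrier .
  have basis: "B (rep_right_act p V \<rho> v a) (delta K d) = B v (bimod_left K \<delta> p r a (delta K d))"
    if d: "d \<in> D" for d
  proof (rule linear_map_eqI[where f = "\<lambda>a. B (rep_right_act p V \<rho> v a) (delta K d)" and
        g = "\<lambda>a. B v (bimod_left K \<delta> p r a (delta K d))", OF KP W _ _ spanning_free_mod[OF K] _ aP])
    show "linear_map K ?KP W (\<lambda>a. B (rep_right_act p V \<rho> v a) (delta K d))"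
      by (rule linear_map_compose[OF right_act_linear_right[OF v] left[OF D_delta[OF d]]])
    show "linear_map K ?KP W (\<lambda>a. B v (bimod_left K \<delta> p r a (delta K d)))"
      by (rule linear_map_compose[OF left_mult_linear_left[OF D_delta[OF d]] right[OF v]])
    fix s assume "s \<in> delta K ` prop_diagrams p p p"
    then have "s \<in> (\<lambda>g. delta K (perm_diagram p g)) ` carrier (Sym p)"
      by (simp only: bij_betw_imp_surj_on[OF bij_perm_diagram, symmetric] image_image)
    then obtain g where g: "s = delta K (perm_diagram p g)" "g \<in> carrier (Sym p)" by (rule imageE)
    show "B (rep_right_act p V \<rho> v s) (delta K d) = B v (bimod_left K \<delta> p r s (delta K d))"
      unfolding g(1) right_act_delta[OF v g(2)] left_mult_delta[OF d g(2)] by (rule bal[OF v d g(2)])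
  qed
  show ?thesis
  proof (rule linear_map_eqI[where f = "B (rep_right_act p V \<rho> v a)" and
        g = "\<lambda>m. B v (bimod_left K \<delta> p r a m)", OF KDm W _ _ spanning_free_mod[OF K] _ m])
    show "linear_map K KD W (B (rep_right_act p V \<rho> v a))"
      by (rule right[OF linear_mapD(1)[OF right_act_linear_left[OF a] v]])
    show "linear_map K KD W (\<lambda>m. B v (bimod_left K \<delta> p r a m))"
      by (rule linear_map_compose[OF left_mult_linear_right[OF a] right[OF v]])
  qed (use basis in blast)
qed

text \<open>A map out of the inflation is given by its values on a vector and a diagram; the
  extension to combinations of diagrams and to the whole group algebra is made here once and for
  all.\<close>

lemma infl_lift:
  assumes W: "module K W"
    and lin: "\<And>d. d \<in> D \<Longrightarrow> linear_map K V W (\<lambda>v. u v d)"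
    and bal: "\<And>v d g. v \<in> carrier V \<Longrightarrow> d \<in> D \<Longrightarrow> g \<in> carrier (Sym p) \<Longrightarrow>
      u (\<rho> (inv\<^bsub>Sym p\<^esub> g) v) d = u v (dcomp (perm_diagram p g) d)"
  shows "\<exists>\<phi>. linear_map K I W \<phi> \<and> (\<forall>v\<in>carrier V. \<forall>d\<in>D. \<phi> (tens v d) = u v d)"
proof -
  let ?B = "\<lambda>v. lincomb K W (u v)"
  have uc: "u v \<in> D \<rightarrow> carrier W" if "v \<in> carrier V" for v
    using linear_mapD(1)[OF lin] that by blast
  have right: "linear_map K KD W (?B v)" if "v \<in> carrier V" for v
    by (rule lincomb_linear[OF W uc[OF that]])
  have left: "linear_map K V W (\<lambda>v. ?B v m)" if m: "m \<in> carrier KD" for m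
    unfolding lincomb_def
    using m unfolding free_mod_carrier
    by (intro linear_map_finsum[OF W] linear_map_smult[OF W] lin) auto
  have val: "?B v (delta K d) = u v d" if "v \<in> carrier V" "d \<in> D" for v d
    by (rule lincomb_delta[OF W uc[OF that(1)] that(2)])
  have balB: "?B (\<rho> (inv\<^bsub>Sym p\<^esub> g) v) (delta K d) = ?B v (delta K (dcomp (perm_diagram p g) d))"
    if "v \<in> carrier V" "d \<in> D" "g \<in> carrier (Sym p)" for v d g
    unfolding val[OF linear_mapD(1)[OF rep_linear[OF G.inv_closed[OF that(3)]] that(1)] that(2)]
      val[OF that(1) perm_left_prop[OF that(2,3)]]
    by (rule bal[OF that])
  have "\<exists>\<phi>. linear_map K T.VM W \<phi> \<and>
    (\<forall>v\<in>carrier V. \<forall>m\<in>carrier KD. \<phi> (T.pure v m) = ?B v m) \<and>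
    (\<forall>x\<in>carrier T.F. \<phi> (T.N +>\<^bsub>T.F\<^esub> x) = lincomb K W (case_prod ?B) x)"
  proof (rule T.tensor_lift[OF W])
    show "?B (rep_right_act p V \<rho> v a) m = ?B v (bimod_left K \<delta> p r a m)"
      if "v \<in> carrier V" "a \<in> SA" "m \<in> carrier KD" for v a m
      by (rule balancedI[where B = ?B, OF W]) (fact left right balB that)+
  qed (fact left right)+
  then obtain \<phi> where "linear_map K T.VM W \<phi>"
    "\<forall>v\<in>carrier V. \<forall>m\<in>carrier KD. \<phi> (T.pure v m) = ?B v m"
    by (elim exE conjE)
  then show ?thesis
    unfolding infl_def infl_pure_def using D_delta val by (intro exI[of _ \<phi>]) simp
qed

text \<open>One permutation renumbers top ends, the other bottom ends. On codes this is
  precomposition of \<open>\<beta>\<close> against postcomposition.\<close>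

lemma perm_comm:
  assumes g: "g \<in> carrier (Sym r)" and g': "g' \<in> carrier (Sym p)" and d: "d \<in> D"
  shows "dcomp (dcomp (perm_diagram p g') d) (perm_diagram r (inv\<^bsub>Sym r\<^esub> g)) =
    dcomp (perm_diagram p g') (dcomp d (perm_diagram r (inv\<^bsub>Sym r\<^esub> g)))"
proof -
  note g'i = G.inv_closed[OF g']
  obtain \<beta> h where c: "(\<beta>, h) \<in> codes p r" "d = mk_diagram p r \<beta> h" using d by (rule mk_diagram_surj)
  have perm: "sel w (inv\<^bsub>Sym p\<^esub> g') permutes {1..sel w p}" for w
    using g'i unfolding Sym_carrier_iff by blast
  have "sel w (frame_push p g (frame_right p \<beta> (inv\<^bsub>Sym p\<^esub> g'))) =
      sel w (frame_right p (frame_push p g \<beta>) (inv\<^bsub>Sym p\<^esub> g'))" for w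
    unfolding sel_frame_push sel_frame_right using permutes_in_image[OF perm] by (intro restrict_ext) simp
  from this[of Lft] this[of Rgt]
  have "frame_push p g (frame_right p \<beta> (inv\<^bsub>Sym p\<^esub> g')) = frame_right p (frame_push p g \<beta>) (inv\<^bsub>Sym p\<^esub> g')"
    by (simp add: prod_eq_iff)
  then show ?thesis
    unfolding c(2) dcomp_perm_mk_diagram[OF c(1) g'] dcomp_mk_diagram_perm[OF c(1) g]
      dcomp_mk_diagram_perm[OF codes_right(1)[OF c(1) g'i] g] codes_right(2)[OF c(1) g'i]
      dcomp_perm_mk_diagram[OF codes_push(1)[OF c(1) g] g'] by simp
qed

text \<open>The action is the \<open>tensor_map\<close> of the identity and right multiplication by
  a permutation diagram. It is balanced because that multiplication commutes with the left group
  action.\<close>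

lemma infl_act_tens:
  assumes g: "g \<in> carrier (Sym r)"
  shows "linear_map K I I (I_act g)"
    and "v \<in> carrier V \<Longrightarrow> d \<in> D \<Longrightarrow>
      I_act g (tens v d) = tens v (dcomp d (perm_diagram r (inv\<^bsub>Sym r\<^esub> g)))"
proof -
  interpret Gr: group "Sym r" by (rule group_Sym)
  let ?gi = "inv\<^bsub>Sym r\<^esub> g"
  let ?b = "delta K (perm_diagram r ?gi)"
  let ?R = "\<lambda>m. bimod_right K \<delta> p r m ?b"
  have gi: "?gi \<in> carrier (Sym r)" by (rule Gr.inv_closed[OF g])
  have pd: "perm_diagram r ?gi \<in> diagrams r r"
    using bij_betwE[OF bij_perm_diagram, of r] gi prop_diagrams_sub by blast
  have b: "?b \<in> carrier (free_mod K (diagrams r r))" by (rule delta_closed[OF K pd])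
  have R: "linear_map K KD KD ?R"
    unfolding bimod_right_def
    by (rule dmult_linear_left[OF K \<delta> finite_prop_diagrams finite_diagrams finite_prop_diagrams b])
  have Rd: "?R (delta K d) = delta K (dcomp d (perm_diagram r ?gi))" if d: "d \<in> D" for d
    unfolding bimod_right_def
  proof (rule dmult_delta[OF K \<delta> finite_prop_diagrams finite_diagrams d pd perm_right_prop[OF d gi]])
    show "loops d (perm_diagram r ?gi) = 0"
      using dcomp_perm_right(2)[OF _ gi] d prop_diagrams_sub by blast
  qed
  have bal: "T.pure (rep_right_act p V \<rho> v a) (?R m) = T.pure v (?R (bimod_left K \<delta> p r a m))"
    if "v \<in> carrier V" "a \<in> SA" "m \<in> carrier KD" for v a m
  proof (rule balancedI[where B = "\<lambda>v m. T.pure v (?R m)", OF T.tensor_module])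
    show "linear_map K V T.VM (\<lambda>v. T.pure v (?R m))" if "m \<in> carrier KD" for m
      by (rule T.pure_linear_left[OF linear_mapD(1)[OF R that]])
    show "linear_map K KD T.VM (\<lambda>m. T.pure v (?R m))" if "v \<in> carrier V" for v
      by (rule linear_map_compose[OF R T.pure_linear_right[OF that]])
    fix v d g' assume vdg: "v \<in> carrier V" "d \<in> D" "g' \<in> carrier (Sym p)"
    show "T.pure (\<rho> (inv\<^bsub>Sym p\<^esub> g') v) (?R (delta K d)) = T.pure v (?R (delta K (dcomp (perm_diagram p g') d)))"
      unfolding Rd[OF vdg(2)] Rd[OF perm_left_prop[OF vdg(2,3)]] perm_comm[OF g vdg(3,2)]
      using tens_move[OF vdg(1) perm_right_prop[OF vdg(2) gi] vdg(3)] unfolding infl_pure_def .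
  qed (fact that)+
  let ?tm = "tensor_map K SA (rep_right_act p V \<rho>) V (bimod_left K \<delta> p r) KD (\<lambda>v. v) ?R"
  have lin: "linear_map K T.VM T.VM ?tm"
    by (rule tensor_map_pure_linear(1)[OF T.tensor_product_axioms T.tensor_product_axioms linear_map_id R]) (fact bal)
  have tmp: "?tm (T.pure v m) = T.pure v (?R m)" if "v \<in> carrier V" "m \<in> carrier KD" for v m
    by (rule tensor_map_pure_linear(2)[OF T.tensor_product_axioms T.tensor_product_axioms linear_map_id R])
      (fact bal that)+
  have bW: "?b \<in> carrier (walled_brauer K \<delta> r)" using b by (simp add: walled_brauer_def)
  \<comment> \<open>\<open>infl_act\<close> is a restricted function in both arguments, so its
    formula applies only after membership in the two carriers is known.\<close>
  have eq: "?tm X = I_act g X" if "X \<in> carrier I" for X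
    unfolding restrict_sym_def infl_act_def using that bW by simp
  show "linear_map K I I (I_act g)"
    by (rule linear_map_cong[OF lin[folded infl_def] infl_module eq])
  show "I_act g (tens v d) = tens v (dcomp d (perm_diagram r ?gi))"
    if "v \<in> carrier V" "d \<in> D"
    unfolding eq[OF tens_closed[OF that], symmetric]
    using tmp[OF that(1) D_delta[OF that(2)]] unfolding Rd[OF that(2)] infl_pure_def .
qed

end

subsection \<open>Equivariant functions on frames\<close>

lemma equivariantD:
  assumes "f \<in> equivariant p X \<alpha> A"
  shows "\<beta> \<in> frames p A \<Longrightarrow> f \<beta> \<in> X" "f \<in> extensional (frames p A)"
    "\<beta> \<in> frames p A \<Longrightarrow> g \<in> carrier (Sym p) \<Longrightarrow> f (frame_right p \<beta> g) = \<alpha> (inv\<^bsub>Sym p\<^esub> g) (f \<beta>)"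
  using assms unfolding equivariant_def PiE_def by blast+

lemma frame_right_one:
  assumes "\<beta> \<in> frames p A"
  shows "frame_right p \<beta> \<one>\<^bsub>Sym p\<^esub> = \<beta>"
proof -
  have "sel w \<one>\<^bsub>Sym p\<^esub> = id" for w by (cases w) (simp_all add: DirProd_def sym_group_one)
  then have "sel w (frame_right p \<beta> \<one>\<^bsub>Sym p\<^esub>) = sel w \<beta>" for w
    using assms unfolding frames_iff sel_frame_right
    by (intro extensionalityI[of _ "{1..sel w p}"]) auto
  from this[of Lft] this[of Rgt] show ?thesis by (simp add: prod_eq_iff)
qed

text \<open>The frames of \<open>A\<close> form a torsor: the value at one frame can be prescribed
  freely and forces all others.\<close>

lemma equivariant_evaluation:
  assumes act: "group_action (Sym p) X \<alpha>" and \<beta>: "\<beta> \<in> frames p A"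
  shows "bij_betw (\<lambda>f. f \<beta>) (equivariant p X \<alpha> A) X"
proof (rule bij_betw_imageI)
  interpret G: group "Sym p" by (rule group_Sym)
  interpret act: group_action "Sym p" X \<alpha> by (rule act)
  have clos: "\<alpha> g x \<in> X" if "g \<in> carrier (Sym p)" "x \<in> X" for g x
    using act.element_image[OF that] by blast
  show "inj_on (\<lambda>f. f \<beta>) (equivariant p X \<alpha> A)"
  proof (rule inj_onI)
    fix f h assume fh: "f \<in> equivariant p X \<alpha> A" "h \<in> equivariant p X \<alpha> A" "f \<beta> = h \<beta>"
    show "f = h"
    proof (rule extensionalityI[OF equivariantD(2)[OF fh(1)] equivariantD(2)[OF fh(2)]])
      fix \<beta>' assume "\<beta>' \<in> frames p A"
      with \<beta> obtain g where g: "g \<in> carrier (Sym p)" "\<beta>' = frame_right p \<beta> g" by (rule frame_torsor)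
      show "f \<beta>' = h \<beta>'"
        unfolding g(2) equivariantD(3)[OF fh(1) \<beta> g(1)] equivariantD(3)[OF fh(2) \<beta> g(1)] fh(3) ..
    qed
  qed
  show "(\<lambda>f. f \<beta>) ` equivariant p X \<alpha> A = X"
  proof
    show "(\<lambda>f. f \<beta>) ` equivariant p X \<alpha> A \<subseteq> X"
      by (rule image_subsetI) (rule equivariantD(1)[OF _ \<beta>])
    show "X \<subseteq> (\<lambda>f. f \<beta>) ` equivariant p X \<alpha> A"
    proof
      fix x assume x: "x \<in> X"
      \<comment> \<open>The frame \<open>\<beta>'\<close> is \<open>\<beta> g\<close> for exactly
        one \<open>g\<close>, and equivariance dictates the value of g^-1 on
        \<open>x\<close>.\<close>
      define f where "f = (\<lambda>\<beta>'\<in>frames p A.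
        \<alpha> (inv\<^bsub>Sym p\<^esub> (THE g. g \<in> carrier (Sym p) \<and> \<beta>' = frame_right p \<beta> g)) x)"
      have f: "f (frame_right p \<beta> g) = \<alpha> (inv\<^bsub>Sym p\<^esub> g) x" if g: "g \<in> carrier (Sym p)" for g
      proof -
        have "(THE h. h \<in> carrier (Sym p) \<and> frame_right p \<beta> g = frame_right p \<beta> h) = g"
          using g frame_right_cancel[OF \<beta> g] by (intro the_equality) blast+
        then show ?thesis using frame_right_frames[OF \<beta> g] by (simp add: f_def)
      qed
      have "f \<in> equivariant p X \<alpha> A"
      proof (rule equivariantI)
        show "f \<in> extensional (frames p A)" by (simp add: f_def)
      next
        fix \<beta>' assume "\<beta>' \<in> frames p A"
        with \<beta> obtain g where g: "g \<in> carrier (Sym p)" "\<beta>' = frame_right p \<beta> g" by (rule frame_torsor)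
        show "f \<beta>' \<in> X" unfolding g(2) f[OF g(1)] by (rule clos[OF G.inv_closed[OF g(1)] x])
      next
        fix \<beta>' h assume h: "h \<in> carrier (Sym p)" and "\<beta>' \<in> frames p A"
        from \<beta> this(2) obtain g where g: "g \<in> carrier (Sym p)" and b: "\<beta>' = frame_right p \<beta> g"
          by (rule frame_torsor)
        have "f (frame_right p \<beta>' h) = \<alpha> (inv\<^bsub>Sym p\<^esub> (g \<otimes>\<^bsub>Sym p\<^esub> h)) x"
          unfolding b frame_right_mult[OF g h] by (rule f) (rule G.m_closed[OF g h])
        also have "\<dots> = \<alpha> (inv\<^bsub>Sym p\<^esub> h) (f \<beta>')"
          \<comment> \<open>Inversion reverses the product, so the right action on frames matches
            the left action on \<open>X\<close>.\<close>
          unfolding G.inv_mult_group[OF g h]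
          by (simp only: act.composition_rule[OF x G.inv_closed[OF h] G.inv_closed[OF g]] b f[OF g])
        finally show "f (frame_right p \<beta>' h) = \<alpha> (inv\<^bsub>Sym p\<^esub> h) (f \<beta>')" .
      qed
      moreover have "f \<beta> = x"
      proof -
        have "f \<beta> = \<alpha> \<one>\<^bsub>Sym p\<^esub> x"
          using f[OF G.one_closed] unfolding frame_right_one[OF \<beta>] G.inv_one .
        then show ?thesis using x act.id_eq_one by (metis restrict_apply')
      qed
      ultimately show "x \<in> (\<lambda>f. f \<beta>) ` equivariant p X \<alpha> A" by (intro image_eqI[of _ _ f]) simp_all
    qed
  qed
qed

text \<open>The equivariant function with prescribed value at \<open>\<beta>\<close>; the pair of
  sets whose frames it takes as arguments is recovered from \<open>\<beta>\<close> as its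
  image.\<close>

definition frame_ext ::
    "nat \<times> nat \<Rightarrow> 'x set \<Rightarrow> ((nat \<Rightarrow> nat) \<times> (nat \<Rightarrow> nat) \<Rightarrow> 'x \<Rightarrow> 'x) \<Rightarrow>
     (nat \<Rightarrow> 'u) \<times> (nat \<Rightarrow> 'u) \<Rightarrow> 'x \<Rightarrow> (nat \<Rightarrow> 'u) \<times> (nat \<Rightarrow> 'u) \<Rightarrow> 'x" where
  "frame_ext p X \<alpha> \<beta> = inv_into (equivariant p X \<alpha> (frame_image p \<beta>)) (\<lambda>f. f \<beta>)"

context
  fixes p :: "nat \<times> nat" and X :: "'x set" and \<alpha>
  assumes act: "group_action (Sym p) X \<alpha>"
begin

lemma frame_ext_equivariant:
  assumes "\<beta> \<in> frames p A" "x \<in> X"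
  shows "frame_ext p X \<alpha> \<beta> x \<in> equivariant p X \<alpha> A" "frame_ext p X \<alpha> \<beta> x \<beta> = x"
proof -
  note ev = equivariant_evaluation[OF act assms(1), unfolded bij_betw_def]
  have x: "x \<in> (\<lambda>f. f \<beta>) ` equivariant p X \<alpha> A" using ev assms(2) by simp
  show "frame_ext p X \<alpha> \<beta> x \<in> equivariant p X \<alpha> A"
    unfolding frame_ext_def frame_image_eq[OF assms(1)] by (rule inv_into_into[OF x])
  show "frame_ext p X \<alpha> \<beta> x \<beta> = x"
    unfolding frame_ext_def frame_image_eq[OF assms(1)] by (rule f_inv_into_f[OF x])
qed

lemma frame_ext_unique:
  assumes "\<beta> \<in> frames p A" "f \<in> equivariant p X \<alpha> A"
  shows "frame_ext p X \<alpha> \<beta> (f \<beta>) = f"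
  unfolding frame_ext_def frame_image_eq[OF assms(1)]
  using inv_into_f_f[OF bij_betw_imp_inj_on[OF equivariant_evaluation[OF act assms(1)]] assms(2)] .

text \<open>Moving the frame by g^-1 and the value by \<open>g\<close> prescribes the same function.
  This is the balancing relation seen on the side of species.\<close>

lemma frame_ext_right:
  assumes "\<beta> \<in> frames p A" "x \<in> X" "g \<in> carrier (Sym p)"
  shows "frame_ext p X \<alpha> (frame_right p \<beta> (inv\<^bsub>Sym p\<^esub> g)) (\<alpha> g x) = frame_ext p X \<alpha> \<beta> x"
proof -
  interpret G: group "Sym p" by (rule group_Sym)
  note f = frame_ext_equivariant[OF assms(1,2)]
  have "frame_ext p X \<alpha> \<beta> x (frame_right p \<beta> (inv\<^bsub>Sym p\<^esub> g)) = \<alpha> g x"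
    unfolding equivariantD(3)[OF f(1) assms(1) G.inv_closed[OF assms(3)]] G.inv_inv[OF assms(3)] f(2) ..
  then show ?thesis
    using frame_ext_unique[OF frame_right_frames[OF assms(1) G.inv_closed[OF assms(3)]] f(1)] by simp
qed

text \<open>The transported function takes at the pushed frame the old value at
  \<open>\<beta>\<close>, because pulling back undoes pushing; uniqueness does the rest.\<close>

lemma frame_ext_push:
  assumes "\<beta> \<in> frames p A" "x \<in> X" "inj2 A \<sigma>"
  shows "(\<lambda>\<beta>'\<in>frames p (im2 \<sigma> A). frame_ext p X \<alpha> \<beta> x (frame_pull p A \<sigma> \<beta>')) =
    frame_ext p X \<alpha> (frame_push p \<sigma> \<beta>) x"
proof -
  note f = frame_ext_equivariant[OF assms(1,2)]
  let ?f = "\<lambda>\<beta>'\<in>frames p (im2 \<sigma> A). frame_ext p X \<alpha> \<beta> x (frame_pull p A \<sigma> \<beta>')"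
  have b: "frame_push p \<sigma> \<beta> \<in> frames p (im2 \<sigma> A)" by (rule frame_push_frames[OF assms(1,3)])
  have "?f (frame_push p \<sigma> \<beta>) = x" using b f(2) by (simp add: frame_pull_push[OF assms(1,3)])
  then show ?thesis
    using frame_ext_unique[OF b equivariant_pull[OF assms(3) f(1)]] by simp
qed

end

lemma frame_ext_linear:
  assumes rep: "is_rep K (Sym p) V \<rho>" and \<beta>: "\<beta> \<in> frames p A"
  shows "linear_map K V (lobj (module_species p V \<rho>) A) (frame_ext p (carrier V) \<rho> \<beta>)"
proof -
  have act: "group_action (Sym p) (carrier V) \<rho>" using rep by (simp add: is_rep_def)
  have car: "carrier (lobj (module_species p V \<rho>) A) = equivariant p (carrier V) \<rho> A"
    by (simp add: module_species_def)
  have "linear_map K (lobj (module_species p V \<rho>) A) V (\<lambda>f. f \<beta>)"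
    by (intro linear_mapI) (simp_all add: module_species_def \<beta> equivariantD(1)[OF _ \<beta>])
  from linear_map_inv_into[OF module_species_module[OF rep] this] show ?thesis
    unfolding car frame_ext_def frame_image_eq[OF \<beta>] using equivariant_evaluation[OF act \<beta>] by blast
qed

text \<open>Transport in a product of species looks up, for each target index \<open>j\<close>, the
  component at its preimage \<open>c j\<close>; hence the reindexing goes against the direction of
  the map.\<close>

lemma dsum_map_linear:
  assumes "\<And>j. j \<in> J \<Longrightarrow> c j \<in> I" "\<And>j. j \<in> J \<Longrightarrow> linear_map K (V (c j)) (W j) (t j)"
  shows "linear_map K (dsum I V) (dsum J W) (\<lambda>f. \<lambda>j\<in>J. t j (f (c j)))"
proof -
  have mem: "f (c j) \<in> carrier (V (c j))" if "f \<in> carrier (dsum I V)" "j \<in> J" for f j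
    using that assms(1) by (auto simp: dsum_carrier)
  show ?thesis
    using assms(1) linear_mapD[OF assms(2)] mem
    by (intro linear_mapI) (auto simp: dsum_carrier[of _ J] dsum_ops intro!: restrict_ext)
qed

lemma vim2_im2:
  assumes "inj2 U \<sigma>" "A \<in> parts U"
  shows "vim2 U \<sigma> (im2 \<sigma> A) = A"
proof -
  have "S \<inter> f -` f ` B = B" if "inj_on f S" "B \<subseteq> S" for f :: "'a \<Rightarrow> 'a" and S B
    using that by (auto dest: inj_onD)
  then show ?thesis using assms unfolding vim2_def im2_def inj2_def parts_def by (simp add: mem_Times_iff)
qed

lemma im2_vim2: "A' \<in> parts (im2 \<sigma> U) \<Longrightarrow> im2 \<sigma> (vim2 U \<sigma> A') = A'"
  by (auto simp: vim2_def im2_def parts_def)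

lemma vim2_parts: "vim2 U \<sigma> A' \<in> parts U"
  by (auto simp: vim2_def parts_def)



subsection \<open>The isomorphism\<close>

context inflation
begin

abbreviation "P \<equiv> parts (std r)"
abbreviation "FA A \<equiv> lobj (module_species p V \<rho>) A"
abbreviation "B A \<equiv> sobj bij_species (diff2 (std r) A)"
abbreviation "GA A \<equiv> lobj (lin_of K bij_species) (diff2 (std r) A)"
abbreviation "W \<equiv> lobj (V_H_species K p V \<rho>) (std r)"
abbreviation "W_act \<equiv> lmap (V_H_species K p V \<rho>) (std r)"
abbreviation "FG A \<equiv> tensor_K K (FA A) (GA A)"

abbreviation "FG_pure A f h \<equiv> pure_tensor_K K (FA A) (GA A) f (delta K h)"

text \<open>A pure tensor placed in one summand, its second factor a basis vector; pure tensors of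
  vectors with diagrams are sent to elements of this form.\<close>

definition generator where
  "generator A f h = dsum_single P FG A (FG_pure A f h)"

lemma W_eq: "W = dsum P FG"
  by (simp add: V_H_species_def lin_prod_def)

lemma GA_eq: "GA A = free_mod K (B A)"
  by (simp add: lin_of_def)

lemma FA_module: "module K (FA A)"
  by (rule module_species_module[OF rep])

lemma GA_module: "module K (GA A)"
  unfolding GA_eq by (rule free_mod_module[OF K])

lemma FG_tensor: "tensor_product K (FA A) (GA A) (carrier K) (\<lambda>v k. k \<odot>\<^bsub>FA A\<^esub> v) (smult (GA A))"
  by (rule tensor_product_K[OF FA_module GA_module])

lemma FG_module: "module K (FG A)"
  by (rule tensor_product.tensor_module[OF FG_tensor])

lemma W_module: "module K W"
  unfolding W_eq by (rule dsum_module[OF K FG_module])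

lemma finite_P: "finite P"
  by (simp add: parts_def)

lemma delta_GA: "h \<in> B A \<Longrightarrow> delta K h \<in> carrier (GA A)"
  unfolding GA_eq by (rule delta_closed[OF K])

lemma generator_linear: "h \<in> B A \<Longrightarrow> linear_map K (FA A) W (\<lambda>f. generator A f h)"
  unfolding generator_def W_eq
  by (rule linear_map_compose[OF tensor_product.pure_linear_left[OF FG_tensor delta_GA] dsum_single_linear[OF K FG_module]])

lemma spanning_generators:
  "spanning K W {generator A f h | A f h. A \<in> P \<and> f \<in> carrier (FA A) \<and> h \<in> B A}"
proof -
  have "spanning K (FG A) {pure_tensor_K K (FA A) (GA A) f m | f m. f \<in> carrier (FA A) \<and> m \<in> delta K ` B A}" for A
    by (rule tensor_product.spanning_pure[OF FG_tensor])
      (unfold GA_eq, rule spanning_free_mod[OF K])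
  from dsum_spanning[OF K FG_module finite_P this]
  have "spanning K W {dsum_single P FG A x | A x. A \<in> P \<and>
      x \<in> {pure_tensor_K K (FA A) (GA A) f m | f m. f \<in> carrier (FA A) \<and> m \<in> delta K ` B A}}"
    unfolding W_eq .
  moreover have "{dsum_single P FG A x | A x. A \<in> P \<and>
      x \<in> {pure_tensor_K K (FA A) (GA A) f m | f m. f \<in> carrier (FA A) \<and> m \<in> delta K ` B A}} =
      {generator A f h | A f h. A \<in> P \<and> f \<in> carrier (FA A) \<and> h \<in> B A}" (is "?L = ?R")
  proof (intro equalityI subsetI)
    fix x assume "x \<in> ?L"
    then obtain A f h where "A \<in> P" "f \<in> carrier (FA A)" "h \<in> B A"
      "x = dsum_single P FG A (FG_pure A f h)" by blast
    then show "x \<in> ?R" unfolding generator_def by blast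
  next
    fix x assume "x \<in> ?R"
    then obtain A f h where "A \<in> P" "f \<in> carrier (FA A)" "h \<in> B A" "x = generator A f h" by blast
    then show "x \<in> ?L" unfolding generator_def by blast
  qed
  ultimately show ?thesis by (simp only:)
qed

text \<open>At index \<open>A'\<close> the transport applies a tensor map to the component at the
  preimage of \<open>A'\<close>. An element supported at \<open>A\<close> thus becomes one supported
  at the image of \<open>A\<close>; elsewhere a linear map is applied to zero.\<close>

lemma lmap_generator:
  assumes g: "g \<in> carrier (Sym r)"
  shows "linear_map K W W (W_act g)"
    and "A \<in> P \<Longrightarrow> f \<in> carrier (FA A) \<Longrightarrow> h \<in> B A \<Longrightarrow>
      W_act g (generator A f h) =
      generator (im2 g A) (lmap (module_species p V \<rho>) A g f) (smap bij_species (diff2 (std r) A) g h)"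
proof -
  let ?c = "vim2 (std r) g"
  let ?lF = "\<lambda>A. lmap (module_species p V \<rho>) A g"
  let ?lG = "\<lambda>A. lmap (lin_of K bij_species) (diff2 (std r) A) g"
  let ?t = "\<lambda>A'. tensor_map_K K (FA A') (GA A') (?lF (?c A')) (?lG (?c A'))"
  have im: "im2 g (std r) = std r" and inj: "inj2 U g" for U using im2_Sym[OF g] by auto
  have fin: "fin2 A" if "A \<in> P" for A
    using that finite_subset by (fastforce simp: fin2_def parts_def)
  have im_c: "im2 g (?c A') = A'" if "A' \<in> P" for A'
    using im2_vim2[of A' g "std r"] that by (simp only: im)
  have c_im: "?c (im2 g A) = A" if "A \<in> P" for A by (rule vim2_im2[OF inj that])
  have im_P: "im2 g A \<in> P" if "A \<in> P" for A
    using parts_im2[OF that, of g] by (simp only: im)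
  have dif: "diff2 (std r) (im2 g A) = im2 g (diff2 (std r) A)" if "A \<in> P" for A
    using diff2_im2[OF inj that] by (simp only: im)
  have smap: "smap bij_species (diff2 (std r) A) g \<in> B A \<rightarrow> B (im2 g A)" if "A \<in> P" for A
    unfolding dif[OF that]
    by (rule is_set_species.smap_closed[OF bij_species_is_set_species fin2_diff2 inj]) (simp add: fin2_def)
  have lF: "linear_map K (FA A) (FA (im2 g A)) (?lF A)" if "A \<in> P" for A
    by (rule is_lin_species.lmap_linear[OF module_species_is_lin_species[OF rep] fin[OF that] inj])
  have lG_eq: "?lG A = push K (smap bij_species (diff2 (std r) A) g)" for A by (simp add: lin_of_def)
  have lG: "linear_map K (GA A) (GA (im2 g A)) (?lG A)" if "A \<in> P" for A
    unfolding GA_eq lG_eq by (rule push_linear[OF K smap[OF that]])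
  have lFc: "linear_map K (FA (?c A')) (FA A') (?lF (?c A'))" if "A' \<in> P" for A'
    using lF[OF vim2_parts[of "std r" g A']] by (simp only: im_c[OF that])
  have lGc: "linear_map K (GA (?c A')) (GA A') (?lG (?c A'))" if "A' \<in> P" for A'
    using lG[OF vim2_parts[of "std r" g A']] by (simp only: im_c[OF that])
  have t: "linear_map K (FG (?c A')) (FG A') (?t A')" if "A' \<in> P" for A'
    by (rule tensor_map_K_pure_linear(1)[OF FA_module GA_module FA_module GA_module lFc[OF that] lGc[OF that]])
  have lmap: "W_act g = (\<lambda>F. \<lambda>A'\<in>P. ?t A' (F (?c A')))"
    unfolding V_H_species_def lin_prod_def by (simp only: lin_species.simps im Let_def)
  show "linear_map K W W (W_act g)"
    unfolding lmap W_eq 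
    by (rule dsum_map_linear[where c = ?c and V = "\<lambda>A. FG A" and W = "\<lambda>A. FG A" and t = ?t])
      (rule vim2_parts, fact t)
  assume A: "A \<in> P" and f: "f \<in> carrier (FA A)" and h: "h \<in> B A"
  show "W_act g (generator A f h) =
      generator (im2 g A) (?lF A f) (smap bij_species (diff2 (std r) A) g h)"
    unfolding lmap generator_def dsum_single_def
  proof (rule restrict_ext)
    fix A' assume A': "A' \<in> P"
    have cP: "?c A' \<in> P" by (rule vim2_parts)
    have iff: "?c A' = A \<longleftrightarrow> A' = im2 g A" using im_c[OF A'] c_im[OF A] by metis
    show "?t A' ((\<lambda>A'\<in>P. if A' = A then FG_pure A f h else \<zero>\<^bsub>FG A'\<^esub>) (?c A')) =
        (if A' = im2 g A then pure_tensor_K K (FA (im2 g A)) (GA (im2 g A)) (?lF A f)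
            (delta K (smap bij_species (diff2 (std r) A) g h)) else \<zero>\<^bsub>FG A'\<^esub>)"
    proof (cases "A' = im2 g A")
      case True
      then have c: "?c A' = A" using iff by simp
      have "?t A' (FG_pure A f h) =
          pure_tensor_K K (FA A') (GA A') (?lF A f) (?lG A (delta K h))"
        using tensor_map_K_pure_linear(2)[OF FA_module GA_module FA_module GA_module lFc[OF A'] lGc[OF A']]
          f delta_GA[OF h] unfolding c by blast
      moreover have "?lG A (delta K h) = delta K (smap bij_species (diff2 (std r) A) g h)"
        unfolding lG_eq by (rule push_delta[OF K smap[OF A] h])
      ultimately show ?thesis using True A c cP by simp
    next
      case False
      then show ?thesis using iff cP linear_map_zero[OF FG_module FG_module t[OF A']] by simp
    qed
  qed
qed

section \<open>Mutually inverse maps between the inflation and the product of species\<close>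

abbreviation "ext \<beta> v \<equiv> frame_ext p (carrier V) \<rho> \<beta> v"

lemma FA_carrier: "carrier (FA A) = equivariant p (carrier V) \<rho> A"
  by (simp add: module_species_def)

lemma codesD:
  assumes "(\<beta>, h) \<in> codes p r"
  shows "frame_image p \<beta> \<in> P" "\<beta> \<in> frames p (frame_image p \<beta>)" "h \<in> B (frame_image p \<beta>)"
  using assms by (auto simp: codes_def)

text \<open>Defined on diagrams through \<open>decode\<close>. It is balanced because
  \<open>g\<close> replaces \<open>\<beta>\<close> by \<open>\<beta> g^-1\<close>, which keeps
  \<open>A\<close> and \<open>h\<close>, while the equivariant function prescribed by the moved data
  is the same.\<close>

lemma forward_map:
  "\<exists>\<Phi>. linear_map K I W \<Phi> \<and> (\<forall>v\<in>carrier V. \<forall>(\<beta>, h)\<in>codes p r.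
    \<Phi> (tens v (mk_diagram p r \<beta> h)) = generator (frame_image p \<beta>) (ext \<beta> v) h)"
proof -
  define u where "u v d = (case decode p r d of (\<beta>, h) \<Rightarrow> generator (frame_image p \<beta>) (ext \<beta> v) h)" for v d
  have u: "u v (mk_diagram p r \<beta> h) = generator (frame_image p \<beta>) (ext \<beta> v) h"
    if "(\<beta>, h) \<in> codes p r" for v \<beta> h
    by (simp add: u_def decode_mk_diagram[OF that])
  have "\<exists>\<Phi>. linear_map K I W \<Phi> \<and> (\<forall>v\<in>carrier V. \<forall>d\<in>D. \<Phi> (tens v d) = u v d)"
  proof (rule infl_lift[OF W_module])
    fix d assume "d \<in> D"
    then obtain \<beta> h where c: "(\<beta>, h) \<in> codes p r" "d = mk_diagram p r \<beta> h" by (rule mk_diagram_surj)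
    note A = codesD[OF c(1)]
    show "linear_map K V W (\<lambda>v. u v d)"
      unfolding c(2) u[OF c(1)]
      by (rule linear_map_compose[OF frame_ext_linear[OF rep A(2)] generator_linear[OF A(3)]])
  next
    fix v d g assume v: "v \<in> carrier V" and "d \<in> D" and g: "g \<in> carrier (Sym p)"
    from this(2) obtain \<beta> h where c: "(\<beta>, h) \<in> codes p r" "d = mk_diagram p r \<beta> h" by (rule mk_diagram_surj)
    note A = codesD[OF c(1)] and gi = G.inv_closed[OF g]
    interpret act: group_action "Sym p" "carrier V" \<rho> by (rule rep_action)
    have vi: "\<rho> (inv\<^bsub>Sym p\<^esub> g) v \<in> carrier V" by (rule linear_mapD(1)[OF rep_linear[OF gi] v])
    \<comment> \<open>Writes \<open>v\<close> as \<open>g\<close> applied to g^-1 v, the shape in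
      which \<open>frame_ext_right\<close> compares two prescriptions.\<close>
    have gv: "\<rho> g (\<rho> (inv\<^bsub>Sym p\<^esub> g) v) = v"
      using act.composition_rule[OF v g gi] act.id_eq_one v unfolding G.r_inv[OF g]
      by (metis restrict_apply')
    show "u (\<rho> (inv\<^bsub>Sym p\<^esub> g) v) d = u v (dcomp (perm_diagram p g) d)"
      unfolding c(2) dcomp_perm_mk_diagram[OF c(1) g] u[OF c(1)] u[OF codes_right(1)[OF c(1) gi]]
        codes_right(2)[OF c(1) gi]
      using frame_ext_right[OF rep_action A(2) vi g] unfolding gv by simp
  qed
  then obtain \<Phi> where Phi: "linear_map K I W \<Phi>" "\<forall>v\<in>carrier V. \<forall>d\<in>D. \<Phi> (tens v d) = u v d"
    by (elim exE conjE)
  have "\<Phi> (tens v (mk_diagram p r \<beta> h)) = generator (frame_image p \<beta>) (ext \<beta> v) h"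
    if "v \<in> carrier V" "(\<beta>, h) \<in> codes p r" for v \<beta> h
    using Phi(2) that mk_diagram_prop[OF that(2)] u[OF that(2)] by simp
  then show ?thesis using Phi(1) by (intro exI[of _ \<Phi>]) auto
qed

text \<open>Fixing the frame makes the map explicit: evaluate \<open>f\<close> at
  \<open>\<beta>\<close> and extend linearly over the bijections \<open>h\<close>.\<close>

lemma backward_component:
  assumes A: "A \<in> P" and \<beta>: "\<beta> \<in> frames p A"
  shows "\<exists>\<psi>. linear_map K (FG A) I \<psi> \<and> (\<forall>f\<in>carrier (FA A). \<forall>h\<in>B A.
    \<psi> (FG_pure A f h) = tens (f \<beta>) (mk_diagram p r \<beta> h))"
proof -
  interpret I: module K I by (rule infl_module)
  let ?B = "\<lambda>f. lincomb K I (\<lambda>h. tens (f \<beta>) (mk_diagram p r \<beta> h))"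
  have d: "mk_diagram p r \<beta> h \<in> D" if "h \<in> B A" for h
    by (rule mk_diagram_prop[OF codesI[OF A \<beta> that]])
  have ev: "linear_map K (FA A) V (\<lambda>f. f \<beta>)"
    by (intro linear_mapI) (simp_all add: module_species_def \<beta> equivariantD(1)[OF _ \<beta>])
  have uc: "(\<lambda>h. tens (f \<beta>) (mk_diagram p r \<beta> h)) \<in> B A \<rightarrow> carrier I" if "f \<in> carrier (FA A)" for f
    using tens_closed[OF linear_mapD(1)[OF ev that] d] by blast
  have right: "linear_map K (GA A) I (?B f)" if "f \<in> carrier (FA A)" for f
    unfolding GA_eq by (rule lincomb_linear[OF infl_module uc[OF that]])
  have left: "linear_map K (FA A) I (\<lambda>f. ?B f m)" if m: "m \<in> carrier (GA A)" for m
    unfolding lincomb_def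
  proof (rule linear_map_finsum[OF infl_module])
    show "finite {x. m x \<noteq> \<zero>\<^bsub>K\<^esub>}" using m unfolding GA_eq free_mod_carrier by blast
    fix h assume h: "h \<in> {x. m x \<noteq> \<zero>\<^bsub>K\<^esub>}"
    have mh: "m h \<in> carrier K" "h \<in> B A" using m h unfolding GA_eq free_mod_carrier by blast+
    show "linear_map K (FA A) I (\<lambda>f. m h \<odot>\<^bsub>I\<^esub> tens (f \<beta>) (mk_diagram p r \<beta> h))"
      by (rule linear_map_smult[OF infl_module linear_map_compose[OF ev tens_linear[OF d[OF mh(2)]]] mh(1)])
  qed
  have bal: "?B (k \<odot>\<^bsub>FA A\<^esub> f) m = ?B f (k \<odot>\<^bsub>GA A\<^esub> m)"
    if "f \<in> carrier (FA A)" "k \<in> carrier K" "m \<in> carrier (GA A)" for f k m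
    unfolding linear_mapD(3)[OF left[OF that(3)] that(2,1)] linear_mapD(3)[OF right[OF that(1)] that(2,3)] ..
  have "\<exists>\<phi>. linear_map K (FG A) I \<phi> \<and>
    (\<forall>f\<in>carrier (FA A). \<forall>m\<in>carrier (GA A). \<phi> (pure_tensor_K K (FA A) (GA A) f m) = ?B f m) \<and>
    (\<forall>x\<in>carrier (free_mod K (carrier (FA A) \<times> carrier (GA A))).
      \<phi> (tensor_rel K (carrier K) (\<lambda>v k. k \<odot>\<^bsub>FA A\<^esub> v) (FA A) (smult (GA A)) (GA A)
        +>\<^bsub>free_mod K (carrier (FA A) \<times> carrier (GA A))\<^esub> x) = lincomb K I (case_prod ?B) x)"
    by (rule tensor_product.tensor_lift[OF FG_tensor infl_module]) (fact left right bal)+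
  then obtain \<psi> where psi: "linear_map K (FG A) I \<psi>"
    "\<forall>f\<in>carrier (FA A). \<forall>m\<in>carrier (GA A). \<psi> (pure_tensor_K K (FA A) (GA A) f m) = ?B f m"
    by (elim exE conjE)
  have "\<psi> (FG_pure A f h) = tens (f \<beta>) (mk_diagram p r \<beta> h)"
    if "f \<in> carrier (FA A)" "h \<in> B A" for f h
    using bspec[OF bspec[OF psi(2) that(1)] delta_GA[OF that(2)]]
      lincomb_delta[OF infl_module uc[OF that(1)] that(2)] by (rule trans)
  then show ?thesis using psi(1) by (intro exI[of _ \<psi>]) simp
qed

text \<open>A frame is chosen once for each summand that has one; the conclusion records only that
  some frame of \<open>A\<close> computes the value. On summands without frames the component is the
  zero map.\<close>

lemma backward_map:
  "\<exists>\<Psi>. linear_map K W I \<Psi> \<and> (\<forall>A\<in>P. \<forall>f\<in>carrier (FA A). \<forall>h\<in>B A. frames p A \<noteq> {} \<longrightarrow>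
    (\<exists>\<beta>\<in>frames p A. \<Psi> (generator A f h) = tens (f \<beta>) (mk_diagram p r \<beta> h)))"
proof -
  have "\<exists>\<psi>. linear_map K (FG A) I \<psi> \<and> (frames p A \<noteq> {} \<longrightarrow> (\<exists>\<beta>\<in>frames p A. \<forall>f\<in>carrier (FA A). \<forall>h\<in>B A.
    \<psi> (FG_pure A f h) = tens (f \<beta>) (mk_diagram p r \<beta> h)))" if A: "A \<in> P" for A
  proof (cases "frames p A = {}")
    case True
    then show ?thesis using linear_map_zero_map[OF infl_module] by (intro exI conjI) simp_all
  next
    case False
    then obtain \<beta> where \<beta>: "\<beta> \<in> frames p A" by (metis ex_in_conv)
    obtain \<psi> where psi: "linear_map K (FG A) I \<psi>" "\<forall>f\<in>carrier (FA A). \<forall>h\<in>B A.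
        \<psi> (FG_pure A f h) = tens (f \<beta>) (mk_diagram p r \<beta> h)"
      using backward_component[OF A \<beta>] by (elim exE conjE)
    show ?thesis by (rule exI[of _ \<psi>], rule conjI[OF psi(1)], rule impI, rule bexI[of _ \<beta>])
      (rule psi(2), rule \<beta>)
  qed
  then have "\<forall>A\<in>P. \<exists>\<psi>. linear_map K (FG A) I \<psi> \<and> (frames p A \<noteq> {} \<longrightarrow> (\<exists>\<beta>\<in>frames p A. \<forall>f\<in>carrier (FA A). \<forall>h\<in>B A.
    \<psi> (FG_pure A f h) = tens (f \<beta>) (mk_diagram p r \<beta> h)))" by (rule ballI)
  from bchoice[OF this] obtain \<psi> where psi_all: "\<forall>A\<in>P. linear_map K (FG A) I (\<psi> A) \<and>
    (frames p A \<noteq> {} \<longrightarrow> (\<exists>\<beta>\<in>frames p A. \<forall>f\<in>carrier (FA A). \<forall>h\<in>B A.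
      \<psi> A (FG_pure A f h) = tens (f \<beta>) (mk_diagram p r \<beta> h)))"
    by (elim exE)
  note psi = conjunct1[OF bspec[OF psi_all]] mp[OF conjunct2[OF bspec[OF psi_all]]]
  let ?Psi = "\<lambda>F. \<Oplus>\<^bsub>I\<^esub> A\<in>P. \<psi> A (F A)"
  have val: "?Psi (generator A f h) = \<psi> A (FG_pure A f h)"
    if "A \<in> P" "f \<in> carrier (FA A)" "h \<in> B A" for A f h
    unfolding generator_def
    by (rule dsum_copair(2)[where V = "\<lambda>A. FG A" and \<psi> = \<psi> and i = A, OF K FG_module finite_P infl_module psi(1) that(1)
          tensor_product.pure_closed[OF FG_tensor that(2) delta_GA[OF that(3)]]])
  show ?thesis
  proof (intro exI[of _ ?Psi] conjI ballI impI)
    show "linear_map K W I ?Psi"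
      unfolding W_eq by (rule dsum_copair(1)[where V = "\<lambda>A. FG A" and \<psi> = \<psi>, OF K FG_module finite_P infl_module psi(1)])
    fix A f h assume A: "A \<in> P" and f: "f \<in> carrier (FA A)" and h: "h \<in> B A" and "frames p A \<noteq> {}"
    from psi(2)[OF A this(4)] obtain \<beta> where b: "\<beta> \<in> frames p A" "\<forall>f\<in>carrier (FA A). \<forall>h\<in>B A.
        \<psi> A (FG_pure A f h) = tens (f \<beta>) (mk_diagram p r \<beta> h)"
      by (elim bexE)
    show "\<exists>\<beta>\<in>frames p A. ?Psi (generator A f h) = tens (f \<beta>) (mk_diagram p r \<beta> h)"
      unfolding val[OF A f h] by (rule bexI[of _ \<beta>]) (fact bspec[OF bspec[OF b(2) f] h], fact b(1))
  qed
qed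

text \<open>Independence of the chosen frame: passing from \<open>\<beta>\<close> to
  \<open>\<beta> g\<close> moves vector and diagram by permutations that cancel across the tensor
  sign.\<close>

lemma tens_code_right:
  assumes "(\<beta>, h) \<in> codes p r" "v \<in> carrier V" "g \<in> carrier (Sym p)"
  shows "tens (\<rho> (inv\<^bsub>Sym p\<^esub> g) v) (mk_diagram p r (frame_right p \<beta> g) h) = tens v (mk_diagram p r \<beta> h)"
proof -
  note c = codes_right(1)[OF assms(1,3)]
  have "frame_right p (frame_right p \<beta> g) (inv\<^bsub>Sym p\<^esub> g) = \<beta>"
    unfolding frame_right_mult[OF assms(3) G.inv_closed[OF assms(3)]] G.r_inv[OF assms(3)]
    by (rule frame_right_one[OF codesD(2)[OF assms(1)]])
  then show ?thesis
    using tens_move[OF assms(2) mk_diagram_prop[OF c] assms(3)]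
    unfolding dcomp_perm_mk_diagram[OF c assms(3)] by simp
qed

text \<open>Besides the isomorphism its values on pure tensors are recorded, because the comparison
  of bases refers to this same map.\<close>

theorem infl_iso:
  "\<exists>\<Phi>. rep_iso K (Sym r) I (I_act) W (W_act) \<Phi> \<and>
    (\<forall>v\<in>carrier V. \<forall>(\<beta>, h)\<in>codes p r.
      \<Phi> (tens v (mk_diagram p r \<beta> h)) = generator (frame_image p \<beta>) (ext \<beta> v) h)"
proof -
  obtain \<Phi> where Phi: "linear_map K I W \<Phi>" and Phi_code: "\<forall>v\<in>carrier V. \<forall>(\<beta>, h)\<in>codes p r.
      \<Phi> (tens v (mk_diagram p r \<beta> h)) = generator (frame_image p \<beta>) (ext \<beta> v) h"
    using forward_map by (elim exE conjE)
  have Phi_val: "\<Phi> (tens v (mk_diagram p r \<beta> h)) = generator (frame_image p \<beta>) (ext \<beta> v) h"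
    if "v \<in> carrier V" "(\<beta>, h) \<in> codes p r" for v \<beta> h
    using bspec[OF bspec[OF Phi_code that(1)] that(2)] by simp
  obtain \<Psi> where Psi: "linear_map K W I \<Psi>" and Psi_gen: "\<forall>A\<in>P. \<forall>f\<in>carrier (FA A). \<forall>h\<in>B A. frames p A \<noteq> {} \<longrightarrow>
      (\<exists>\<beta>\<in>frames p A. \<Psi> (generator A f h) = tens (f \<beta>) (mk_diagram p r \<beta> h))"
    using backward_map by (elim exE conjE)
  have ext_FA: "ext \<beta> v \<in> carrier (FA A)" "ext \<beta> v \<beta> = v" if "\<beta> \<in> frames p A" "v \<in> carrier V" for \<beta> v A
    using frame_ext_equivariant[OF rep_action that] by (simp_all add: FA_carrier)
  have bij: "bij_betw \<Phi> (carrier I) (carrier W)"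
  proof (rule linear_bij[OF infl_module W_module Phi Psi spanning_tens _ spanning_generators])
    fix s assume "s \<in> {tens v d | v d. v \<in> carrier V \<and> d \<in> D}"
    then obtain v d where v: "v \<in> carrier V" and "d \<in> D" "s = tens v d" by blast
    then obtain \<beta> h where c: "(\<beta>, h) \<in> codes p r" and s: "s = tens v (mk_diagram p r \<beta> h)"
      by (metis mk_diagram_surj)
    note A = codesD[OF c]
    let ?f = "ext \<beta> v"
    have "frames p (frame_image p \<beta>) \<noteq> {}" using A(2) by blast
    then obtain \<beta>' where b': "\<beta>' \<in> frames p (frame_image p \<beta>)"
      "\<Psi> (generator (frame_image p \<beta>) ?f h) = tens (?f \<beta>') (mk_diagram p r \<beta>' h)"
      using Psi_gen A(1) ext_FA(1)[OF A(2) v] A(3) by blast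
    \<comment> \<open>The backward map uses its own frame \<open>\<beta>'\<close> of the same set,
      which differs from \<open>\<beta>\<close> by some \<open>g\<close>.\<close>
    obtain g where g: "g \<in> carrier (Sym p)" "\<beta>' = frame_right p \<beta> g"
      using A(2) b'(1) by (rule frame_torsor)
    have "?f \<beta>' = \<rho> (inv\<^bsub>Sym p\<^esub> g) v"
      using equivariantD(3)[OF ext_FA(1)[OF A(2) v, unfolded FA_carrier] A(2) g(1)]
      unfolding g(2) ext_FA(2)[OF A(2) v] .
    then show "\<Psi> (\<Phi> s) = s"
      unfolding s Phi_val[OF v c] b'(2) unfolding g(2) using tens_code_right[OF c v g(1)] by simp
  next
    fix s assume "s \<in> {generator A f h | A f h. A \<in> P \<and> f \<in> carrier (FA A) \<and> h \<in> B A}"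
    then obtain A f h where A: "A \<in> P" and f: "f \<in> carrier (FA A)" and h: "h \<in> B A" and s: "s = generator A f h"
      by blast
    show "\<Phi> (\<Psi> s) = s"
    proof (cases "frames p A = {}")
      case True
      \<comment> \<open>Without frames the only equivariant function is the empty one, which is
        zero; so the generator itself is zero.\<close>
      then have "f = \<zero>\<^bsub>FA A\<^esub>" using f by (auto simp: FA_carrier equivariant_def module_species_def)
      then have "s = \<zero>\<^bsub>W\<^esub>"
        unfolding s using linear_map_zero[OF FA_module W_module generator_linear[OF h]] by simp
      then show ?thesis
        using linear_map_zero[OF W_module infl_module Psi] linear_map_zero[OF infl_module W_module Phi] by simp
    next
      case False
      then obtain \<beta> where b: "\<beta> \<in> frames p A" "\<Psi> s = tens (f \<beta>) (mk_diagram p r \<beta> h)"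
        using Psi_gen A f h unfolding s by blast
      have fb: "f \<beta> \<in> carrier V" by (rule equivariantD(1)[OF f[unfolded FA_carrier] b(1)])
      have "\<Phi> (\<Psi> s) = generator A f h"
        unfolding b(2) Phi_val[OF fb codesI[OF A b(1) h]] frame_image_eq[OF b(1)]
          frame_ext_unique[OF rep_action b(1) f[unfolded FA_carrier]] ..
      then show ?thesis using s by simp
    qed
  qed
  \<comment> \<open>Both sides are linear. On a pure tensor, \<open>g\<close> pushes the code on one
    side and transports summand, function and bijection on the other.\<close>
  have equiv: "\<Phi> (I_act g x) = W_act g (\<Phi> x)"
    if g: "g \<in> carrier (Sym r)" and x: "x \<in> carrier I" for g x
  proof (rule linear_map_eqI[where f = "\<lambda>x. \<Phi> (I_act g x)" and
        g = "\<lambda>x. W_act g (\<Phi> x)", OF infl_module W_module _ _ spanning_tens _ x])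
    show "linear_map K I W (\<lambda>x. \<Phi> (I_act g x))"
      by (rule linear_map_compose[OF infl_act_tens(1)[OF g] Phi])
    show "linear_map K I W (\<lambda>x. W_act g (\<Phi> x))"
      by (rule linear_map_compose[OF Phi lmap_generator(1)[OF g]])
    fix s assume "s \<in> {tens v d | v d. v \<in> carrier V \<and> d \<in> D}"
    then obtain v d where v: "v \<in> carrier V" and "d \<in> D" "s = tens v d" by blast
    then obtain \<beta> h where c: "(\<beta>, h) \<in> codes p r" and s: "s = tens v (mk_diagram p r \<beta> h)"
      by (metis mk_diagram_surj)
    note A = codesD[OF c] and push = codes_push[OF c g]
    have inj: "inj2 (frame_image p \<beta>) g" by (rule im2_Sym(2)[OF g])
    have F: "lmap (module_species p V \<rho>) (frame_image p \<beta>) g (ext \<beta> v) = ext (frame_push p g \<beta>) v"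
      using frame_ext_push[OF rep_action A(2) v inj] by (simp add: module_species_def)
    show "\<Phi> (I_act g s) = W_act g (\<Phi> s)"
      unfolding s infl_act_tens(2)[OF g v mk_diagram_prop[OF c]] dcomp_mk_diagram_perm[OF c g]
        Phi_val[OF v c] Phi_val[OF v push(1)] push(2)
        lmap_generator(2)[OF g A(1) ext_FA(1)[OF A(2) v] A(3)] F ..
  qed
  show ?thesis
    unfolding rep_iso_def using Phi bij equiv Phi_code by (intro exI[of _ \<Phi>]) blast
qed

end

subsection \<open>Permutation representations\<close>

lemma perm_rep_iff_lincomb:
  "perm_rep K G X \<alpha> V \<rho> b \<longleftrightarrow> b \<in> X \<rightarrow> carrier V \<and>
     (\<forall>g\<in>carrier G. \<forall>x\<in>X. \<alpha> g x \<in> X \<and> b (\<alpha> g x) = \<rho> g (b x)) \<and>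
     bij_betw (lincomb K V b) (carrier (free_mod K X)) (carrier V)"
  by (simp add: perm_rep_def lincomb_def[abs_def])

lemma spanning_basis:
  assumes V: "module K V" and b: "b \<in> X \<rightarrow> carrier V"
    and bij: "bij_betw (lincomb K V b) (carrier (free_mod K X)) (carrier V)"
  shows "spanning K V (b ` X)"
proof -
  interpret V: module K V by (rule V)
  have "lincomb K V b ` delta K ` X = b ` X"
    unfolding image_image using lincomb_delta[OF V b] by (intro image_cong) simp_all
  then show ?thesis
    using spanning_image[OF free_mod_module[OF V.R.is_cring] V lincomb_linear[OF V b]
        bij_betw_imp_surj_on[OF bij] spanning_free_mod[OF V.R.is_cring]] by simp
qed

text \<open>The inverse of the new linear extension is a composite: the inverse of
  \<open>\<Phi>\<close>, coordinates with respect to \<open>b\<close>, and pushing forward along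
  \<open>\<phi>\<close>.\<close>

lemma perm_rep_transport:
  assumes V: "module K V" and W: "module K W"
    and perm: "perm_rep K G X \<alpha> V \<rho> b" and iso: "rep_iso K G V \<rho> W \<sigma> \<Phi>"
    and gset: "gset_iso G X \<alpha> Y \<beta> \<phi>" and comp: "\<And>x. x \<in> X \<Longrightarrow> \<Phi> (b x) = b' (\<phi> x)"
  shows "perm_rep K G Y \<beta> W \<sigma> b'"
proof -
  interpret V: module K V by (rule V)
  have cr: "cring K" by (rule V.R.is_cring)
  have b: "b \<in> X \<rightarrow> carrier V"
    and act: "\<And>g x. g \<in> carrier G \<Longrightarrow> x \<in> X \<Longrightarrow> \<alpha> g x \<in> X \<and> b (\<alpha> g x) = \<rho> g (b x)"
    and bij: "bij_betw (lincomb K V b) (carrier (free_mod K X)) (carrier V)"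
    using perm unfolding perm_rep_iff_lincomb by blast+
  have Phi: "linear_map K V W \<Phi>" "bij_betw \<Phi> (carrier V) (carrier W)"
    and Phi_act: "\<And>g v. g \<in> carrier G \<Longrightarrow> v \<in> carrier V \<Longrightarrow> \<Phi> (\<rho> g v) = \<sigma> g (\<Phi> v)"
    using iso unfolding rep_iso_def by blast+
  have phi: "bij_betw \<phi> X Y" and phi_act: "\<And>g x. g \<in> carrier G \<Longrightarrow> x \<in> X \<Longrightarrow> \<phi> (\<alpha> g x) = \<beta> g (\<phi> x)"
    using gset unfolding gset_iso_def by blast+
  have Y: "Y = \<phi> ` X" using bij_betw_imp_surj_on[OF phi] by simp
  have bx: "b x \<in> carrier V" if "x \<in> X" for x using b that by blast
  have b': "b' \<in> Y \<rightarrow> carrier W"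
    using comp linear_mapD(1)[OF Phi(1) bx] unfolding Y by (auto simp: comp[symmetric])
  let ?L = "lincomb K V b"
  let ?Li = "inv_into (carrier (free_mod K X)) ?L" and ?Pi = "inv_into (carrier V) \<Phi>"
  have Lin: "linear_map K (free_mod K X) V ?L" by (rule lincomb_linear[OF V b])
  have phiY: "\<phi> \<in> X \<rightarrow> Y" unfolding Y by blast
  have g: "linear_map K W (free_mod K Y) (\<lambda>w. push K \<phi> (?Li (?Pi w)))"
    by (rule linear_map_compose[OF linear_map_inv_into[OF V Phi] linear_map_compose[OF
          linear_map_inv_into[OF free_mod_module[OF cr] Lin bij] push_linear[OF cr phiY]]])
  have gb: "push K \<phi> (?Li (?Pi (b' (\<phi> x)))) = delta K (\<phi> x)" if x: "x \<in> X" for x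
  proof -
    have 1: "?Pi (b' (\<phi> x)) = b x"
      unfolding comp[OF x, symmetric] by (rule inv_into_f_f[OF bij_betw_imp_inj_on[OF Phi(2)] bx[OF x]])
    have "?Li (b x) = delta K x"
      using inv_into_f_f[OF bij_betw_imp_inj_on[OF bij] delta_closed[OF cr x]]
      unfolding lincomb_delta[OF V b x] .
    then show ?thesis unfolding 1 using push_delta[OF cr phiY x] by simp
  qed
  have span: "spanning K W (b' ` Y)"
  proof -
    have "b' ` Y = \<Phi> ` b ` X" unfolding Y image_image using comp by (intro image_cong) simp_all
    then show ?thesis
      using spanning_image[OF V W Phi(1) bij_betw_imp_surj_on[OF Phi(2)] spanning_basis[OF V b bij]] by simp
  qed
  have "bij_betw (lincomb K W b') (carrier (free_mod K Y)) (carrier W)"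
  proof (rule linear_bij[OF free_mod_module[OF cr] W lincomb_linear[OF W b'] g spanning_free_mod[OF cr] _ span])
    fix s assume "s \<in> delta K ` Y"
    then obtain x where x: "x \<in> X" "s = delta K (\<phi> x)" unfolding Y by blast
    then have "\<phi> x \<in> Y" unfolding Y by blast
    then have "lincomb K W b' s = b' (\<phi> x)" unfolding x(2) by (rule lincomb_delta[OF W b'])
    then show "push K \<phi> (?Li (?Pi (lincomb K W b' s))) = s" using gb[OF x(1)] x(2) by simp
  next
    fix s assume "s \<in> b' ` Y"
    then obtain x where x: "x \<in> X" "s = b' (\<phi> x)" unfolding Y by blast
    then have "\<phi> x \<in> Y" unfolding Y by blast
    then have "lincomb K W b' (delta K (\<phi> x)) = b' (\<phi> x)" by (rule lincomb_delta[OF W b'])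
    then show "lincomb K W b' (push K \<phi> (?Li (?Pi s))) = s" using gb[OF x(1)] x(2) by simp
  qed
  moreover have "\<beta> g y \<in> Y \<and> b' (\<beta> g y) = \<sigma> g (b' y)" if g: "g \<in> carrier G" and y: "y \<in> Y" for g y
  proof -
    obtain x where x: "x \<in> X" "y = \<phi> x" using y unfolding Y by blast
    note a = act[OF g x(1)]
    have "b' (\<beta> g y) = \<Phi> (b (\<alpha> g x))"
      unfolding x(2) phi_act[OF g x(1), symmetric] using comp[of "\<alpha> g x"] a by simp
    also have "\<dots> = \<sigma> g (b' y)"
      unfolding x(2) comp[OF x(1), symmetric] Phi_act[OF g bx[OF x(1)], symmetric] using a by simp
    finally show ?thesis using phi_act[OF g x(1)] a unfolding x(2) Y by (metis imageI)
  qed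
  ultimately show ?thesis unfolding perm_rep_iff_lincomb using b' by blast
qed

lemma the_elem_image_const:
  assumes "X \<noteq> {}" "\<And>x. x \<in> X \<Longrightarrow> f x = c"
  shows "the_elem (f ` X) = c"
proof -
  have "f ` X = {c}" using assms by auto
  then show ?thesis by simp
qed

locale permutation_inflation = inflation K \<delta> p r V \<rho>
  for K :: "('k, 'z) ring_scheme" and \<delta> :: 'k and p r :: "nat \<times> nat"
    and V :: "('k, 'v) module" and \<rho> :: "(nat \<Rightarrow> nat) \<times> (nat \<Rightarrow> nat) \<Rightarrow> 'v \<Rightarrow> 'v" +
  fixes T :: "'t set" and \<alpha> :: "(nat \<Rightarrow> nat) \<times> (nat \<Rightarrow> nat) \<Rightarrow> 't \<Rightarrow> 't" and b :: "'t \<Rightarrow> 'v"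
  assumes T_action: "group_action (Sym p) T \<alpha>" and perm: "perm_rep K (Sym p) T \<alpha> V \<rho> b"
begin

sublocale act: group_action "Sym p" T \<alpha> by (rule T_action)

section \<open>Orbits of the diagonal action as a basis of the inflation\<close>

definition cls :: "'t \<Rightarrow> diagram \<Rightarrow> ('t \<times> diagram) set" where
  "cls t d = (\<lambda>g. (\<alpha> g t, dcomp (perm_diagram p g) d)) ` carrier (Sym p)"

abbreviation "Q \<equiv> quot_set p r T \<alpha>"
abbreviation "qb \<equiv> quot_set_basis K \<delta> p r V \<rho> b"

lemma quot_eq: "Q = {cls t d | t d. t \<in> T \<and> d \<in> D}"
proof -
  have "orbit (Sym p) (\<lambda>g (t, d). (\<alpha> g t, dcomp (perm_diagram p g) d)) (t, d) = cls t d" for t d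
    unfolding orbit_def cls_def by (auto simp only: prod.case image_def Bex_def)
  then show ?thesis unfolding quot_set_def orbits_def by auto
qed

lemma clsE:
  assumes "x \<in> cls t d"
  obtains g where "g \<in> carrier (Sym p)" "x = (\<alpha> g t, dcomp (perm_diagram p g) d)"
  using assms unfolding cls_def by blast

lemma T_closed: "g \<in> carrier (Sym p) \<Longrightarrow> t \<in> T \<Longrightarrow> \<alpha> g t \<in> T"
  using act.element_image by blast

lemma T_one: "t \<in> T \<Longrightarrow> \<alpha> \<one>\<^bsub>Sym p\<^esub> t = t"
  using act.id_eq_one by (metis restrict_apply')

lemma T_inv: "g \<in> carrier (Sym p) \<Longrightarrow> t \<in> T \<Longrightarrow> \<alpha> g (\<alpha> (inv\<^bsub>Sym p\<^esub> g) t) = t"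
  using act.composition_rule[of t g "inv\<^bsub>Sym p\<^esub> g"] T_one G.inv_closed G.r_inv by simp

lemma T_inv': "g \<in> carrier (Sym p) \<Longrightarrow> t \<in> T \<Longrightarrow> \<alpha> (inv\<^bsub>Sym p\<^esub> g) (\<alpha> g t) = t"
  using T_inv[OF G.inv_closed] G.inv_inv by simp

lemma b_closed: "t \<in> T \<Longrightarrow> b t \<in> carrier V"
  using perm unfolding perm_rep_def by blast

lemma b_equivariant: "g \<in> carrier (Sym p) \<Longrightarrow> t \<in> T \<Longrightarrow> b (\<alpha> g t) = \<rho> g (b t)"
  using perm unfolding perm_rep_def by blast

lemma dcomp_perm_mult:
  assumes "d \<in> D" "g \<in> carrier (Sym p)" "g' \<in> carrier (Sym p)"
  shows "dcomp (perm_diagram p g) (dcomp (perm_diagram p g') d) = dcomp (perm_diagram p (g \<otimes>\<^bsub>Sym p\<^esub> g')) d"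
proof -
  obtain \<beta> h where c: "(\<beta>, h) \<in> codes p r" "d = mk_diagram p r \<beta> h" using assms(1) by (rule mk_diagram_surj)
  note gi = G.inv_closed[OF assms(2)] and g'i = G.inv_closed[OF assms(3)]
  show ?thesis
    unfolding c(2) dcomp_perm_mk_diagram[OF c(1) assms(3)] dcomp_perm_mk_diagram[OF codes_right(1)[OF c(1) g'i] assms(2)]
      dcomp_perm_mk_diagram[OF c(1) G.m_closed[OF assms(2,3)]] frame_right_mult[OF g'i gi]
      G.inv_mult_group[OF assms(2,3)] ..
qed

lemma dcomp_perm_one:
  assumes "d \<in> D"
  shows "dcomp (perm_diagram p \<one>\<^bsub>Sym p\<^esub>) d = d"
proof -
  obtain \<beta> h where c: "(\<beta>, h) \<in> codes p r" "d = mk_diagram p r \<beta> h" using assms(1) by (rule mk_diagram_surj)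
  show ?thesis
    unfolding c(2) dcomp_perm_mk_diagram[OF c(1) G.one_closed] G.inv_one frame_right_one[OF codesD(2)[OF c(1)]] ..
qed

lemma cls_self:
  assumes "t \<in> T" "d \<in> D"
  shows "(t, d) \<in> cls t d"
  unfolding cls_def
  by (rule image_eqI[OF _ G.one_closed]) (simp only: T_one[OF assms(1)] dcomp_perm_one[OF assms(2)])

lemma cls_move:
  assumes t: "t \<in> T" and d: "d \<in> D" and g: "g \<in> carrier (Sym p)"
  shows "cls (\<alpha> g t) (dcomp (perm_diagram p g) d) = cls t d"
proof -
  have sub: "cls (\<alpha> g t) (dcomp (perm_diagram p g) d) \<subseteq> cls t d"
    if "t \<in> T" "d \<in> D" "g \<in> carrier (Sym p)" for t d g
  proof
    fix x assume "x \<in> cls (\<alpha> g t) (dcomp (perm_diagram p g) d)"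
    then obtain g' where g': "g' \<in> carrier (Sym p)"
      "x = (\<alpha> g' (\<alpha> g t), dcomp (perm_diagram p g') (dcomp (perm_diagram p g) d))" by (rule clsE)
    have "x = (\<alpha> (g' \<otimes>\<^bsub>Sym p\<^esub> g) t, dcomp (perm_diagram p (g' \<otimes>\<^bsub>Sym p\<^esub> g)) d)"
      unfolding g'(2) dcomp_perm_mult[OF that(2) g'(1) that(3)] act.composition_rule[OF that(1) g'(1) that(3)] ..
    then show "x \<in> cls t d" unfolding cls_def using G.m_closed[OF g'(1) that(3)] by (rule image_eqI)
  qed
  have "cls t d \<subseteq> cls (\<alpha> g t) (dcomp (perm_diagram p g) d)"
    using sub[OF T_closed[OF g t] perm_left_prop[OF d g] G.inv_closed[OF g]]
    unfolding dcomp_perm_mult[OF d G.inv_closed[OF g] g] G.l_inv[OF g] dcomp_perm_one[OF d] T_inv'[OF g t] .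
  then show ?thesis using sub[OF t d g] by blast
qed

text \<open>\<open>quot_set_basis\<close> and the isomorphism of sets below are both the single
  value of a function on an orbit; constancy need only be checked against one
  representative.\<close>

lemma cls_image_const:
  assumes t: "t \<in> T" and d: "d \<in> D"
    and f: "\<And>g. g \<in> carrier (Sym p) \<Longrightarrow> f (\<alpha> g t) (dcomp (perm_diagram p g) d) = f t d"
  shows "the_elem ((\<lambda>(t, d). f t d) ` cls t d) = f t d"
proof (rule the_elem_image_const)
  show "cls t d \<noteq> {}" using cls_self[OF t d] by blast
  fix x assume "x \<in> cls t d"
  then show "(\<lambda>(t, d). f t d) x = f t d" by (rule clsE) (simp add: f)
qed

lemma quot_basis_cls:
  assumes "t \<in> T" "d \<in> D"
  shows "qb (cls t d) = tens (b t) d"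
  unfolding quot_set_basis_def
proof (rule cls_image_const[OF assms])
  fix g assume g: "g \<in> carrier (Sym p)"
  show "tens (b (\<alpha> g t)) (dcomp (perm_diagram p g) d) = tens (b t) d"
    using tens_move[OF b_closed[OF T_closed[OF g assms(1)]] assms(2) g]
    unfolding b_equivariant[OF G.inv_closed[OF g] T_closed[OF g assms(1)], symmetric] T_inv'[OF g assms(1)] by simp
qed

text \<open>The actions on the two edges commute, so acting on every member of an orbit yields the
  orbit of the moved representative.\<close>

lemma quot_act_cls:
  assumes t: "t \<in> T" and d: "d \<in> D" and g: "g \<in> carrier (Sym r)"
  shows "quot_set_act r g (cls t d) = cls t (dcomp d (perm_diagram r (inv\<^bsub>Sym r\<^esub> g)))"
  unfolding quot_set_act_def cls_def image_image prod.case
  using perm_comm[OF g _ d] by (intro image_cong) simp_all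

lemma cls_closed: "t \<in> T \<Longrightarrow> d \<in> D \<Longrightarrow> cls t d \<in> Q"
  unfolding quot_eq by blast

lemma quot_basis_closed: "qb \<in> Q \<rightarrow> carrier I"
  unfolding quot_eq using quot_basis_cls tens_closed b_closed by auto

abbreviation "lin_b \<equiv> lincomb K V b"
abbreviation "coord \<equiv> inv_into (carrier (free_mod K T)) lin_b"

lemma b_Pi: "b \<in> T \<rightarrow> carrier V" using b_closed by blast

lemma lin_b_bij: "bij_betw lin_b (carrier (free_mod K T)) (carrier V)"
  using perm unfolding perm_rep_iff_lincomb by blast

lemma coord_linear: "linear_map K V (free_mod K T) coord"
  by (rule linear_map_inv_into[OF free_mod_module[OF K] lincomb_linear[OF V_module b_Pi] lin_b_bij])

lemma coord_b: "t \<in> T \<Longrightarrow> coord (b t) = delta K t"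
  using inv_into_f_f[OF bij_betw_imp_inj_on[OF lin_b_bij] delta_closed[OF K]]
    lincomb_delta[OF V_module b_Pi] by metis

text \<open>The inverse of the linear extension of \<open>qb\<close>: expand \<open>v\<close> in the
  basis \<open>b\<close> and send each basis element \<open>t\<close> to the class of
  \<open>t\<close> and \<open>d\<close>. Balancing is tested on basis vectors, where it says that
  the class does not change along the orbit.\<close>

lemma coordinates:
  "\<exists>\<Xi>. linear_map K I (free_mod K Q) \<Xi> \<and> (\<forall>t\<in>T. \<forall>d\<in>D. \<Xi> (tens (b t) d) = delta K (cls t d))"
proof -
  let ?u = "\<lambda>v d. push K (\<lambda>t. cls t d) (coord v)"
  have KQ: "module K (free_mod K Q)" by (rule free_mod_module[OF K])
  have cl: "(\<lambda>t. cls t d) \<in> T \<rightarrow> Q" if "d \<in> D" for d using cls_closed that by blast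
  have lin: "linear_map K V (free_mod K Q) (\<lambda>v. ?u v d)" if "d \<in> D" for d
    by (rule linear_map_compose[OF coord_linear push_linear[OF K cl[OF that]]])
  have ub: "?u (b t) d = delta K (cls t d)" if "t \<in> T" "d \<in> D" for t d
    unfolding coord_b[OF that(1)] by (rule push_delta[OF K cl[OF that(2)] that(1)])
  have "\<exists>\<Xi>. linear_map K I (free_mod K Q) \<Xi> \<and> (\<forall>v\<in>carrier V. \<forall>d\<in>D. \<Xi> (tens v d) = ?u v d)"
  proof (rule infl_lift[OF KQ lin])
    fix v d g assume v: "v \<in> carrier V" and d: "d \<in> D" and g: "g \<in> carrier (Sym p)"
    note gi = G.inv_closed[OF g]
    show "?u (\<rho> (inv\<^bsub>Sym p\<^esub> g) v) d = ?u v (dcomp (perm_diagram p g) d)"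
    proof (rule linear_map_eqI[where f = "\<lambda>v. ?u (\<rho> (inv\<^bsub>Sym p\<^esub> g) v) d" and
          g = "\<lambda>v. ?u v (dcomp (perm_diagram p g) d)", OF V_module KQ _ _ spanning_basis[OF V_module b_Pi lin_b_bij] _ v])
      show "linear_map K V (free_mod K Q) (\<lambda>v. ?u (\<rho> (inv\<^bsub>Sym p\<^esub> g) v) d)"
        by (rule linear_map_compose[OF rep_linear[OF gi] lin[OF d]])
      show "linear_map K V (free_mod K Q) (\<lambda>v. ?u v (dcomp (perm_diagram p g) d))"
        by (rule lin[OF perm_left_prop[OF d g]])
      fix s assume "s \<in> b ` T"
      then obtain t where t: "s = b t" "t \<in> T" by (rule imageE)
      show "?u (\<rho> (inv\<^bsub>Sym p\<^esub> g) s) d = ?u s (dcomp (perm_diagram p g) d)"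
        unfolding t(1) b_equivariant[OF gi t(2), symmetric] ub[OF T_closed[OF gi t(2)] d]
          ub[OF t(2) perm_left_prop[OF d g]]
        using cls_move[OF T_closed[OF gi t(2)] d g] unfolding T_inv[OF g t(2)] by simp
    qed
  qed
  then obtain \<Xi> where Xi: "linear_map K I (free_mod K Q) \<Xi>" "\<forall>v\<in>carrier V. \<forall>d\<in>D. \<Xi> (tens v d) = ?u v d"
    by (elim exE conjE)
  have "\<Xi> (tens (b t) d) = delta K (cls t d)" if "t \<in> T" "d \<in> D" for t d
    using bspec[OF bspec[OF Xi(2) b_closed[OF that(1)]] that(2)] ub[OF that] by (rule trans)
  then show ?thesis using Xi(1) by (intro exI[of _ \<Xi>]) simp
qed

lemma quot_perm_rep:
  "perm_rep K (Sym r) Q (quot_set_act r) I (I_act) qb"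
  unfolding perm_rep_iff_lincomb
proof (intro conjI ballI)
  show "qb \<in> Q \<rightarrow> carrier I" by (rule quot_basis_closed)
  interpret Gr: group "Sym r" by (rule group_Sym)
  fix g x assume g: "g \<in> carrier (Sym r)" and "x \<in> Q"
  from this(2) obtain t d where td: "t \<in> T" "d \<in> D" and x: "x = cls t d" unfolding quot_eq by blast
  note dg = perm_right_prop[OF td(2) Gr.inv_closed[OF g]]
  show "quot_set_act r g x \<in> Q" unfolding x quot_act_cls[OF td g] by (rule cls_closed[OF td(1) dg])
  show "qb (quot_set_act r g x) = I_act g (qb x)"
    unfolding x quot_act_cls[OF td g] quot_basis_cls[OF td] quot_basis_cls[OF td(1) dg]
      infl_act_tens(2)[OF g b_closed[OF td(1)] td(2)] ..
next
  have KQ: "module K (free_mod K Q)" by (rule free_mod_module[OF K])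
  obtain \<Xi> where Xi: "linear_map K I (free_mod K Q) \<Xi>" and Xi_all: "\<forall>t\<in>T. \<forall>d\<in>D. \<Xi> (tens (b t) d) = delta K (cls t d)"
    using coordinates by (elim exE conjE)
  note Xi_b = bspec[OF bspec[OF Xi_all]]
  have lin: "linear_map K (free_mod K Q) I (lincomb K I qb)" by (rule lincomb_linear[OF infl_module quot_basis_closed])
  have lin_cls: "lincomb K I qb (delta K (cls t d)) = tens (b t) d" if "t \<in> T" "d \<in> D" for t d
    using lincomb_delta[OF infl_module quot_basis_closed cls_closed[OF that]] unfolding quot_basis_cls[OF that] .
  show "bij_betw (lincomb K I qb) (carrier (free_mod K Q)) (carrier I)"
  proof (rule linear_bij[OF KQ infl_module lin Xi spanning_free_mod[OF K] _ spanning_tens])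
    fix s assume "s \<in> delta K ` Q"
    then obtain t d where td: "t \<in> T" "d \<in> D" and s: "s = delta K (cls t d)" unfolding quot_eq by blast
    show "\<Xi> (lincomb K I qb s) = s" unfolding s lin_cls[OF td] by (rule Xi_b[OF td])
  next
    fix s assume "s \<in> {tens v d | v d. v \<in> carrier V \<and> d \<in> D}"
    then obtain v d where v: "v \<in> carrier V" and d: "d \<in> D" and s: "s = tens v d" by blast
    \<comment> \<open>The spanning tensors involve an arbitrary vector \<open>v\<close>; linearity
      in \<open>v\<close> reduces to \<open>v = b t\<close>, where both maps are known.\<close>
    have "lincomb K I qb (\<Xi> (tens v d)) = tens v d"
    proof (rule linear_map_eqI[where f = "\<lambda>v. lincomb K I qb (\<Xi> (tens v d))" and g = "\<lambda>v. tens v d",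
          OF V_module infl_module _ tens_linear[OF d] spanning_basis[OF V_module b_Pi lin_b_bij] _ v])
      show "linear_map K V I (\<lambda>v. lincomb K I qb (\<Xi> (tens v d)))"
        by (rule linear_map_compose[OF linear_map_compose[OF tens_linear[OF d] Xi] lin])
      fix s assume "s \<in> b ` T"
      then obtain t where t: "s = b t" "t \<in> T" by (rule imageE)
      show "lincomb K I qb (\<Xi> (tens s d)) = tens s d"
        unfolding t(1) Xi_b[OF t(2) d] by (rule lin_cls[OF t(2) d])
    qed
    then show "lincomb K I qb (\<Xi> s) = s" using s by simp
  qed
qed

text \<open>The set version of \<open>\<Phi>\<close>: the same recipe on codes, with elements of
  \<open>T\<close> in place of vectors.\<close>

definition species_iso where
  "species_iso X = the_elem ((\<lambda>(t, d). case decode p r d of (\<beta>, h) \<Rightarrow>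
     (frame_image p \<beta>, frame_ext p T \<alpha> \<beta> t, h)) ` X)"

lemma species_iso_cls:
  assumes "t \<in> T" "(\<beta>, h) \<in> codes p r"
  shows "species_iso (cls t (mk_diagram p r \<beta> h)) = (frame_image p \<beta>, frame_ext p T \<alpha> \<beta> t, h)"
proof -
  let ?f = "\<lambda>t d. case decode p r d of (\<beta>, h) \<Rightarrow> (frame_image p \<beta>, frame_ext p T \<alpha> \<beta> t, h)"
  have "species_iso (cls t (mk_diagram p r \<beta> h)) = ?f t (mk_diagram p r \<beta> h)"
    unfolding species_iso_def
  proof (rule cls_image_const[where f = ?f, OF assms(1) mk_diagram_prop[OF assms(2)]])
    fix g assume g: "g \<in> carrier (Sym p)"
    note gi = G.inv_closed[OF g]
    show "?f (\<alpha> g t) (dcomp (perm_diagram p g) (mk_diagram p r \<beta> h)) = ?f t (mk_diagram p r \<beta> h)"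
      unfolding dcomp_perm_mk_diagram[OF assms(2) g] decode_mk_diagram[OF assms(2)]
        decode_mk_diagram[OF codes_right(1)[OF assms(2) gi]] prod.case codes_right(2)[OF assms(2) gi]
        frame_ext_right[OF T_action codesD(2)[OF assms(2)] assms(1) g] ..
  qed
  then show ?thesis unfolding decode_mk_diagram[OF assms(2)] prod.case .
qed

abbreviation "TH \<equiv> T_H_species p T \<alpha> :: (nat, (nat set \<times> nat set) \<times> ((nat \<Rightarrow> nat) \<times> (nat \<Rightarrow> nat) \<Rightarrow> 't) \<times> (nat \<Rightarrow> nat)) set_species"

lemma TH_obj: "(A, f, h) \<in> sobj TH (std r) \<longleftrightarrow>
    A \<in> P \<and> frames p A \<noteq> {} \<and> f \<in> equivariant p T \<alpha> A \<and> h \<in> B A"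
  by (auto simp: T_H_species_def set_prod_def gset_species_def)

lemma quot_codeE:
  assumes "x \<in> Q"
  obtains t \<beta> h where "t \<in> T" "(\<beta>, h) \<in> codes p r" "x = cls t (mk_diagram p r \<beta> h)"
proof -
  obtain t d where td: "t \<in> T" "d \<in> D" "x = cls t d" using assms unfolding quot_eq by blast
  obtain \<beta> h where "(\<beta>, h) \<in> codes p r" "d = mk_diagram p r \<beta> h" using td(2) by (rule mk_diagram_surj)
  then show thesis using that[OF td(1)] td(3) by blast
qed

text \<open>Equal images give two frames of the same set, hence related by some \<open>g\<close>,
  and g^-1 carries one representative to the other. For surjectivity a given function is evaluated
  at any frame of its set.\<close>

lemma species_gset_iso: "gset_iso (Sym r) Q (quot_set_act r) (sobj TH (std r)) (smap TH (std r)) species_iso"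
  unfolding gset_iso_def
proof (intro conjI ballI)
  show "bij_betw species_iso Q (sobj TH (std r))"
  proof (rule bij_betw_imageI)
    show "inj_on species_iso Q"
    proof (rule inj_onI)
      fix x y assume x: "x \<in> Q" and y: "y \<in> Q" and eq: "species_iso x = species_iso y"
      obtain t \<beta> h where t: "t \<in> T" and c: "(\<beta>, h) \<in> codes p r" and x: "x = cls t (mk_diagram p r \<beta> h)"
        using x by (rule quot_codeE)
      obtain t' \<beta>' h' where t': "t' \<in> T" and c': "(\<beta>', h') \<in> codes p r" and y: "y = cls t' (mk_diagram p r \<beta>' h')"
        using y by (rule quot_codeE)
      have A: "frame_image p \<beta> = frame_image p \<beta>'" and f: "frame_ext p T \<alpha> \<beta> t = frame_ext p T \<alpha> \<beta>' t'" and h: "h = h'"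
        using eq unfolding x y species_iso_cls[OF t c] species_iso_cls[OF t' c'] by simp_all
      note b = codesD(2)[OF c] and b' = codesD(2)[OF c', folded A]
      obtain g where g: "g \<in> carrier (Sym p)" "\<beta>' = frame_right p \<beta> g" using b b' by (rule frame_torsor)
      note gi = G.inv_closed[OF g(1)]
      \<comment> \<open>The two functions coincide, so \<open>t'\<close> is the value of the
        function built from \<open>t\<close> at the frame \<open>\<beta>'\<close>.\<close>
      have "t' = frame_ext p T \<alpha> \<beta> t \<beta>'" unfolding f by (rule frame_ext_equivariant(2)[OF T_action b' t', symmetric])
      also have "\<dots> = \<alpha> (inv\<^bsub>Sym p\<^esub> g) t"
        unfolding g(2) equivariantD(3)[OF frame_ext_equivariant(1)[OF T_action b t] b g(1)]
          frame_ext_equivariant(2)[OF T_action b t] ..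
      finally have tt: "t' = \<alpha> (inv\<^bsub>Sym p\<^esub> g) t" .
      have dd: "mk_diagram p r \<beta>' h = dcomp (perm_diagram p (inv\<^bsub>Sym p\<^esub> g)) (mk_diagram p r \<beta> h)"
        unfolding dcomp_perm_mk_diagram[OF c gi] G.inv_inv[OF g(1)] g(2) ..
      show "x = y" unfolding x y tt h[symmetric] dd by (rule cls_move[OF t mk_diagram_prop[OF c] gi, symmetric])
    qed
    show "species_iso ` Q = sobj TH (std r)"
    proof
      show "species_iso ` Q \<subseteq> sobj TH (std r)"
      proof (rule image_subsetI)
        fix x assume "x \<in> Q"
        then obtain t \<beta> h where t: "t \<in> T" and c: "(\<beta>, h) \<in> codes p r" and x: "x = cls t (mk_diagram p r \<beta> h)"
          by (rule quot_codeE)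
        show "species_iso x \<in> sobj TH (std r)"
          unfolding x species_iso_cls[OF t c] TH_obj
          using codesD[OF c] frame_ext_equivariant(1)[OF T_action codesD(2)[OF c] t] by blast
      qed
      show "sobj TH (std r) \<subseteq> species_iso ` Q"
      proof
        fix y assume y: "y \<in> sobj TH (std r)"
        obtain A f h where Afh: "y = (A, f, h)" by (metis prod_cases3)
        then have A: "A \<in> P" "frames p A \<noteq> {}" and f: "f \<in> equivariant p T \<alpha> A" and h: "h \<in> B A"
          using y TH_obj by blast+
        \<comment> \<open>The set-valued species is prescribed to be empty at \<open>A\<close>
          unless \<open>A\<close> has frames, and this supplies one here. Otherwise the empty
          function would be an element outside the image.\<close>
        obtain \<beta> where b: "\<beta> \<in> frames p A" using A(2) by (metis ex_in_conv)
        note c = codesI[OF A(1) b h] and t = equivariantD(1)[OF f b]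
        have "species_iso (cls (f \<beta>) (mk_diagram p r \<beta> h)) = y"
          unfolding species_iso_cls[OF t c] frame_image_eq[OF b] frame_ext_unique[OF T_action b f] Afh ..
        then show "y \<in> species_iso ` Q" using cls_closed[OF t mk_diagram_prop[OF c]] by blast
      qed
    qed
  qed
  fix g x assume g: "g \<in> carrier (Sym r)" and "x \<in> Q"
  from this(2) obtain t \<beta> h where t: "t \<in> T" and c: "(\<beta>, h) \<in> codes p r" and x: "x = cls t (mk_diagram p r \<beta> h)"
    by (rule quot_codeE)
  have inj: "inj2 (frame_image p \<beta>) g" by (rule im2_Sym(2)[OF g])
  have smap: "smap TH (std r) g (A, f, h) = (im2 g A, \<lambda>\<beta>'\<in>frames p (im2 g A). f (frame_pull p A g \<beta>'),
      smap bij_species (diff2 (std r) A) g h)" for A f h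
    by (simp add: T_H_species_def set_prod_def gset_species_def)
  show "species_iso (quot_set_act r g x) = smap TH (std r) g (species_iso x)"
    unfolding x quot_act_cls[OF t mk_diagram_prop[OF c] g] dcomp_mk_diagram_perm[OF c g]
      species_iso_cls[OF t codes_push(1)[OF c g]] species_iso_cls[OF t c] codes_push(2)[OF c g] smap
      frame_ext_push[OF T_action codesD(2)[OF c] t inj] ..
qed

lemma T_H_basis_generator:
  "T_H_basis K p V \<rho> b (std r) (A, f, h) = generator A (\<lambda>\<beta>\<in>frames p A. b (f \<beta>)) h"
  unfolding T_H_basis_def generator_def dsum_single_def prod.case Let_def
  by (intro restrict_ext) simp

text \<open>Composing with the equivariant map \<open>b\<close> turns a \<open>T\<close>-valued
  equivariant function into a \<open>V\<close>-valued one. Its value at \<open>\<beta>\<close> is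
  \<open>b t\<close>, so by uniqueness it is \<open>ext \<beta> (b t)\<close>, and the recipes for
  sets and for vectors agree.\<close>

lemma iso_basis:
  assumes Phi: "\<forall>v\<in>carrier V. \<forall>(\<beta>, h)\<in>codes p r.
      \<Phi> (tens v (mk_diagram p r \<beta> h)) = generator (frame_image p \<beta>) (ext \<beta> v) h"
    and "x \<in> Q"
  shows "\<Phi> (qb x) = T_H_basis K p V \<rho> b (std r) (species_iso x)"
proof -
  obtain t \<beta> h where t: "t \<in> T" and c: "(\<beta>, h) \<in> codes p r" and x: "x = cls t (mk_diagram p r \<beta> h)"
    using assms(2) by (rule quot_codeE)
  let ?A = "frame_image p \<beta>"
  note f = frame_ext_equivariant[OF T_action codesD(2)[OF c] t]
  let ?e = "\<lambda>\<beta>'\<in>frames p ?A. b (frame_ext p T \<alpha> \<beta> t \<beta>')"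
  have "?e \<in> equivariant p (carrier V) \<rho> ?A"
  proof (rule equivariantI)
    fix \<beta>' assume b': "\<beta>' \<in> frames p ?A"
    show "?e \<beta>' \<in> carrier V" using b_closed[OF equivariantD(1)[OF f(1) b']] b' by simp
    fix g assume g: "g \<in> carrier (Sym p)"
    show "?e (frame_right p \<beta>' g) = \<rho> (inv\<^bsub>Sym p\<^esub> g) (?e \<beta>')"
      using frame_right_frames[OF b' g] b' equivariantD(3)[OF f(1) b' g]
        b_equivariant[OF G.inv_closed[OF g] equivariantD(1)[OF f(1) b']] by simp
  qed simp
  from frame_ext_unique[OF rep_action codesD(2)[OF c] this]
  have e: "ext \<beta> (b t) = ?e" using codesD(2)[OF c] f(2) by simp
  have "\<Phi> (qb x) = generator ?A (ext \<beta> (b t)) h"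
    unfolding x quot_basis_cls[OF t mk_diagram_prop[OF c]]
    using bspec[OF bspec[OF Phi b_closed[OF t]] c] by simp
  then show ?thesis
    unfolding x species_iso_cls[OF t c] T_H_basis_generator e .
qed

end

theorem theorem9p2p6:
  fixes K :: "('k, 'z) ring_scheme" and \<delta> :: 'k
    and p r :: "nat \<times> nat"
    and V :: "('k, 'v) module"
    and \<rho> :: "(nat \<Rightarrow> nat) \<times> (nat \<Rightarrow> nat) \<Rightarrow> 'v \<Rightarrow> 'v"
  assumes "field K" and "\<delta> \<in> carrier K"
    and "fst p \<le> fst r" and "snd p \<le> snd r"
    and "is_rep K (Sym p) V \<rho>"
  shows "\<exists>\<Phi>. rep_iso K (Sym r)
        (infl K \<delta> p r V \<rho>) (restrict_sym K r (infl_act K \<delta> p r V \<rho>))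
        (lobj (V_H_species K p V \<rho>) (std r)) (lmap (V_H_species K p V \<rho>) (std r)) \<Phi> \<and>
      (\<forall>(T :: 't set) \<alpha> b.
        group_action (Sym p) T \<alpha> \<and> perm_rep K (Sym p) T \<alpha> V \<rho> b \<longrightarrow>
          perm_rep K (Sym r) (quot_set p r T \<alpha>) (quot_set_act r)
            (infl K \<delta> p r V \<rho>) (restrict_sym K r (infl_act K \<delta> p r V \<rho>))
            (quot_set_basis K \<delta> p r V \<rho> b) \<and>
          perm_rep K (Sym r) (sobj (T_H_species p T \<alpha>) (std r)) (smap (T_H_species p T \<alpha>) (std r))
            (lobj (V_H_species K p V \<rho>) (std r)) (lmap (V_H_species K p V \<rho>) (std r))
            (T_H_basis K p V \<rho> b (std r)) \<and>
          (\<exists>\<phi>. gset_iso (Sym r)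
              (quot_set p r T \<alpha>) (quot_set_act r)
              (sobj (T_H_species p T \<alpha>) (std r)) (smap (T_H_species p T \<alpha>) (std r)) \<phi> \<and>
            (\<forall>x \<in> quot_set p r T \<alpha>.
              \<Phi> (quot_set_basis K \<delta> p r V \<rho> b x) = T_H_basis K p V \<rho> b (std r) (\<phi> x))))"
proof -
  interpret inflation K \<delta> p r V \<rho>
    by (rule inflation.intro[OF domain.axioms(1)[OF field.axioms(1)[OF assms(1)]] assms(2,5)])
  obtain \<Phi> where iso: "rep_iso K (Sym r) I (I_act) W (W_act) \<Phi>"
    and Phi: "\<forall>v\<in>carrier V. \<forall>(\<beta>, h)\<in>codes p r.
      \<Phi> (tens v (mk_diagram p r \<beta> h)) = generator (frame_image p \<beta>) (ext \<beta> v) h"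
    using infl_iso by (elim exE conjE)
  show ?thesis
  proof (rule exI[of _ \<Phi>], rule conjI[OF iso], intro allI impI, elim conjE)
    fix T :: "'t set" and \<alpha> b
    assume "group_action (Sym p) T \<alpha>" and "perm_rep K (Sym p) T \<alpha> V \<rho> b"
    then interpret permutation_inflation K \<delta> p r V \<rho> T \<alpha> b
      by (intro permutation_inflation.intro permutation_inflation_axioms.intro inflation_axioms)
    note compat = iso_basis[OF Phi]
    show "perm_rep K (Sym r) Q (quot_set_act r) I (I_act) qb \<and>
        perm_rep K (Sym r) (sobj TH (std r)) (smap TH (std r)) W (W_act)
          (T_H_basis K p V \<rho> b (std r)) \<and>
        (\<exists>\<phi>. gset_iso (Sym r) Q (quot_set_act r) (sobj TH (std r)) (smap TH (std r)) \<phi> \<and>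
          (\<forall>x\<in>Q. \<Phi> (qb x) = T_H_basis K p V \<rho> b (std r) (\<phi> x)))"
    proof (intro conjI exI[of _ species_iso] ballI)
      \<comment> \<open>The basis of the product of species is not verified directly: it is the
        basis of the inflation, carried over by \<open>\<Phi>\<close> and the bijection of
        sets.\<close>
      show "perm_rep K (Sym r) (sobj TH (std r)) (smap TH (std r)) W (W_act)
          (T_H_basis K p V \<rho> b (std r))"
        by (rule perm_rep_transport[OF infl_module W_module quot_perm_rep iso species_gset_iso compat])
    qed (fact quot_perm_rep species_gset_iso compat)+
  qed
qed

end
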